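(* Let $0\le q\le p$ be integers, let $k_0,k_1,\dots,k_p,m$ be positive integers, $\mathbf{k}=(k_0,\dots,k_p)$, and let $0<x_1<\dots<x_q<a<1<x_{q+1}<\dots<x_p$ be real numbers. Let $\mathbf{B}^*=(B_0^*,\dots,B_p^* )=\mathbf{B}^*(x_1,\dots,x_p;a)$ and $\phi(z;q,m,p,\mathbf{k},\mathbf{B}^* )$ be the vector and the conformal map defined in the context. Then the error of the best uniform approximation of the function $\operatorname{sgn}(x)$ on the set $\{x\in\mathbb{R}:\ |x|\in[a,1]\}$ by rational functions of the form $$\frac{c_nx^n+c_{n-1}x^{n-1}+\dots+c_0}{x^{2k_0-1}(x^2-x_1^2)^{k_1}\cdots(x^2-x_p^2)^{k_p}},\qquad n=2\Big(m-1+\sum_{j=0}^p k_j\Big),$$ with real coefficients $c_0,\dots,c_n$, is equal to $$L=\frac{1}{\cosh B_0^*(x_1,\dots,x_p;a)},$$ and the extremal rational function is given by $$f(x)=1-(-1)^{\sum_{j=0}^q k_j}\,L\,\cos\phi(x;q,m,p,\mathbf{k},\mathbf{B}^* ),\qquad x>0.$$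
   Context: Comb domain. Given integers $0\le q\le p$, positive integers $k_0,\dots,k_p,m$ and $\mathbf{B}=(B_0,\dots,B_p)$ with all $B_j\in(0,\infty)$, $\Omega^{\mathbf{k}}_{q,m,p}(\mathbf{B})$ is the subdomain of the half-strip $\{w=u+iv:\ v>0,\ 0<u<\pi(\sum_{j=0}^p k_j+m)\}$ obtained by deleting the set $$E=\Big\{w=u+iv:\ \Big|u-\pi\sum_{j=0}^q k_j\Big|\le\arccos\Big(\frac{\cosh B_0}{\cosh v}\Big),\ v\ge B_0\Big\}$$ and the vertical rays $l_j=\{w=u+iv:\ u=u_j,\ v\ge B_j\}$, $j=1,\dots,p$, where $$u_j=\pi\,(k_q+k_{q-1}+\dots+k_j)\quad (j=1,\dots,q),$$ $$u_j=\pi\Big(\sum_{i=0}^q k_i+m+\sum_{i=j+1}^p k_i\Big)\quad (j=q+1,\dots,p).$$ (So from left to right one meets $l_q,l_{q-1},\dots,l_1$, then $E$, then $l_p,l_{p-1},\dots,l_{q+1}$.) Boundary points at infinity. "$\infty$ reached along the left-hand (respectively right-hand) side of $l_j$" denotes the boundary element (prime end) of the domain over $\infty$ determined by the path $u=u_j-\varepsilon$ (respectively $u=u_j+\varepsilon$), $v\to+\infty$, with $\varepsilon>0$ small. Values of $\phi$ at boundary points of the quadrant (including $\infty$) are understood in the sense of the boundary correspondence between the quadrant and prime ends of the image domain; in particular, for $x>0$, $\phi(x)$ is the boundary value of $\phi$ at $x$. Conventions in degenerate cases: if $q=0$ there are no rays to the left of $E$, and "the right-hand side of $l_1$" in the condition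 on $\phi(0)$ is read as the right-hand side of the line $u=0$; if $q=p$ there are no rays to the right of $E$, and "the left-hand side of $l_p$" in the normalization of $\phi(\infty)$ is read as the left-hand side of the line $u=\pi(\sum_{j=0}^p k_j+m)$. Normalized map. $\phi(z)=\phi(z;q,m,p,\mathbf{k},\mathbf{B})$ is the conformal map of the first quadrant $\{z=x+iy:\ x>0,\ y>0\}$ onto $\Omega^{\mathbf{k}}_{q,m,p}(\mathbf{B})$ such that $\phi(a)=0$, $\phi(1)=\pi(\sum_{j=0}^p k_j+m)$, and $\phi(\infty)$ corresponds to $\infty$ reached along the left-hand side of $l_p$. The vector $\mathbf{B}^*$. $\mathbf{B}^*=\mathbf{B}^*(x_1,\dots,x_p;a)\in(0,\infty)^{p+1}$ is the unique vector (its existence and uniqueness is a theorem, which may be assumed) such that for $\mathbf{B}=\mathbf{B}^*$: $\phi(x_j)$ corresponds to $\infty$ reached along the left-hand side of $l_j$ for $j=1,\dots,q$; $\phi(0)$ corresponds to $\infty$ reached along the right-hand side of $l_1$; and $\phi(x_j)$ corresponds to $\infty$ reached along the right-hand side of $l_j$ for $j=q+1,\dots,p$. $B_0^*$ denotes its component with index $0$. The error of best uniform approximation is the infimum, over all rational functions $r$ of the given form, of $\sup_{|x|\in[a,1]}|\operatorname{sgn}(x)-r(x)|$; an extremal rational function is an $r$ attaining it. *)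

theory Defs
  imports "HOL-Complex_Analysis.Complex_Analysis"
begin

definition first_quadrant :: "complex set" where
  "first_quadrant = {z. 0 < Re z \<and> 0 < Im z}"

(* The weights k and the levels B are indexed by 0, ..., p and the points x by 1, ..., p;
   their values at other indices play no role. *)

definition strip_width :: "nat \<Rightarrow> nat \<Rightarrow> (nat \<Rightarrow> nat) \<Rightarrow> real" where
  "strip_width m p k = pi * real ((\<Sum>j=0..p. k j) + m)"

definition ray_abscissa :: "nat \<Rightarrow> nat \<Rightarrow> nat \<Rightarrow> (nat \<Rightarrow> nat) \<Rightarrow> nat \<Rightarrow> real" where
  "ray_abscissa q m p k j =
     (if j \<le> q then pi * real (\<Sum>i=j..q. k i)
      else pi * real ((\<Sum>i=0..q. k i) + m + (\<Sum>i=j+1..p. k i)))"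

definition comb_cut :: "nat \<Rightarrow> (nat \<Rightarrow> nat) \<Rightarrow> real \<Rightarrow> complex set" where
  "comb_cut q k B0 =
     {w. B0 \<le> Im w \<and>
         \<bar>Re w - pi * real (\<Sum>j=0..q. k j)\<bar> \<le> arccos (cosh B0 / cosh (Im w))}"

definition comb_ray :: "nat \<Rightarrow> nat \<Rightarrow> nat \<Rightarrow> (nat \<Rightarrow> nat) \<Rightarrow> (nat \<Rightarrow> real) \<Rightarrow> nat \<Rightarrow> complex set" where
  "comb_ray q m p k B j = {w. Re w = ray_abscissa q m p k j \<and> B j \<le> Im w}"

definition comb_domain :: "nat \<Rightarrow> nat \<Rightarrow> nat \<Rightarrow> (nat \<Rightarrow> nat) \<Rightarrow> (nat \<Rightarrow> real) \<Rightarrow> complex set" where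
  "comb_domain q m p k B =
     {w. 0 < Im w \<and> 0 < Re w \<and> Re w < strip_width m p k}
       - comb_cut q k (B 0) - (\<Union>j\<in>{1..p}. comb_ray q m p k B j)"

(* The prime end over infinity determined by a path g tending to infinity in a domain D that
   lies in a vertical half-strip, given by its filter of neighbourhoods: a null chain consists
   of the horizontal crosscuts through the path, and the neighbourhood cut off at height R is
   the component of the part of D above height R that contains a tail of the path. *)
definition end_at_infinity :: "complex set \<Rightarrow> (real \<Rightarrow> complex) \<Rightarrow> complex filter" where
  "end_at_infinity D g =
     (INF R. principal {w. \<forall>\<^sub>F t in at_top. connected_component (D \<inter> {z. R < Im z}) (g t) w})"

(* phi tends, along the filter F, to infinity reached along the left-hand (respectively
   right-hand) side of the vertical line with abscissa u *)
definition tends_left_end :: "complex set \<Rightarrow> real \<Rightarrow> (complex \<Rightarrow> complex) \<Rightarrow> complex filter \<Rightarrow> bool" where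
  "tends_left_end D u \<phi> F \<longleftrightarrow>
     (\<forall>\<^sub>F \<epsilon> in at_right 0. filterlim \<phi> (end_at_infinity D (\<lambda>v. Complex (u - \<epsilon>) v)) F)"

definition tends_right_end :: "complex set \<Rightarrow> real \<Rightarrow> (complex \<Rightarrow> complex) \<Rightarrow> complex filter \<Rightarrow> bool" where
  "tends_right_end D u \<phi> F \<longleftrightarrow>
     (\<forall>\<^sub>F \<epsilon> in at_right 0. filterlim \<phi> (end_at_infinity D (\<lambda>v. Complex (u + \<epsilon>) v)) F)"

(* If q = p there is no ray to the right of the cut, and the last condition refers to the
   right edge of the half-strip instead. *)
definition normalized_comb_map ::
  "nat \<Rightarrow> nat \<Rightarrow> nat \<Rightarrow> (nat \<Rightarrow> nat) \<Rightarrow> (nat \<Rightarrow> real) \<Rightarrow> real \<Rightarrow> (complex \<Rightarrow> complex) \<Rightarrow> bool" where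
  "normalized_comb_map q m p k B a \<phi> \<longleftrightarrow>
     \<phi> holomorphic_on first_quadrant \<and>
     bij_betw \<phi> first_quadrant (comb_domain q m p k B) \<and>
     (\<phi> \<longlongrightarrow> 0) (at (of_real a) within first_quadrant) \<and>
     (\<phi> \<longlongrightarrow> of_real (strip_width m p k)) (at 1 within first_quadrant) \<and>
     tends_left_end (comb_domain q m p k B)
       (if q < p then ray_abscissa q m p k p else strip_width m p k)
       \<phi> (inf at_infinity (principal first_quadrant))"

(* The conditions that single out the vector B* among all B, where phi is the normalized map
   for B. If q = 0 there is no ray to the left of the cut, and the condition at 0 refers to
   the left edge of the half-strip instead. *)
definition prescribed_ends ::
  "nat \<Rightarrow> nat \<Rightarrow> nat \<Rightarrow> (nat \<Rightarrow> nat) \<Rightarrow> (nat \<Rightarrow> real) \<Rightarrow> (nat \<Rightarrow> real) \<Rightarrow> (complex \<Rightarrow> complex) \<Rightarrow> bool" where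
  "prescribed_ends q m p k B x \<phi> \<longleftrightarrow>
     (\<forall>j\<in>{1..q}. tends_left_end (comb_domain q m p k B) (ray_abscissa q m p k j)
        \<phi> (at (of_real (x j)) within first_quadrant)) \<and>
     tends_right_end (comb_domain q m p k B) (if 0 < q then ray_abscissa q m p k 1 else 0)
        \<phi> (at 0 within first_quadrant) \<and>
     (\<forall>j\<in>{q+1..p}. tends_right_end (comb_domain q m p k B) (ray_abscissa q m p k j)
        \<phi> (at (of_real (x j)) within first_quadrant))"

definition approximants ::
  "nat \<Rightarrow> nat \<Rightarrow> (nat \<Rightarrow> nat) \<Rightarrow> (nat \<Rightarrow> real) \<Rightarrow> (real \<Rightarrow> real) set" where
  "approximants m p k x =
     {r. \<exists>c :: nat \<Rightarrow> real. r = (\<lambda>t.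
        (\<Sum>i = 0..2 * (m - 1 + (\<Sum>j=0..p. k j)). c i * t ^ i) /
        (t ^ (2 * k 0 - 1) * (\<Prod>j=1..p. (t\<^sup>2 - (x j)\<^sup>2) ^ k j)))}"

definition sgn_deviation :: "real \<Rightarrow> (real \<Rightarrow> real) \<Rightarrow> real" where
  "sgn_deviation a r = (SUP t\<in>{t. a \<le> \<bar>t\<bar> \<and> \<bar>t\<bar> \<le> 1}. \<bar>sgn t - r t\<bar>)"

definition best_sgn_error :: "real \<Rightarrow> (real \<Rightarrow> real) set \<Rightarrow> real" where
  "best_sgn_error a R = (INF r\<in>R. sgn_deviation a r)"

definition extremal_approximant :: "real \<Rightarrow> (real \<Rightarrow> real) set \<Rightarrow> (real \<Rightarrow> real) \<Rightarrow> bool" where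
  "extremal_approximant a R r \<longleftrightarrow> r \<in> R \<and> sgn_deviation a r = best_sgn_error a R"

end

theory Submission
  imports Defs
begin

text \<open>Since the quadrant is the half-plane under the square root, let \<open>\<Phi>(z) = \<phi>(\<surd>z)\<close>. The points
  \<open>0\<close>, \<open>x\<^sub>j\<^sup>2\<close> and \<open>\<infinity>\<close> correspond to the channels of the comb domain, one each, and \<open>\<Phi>\<close> is locally
  bounded near every other real point: curves on which \<open>Im \<Phi>\<close> is large and which join two different
  boundary points cannot exist, because \<open>Im \<Phi>\<close> is a positive harmonic function (Koebe's lemma).
  Hence near such points \<open>\<Phi>\<close> approaches the finite boundary, and connectedness together with the
  position of the channels shows that positive points belong to the vertical lines and the bottom,
  negative points to the cut. With \<open>f = 1 - (-1)\<^sup>N L cos \<Phi>\<close>, the function \<open>T(z) = f(z)/\<surd>z\<close> is then real on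
  the real axis, so it extends to the plane by reflection. Its poles, and its growth at infinity, have
  orders bounded by the widths of the channels divided by \<open>\<pi>\<close>, since \<open>\<Phi>\<close> grows like
  \<open>\<i> log (z - \<xi>)\<close> times the order. So \<open>f(x\<^sup>2)\<close> is an odd rational function of the required form. On
  \<open>[a, 1]\<close> the map runs along the bottom of the half-strip from one corner to the other, so
  \<open>1 - f(x\<^sup>2)\<close> equioscillates between \<open>\<plusminus>L\<close> often enough to make it the unique extremal function.\<close>

section \<open>Boundary behaviour of holomorphic functions on the half-plane\<close>

text \<open>The hypotheses prescribe limits of \<open>\<phi>\<close> only at \<open>a\<close>, at 1
  and at the ends; elsewhere convergence has to be won from boundedness. For \<open>T\<close> this
  succeeds because \<open>Im T\<close> tends to 0 at the axis: a barrier makes it vanish linearly in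
  the height, which bounds the derivative. For \<Phi> it follows since the cluster set is connected
  and lies in one countable fibre of \<open>cos\<close>. The edge of the cut has the equation
  \<open>cos (Re w - c) * cosh (Im w) = cosh (B 0)\<close>. With \<open>L = 1 / cosh (B 0)\<close>
  this says that \<open>1 - (-1) ^ N * L * cos w\<close> has real part 0, which is where
  \<open>L\<close> comes from. The root is real on the positive and imaginary on the negative axis,
  so dividing by it makes both kinds of boundary value real. It shifts the orders at 0 and at
  infinity by one half, and integrality absorbs the shift. That the segment between the corners runs
  along the bottom, without climbing a wall, is not taken from injectivity on the boundary: the
  Cauchy-Riemann equations give a monotonicity along each wall that excludes such an
  excursion.\<close>

abbreviation upper_half_plane :: "complex set" where
  "upper_half_plane \<equiv> {z. 0 < Im z}"

abbreviation at_upper :: "real \<Rightarrow> complex filter" where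
  "at_upper t \<equiv> at (of_real t) within upper_half_plane"

text \<open>Maximum principle with a one-sided condition at the frontier, because the functions it
  is applied to need not extend there. The superlevel set \<open>K\<close> is compact since its
  limit points cannot lie on the frontier. Where \<open>Re g\<close> is maximal on it, the modulus
  of \<open>exp (g w)\<close> is maximal, so it is constant, which the small values near the
  frontier contradict.\<close>

lemma Re_nonpos_of_frontier:
  assumes "open D" "connected D" "bounded D" "g holomorphic_on D"
    and lim: "\<And>z e. z \<in> frontier D \<Longrightarrow> 0 < e \<Longrightarrow> \<forall>\<^sub>F w in at z within D. Re (g w) < e"
    and "z \<in> D"
  shows "Re (g z) \<le> 0"
proof (rule ccontr)
  assume "\<not> ?thesis"
  then have pos: "0 < Re (g z)" by simp
  define d where "d = Re (g z)"
  define K where "K = {w \<in> D. d \<le> Re (g w)}"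
  have contg: "continuous_on D g"
    using assms(4) holomorphic_on_imp_continuous_on by blast
  have front: "l \<notin> frontier D" if "\<forall>n. s n \<in> K" "s \<longlonglongrightarrow> l" for s l
  proof
    assume l: "l \<in> frontier D"
    then have "l \<notin> D" using \<open>open D\<close> by (simp add: frontier_def interior_open)
    have "filterlim s (at l within D) sequentially"
      using that \<open>l \<notin> D\<close> unfolding filterlim_at K_def by (auto intro!: always_eventually)
    then have "\<forall>\<^sub>F n in sequentially. Re (g (s n)) < d"
      using lim[OF l, of d] pos unfolding d_def filterlim_iff by blast
    then obtain n where "Re (g (s n)) < d" by (auto simp: eventually_sequentially)
    with that show False by (auto simp: K_def not_le[symmetric])
  qed
  have "closed K"
    unfolding closed_sequential_limits
  proof (intro allI impI)
    fix s l assume sl: "(\<forall>n. s n \<in> K) \<and> s \<longlonglongrightarrow> l"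
    then have "l \<in> closure D" unfolding closure_sequential K_def by auto
    then have lD: "l \<in> D" using front[of s l] sl \<open>open D\<close>
      by (auto simp: frontier_def interior_open)
    have "(\<lambda>n. g (s n)) \<longlonglongrightarrow> g l"
      using contg lD sl unfolding continuous_on_sequentially K_def comp_def by auto
    then have "(\<lambda>n. Re (g (s n))) \<longlonglongrightarrow> Re (g l)" by (rule tendsto_Re)
    then have "d \<le> Re (g l)"
      by (rule tendsto_lowerbound) (use sl in \<open>auto simp: K_def\<close>)
    with lD show "l \<in> K" by (simp add: K_def)
  qed
  moreover have "bounded K" using \<open>bounded D\<close> by (rule bounded_subset) (auto simp: K_def)
  ultimately have "compact K" by (simp add: compact_eq_bounded_closed)
  moreover have "z \<in> K" using \<open>z \<in> D\<close> by (simp add: K_def d_def)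
  moreover have "continuous_on K (\<lambda>w. Re (g w))"
    by (intro continuous_intros continuous_on_subset[OF contg]) (auto simp: K_def)
  ultimately obtain z1 where z1: "z1 \<in> K" "\<And>w. w \<in> K \<Longrightarrow> Re (g w) \<le> Re (g z1)"
    using continuous_attains_sup[of K "\<lambda>w. Re (g w)"] by blast
  have max: "Re (g w) \<le> Re (g z1)" if "w \<in> D" for w
    using z1 that by (cases "w \<in> K") (auto simp: K_def)
  have "(\<lambda>w. exp (g w)) constant_on D"
    using maximum_modulus_principle[of "\<lambda>w. exp (g w)" D D z1] assms z1 max
    by (auto simp: K_def intro!: holomorphic_intros)
  then have const: "norm (exp (g w)) = norm (exp (g z))" if "w \<in> D" for w
    using that \<open>z \<in> D\<close> unfolding constant_on_def by metis
  have "D \<noteq> UNIV" using \<open>bounded D\<close> not_bounded_UNIV by auto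
  then obtain l where l: "l \<in> frontier D"
    using \<open>z \<in> D\<close> frontier_eq_empty[of D] by auto
  then have "l \<in> closure D" "l \<notin> D"
    using \<open>open D\<close> by (auto simp: frontier_def interior_open)
  then have "at l within D \<noteq> bot"
    by (simp add: trivial_limit_within islimpt_in_closure)
  moreover have "\<forall>\<^sub>F w in at l within D. w \<in> D \<and> Re (g w) < d"
    using lim[OF l, of d] pos
    by (intro eventually_conj) (auto simp: d_def eventually_at_filter)
  ultimately obtain w where "w \<in> D" "Re (g w) < d"
    using eventually_happens' by blast
  with const[of w] show False by (simp add: d_def)
qed

section \<open>Koebe's lemma for curves approaching the real axis\<close>

lemma rectangle_fashoda:
  fixes f g :: "real \<Rightarrow> complex"
  assumes "path f" "path g"
    and "path_image f \<subseteq> cbox a b" "path_image g \<subseteq> cbox a b"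
    and "Re (pathstart f) = Re a" "Re (pathfinish f) = Re b"
    and "Im (pathstart g) = Im a" "Im (pathfinish g) = Im b"
  shows "path_image f \<inter> path_image g \<noteq> {}"
proof -
  \<comment> \<open>\<open>v\<close> carries the question to \<open>real^2\<close>, where
    \<open>fashoda\<close> is stated.\<close>
  define v :: "complex \<Rightarrow> real^2" where "v = (\<lambda>z. \<chi> i. if i = 1 then Re z else Im z)"
  have v12: "v z $ 1 = Re z" "v z $ 2 = Im z" for z by (auto simp: v_def)
  have "continuous_on UNIV (\<lambda>z. if i = 1 then Re z else Im z)" for i :: 2
    by (cases "i = 1") (auto intro!: continuous_intros)
  then have "continuous_on UNIV v"
    unfolding v_def by (intro continuous_on_vec_lambda)
  then have pv: "path (v \<circ> f)" "path (v \<circ> g)"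
    using assms(1,2) by (auto intro!: path_continuous_image elim: continuous_on_subset)
  have box: "v z \<in> cbox (v a) (v b)" if "z \<in> cbox a b" for z
    using that by (auto simp: mem_box_cart v12 forall_2 in_cbox_complex_iff)
  obtain u where "u \<in> path_image (v \<circ> f)" "u \<in> path_image (v \<circ> g)"
    by (rule fashoda[OF pv, of "v a" "v b"])
       (use assms box in \<open>auto simp: path_image_compose pathstart_compose pathfinish_compose v12\<close>)
  then obtain z w where "z \<in> path_image f" "w \<in> path_image g" "v z = v w"
    by (auto simp: path_image_compose)
  then show ?thesis
    by (metis v12 complex_eqI disjoint_iff)
qed

text \<open>If \<open>Im \<Phi>\<close> exceeded \<open>M\<close> on such a curve, then on the
  component of the rectangle minus the curve that contains the centre, \<open>M * h\<close> would be
  a harmonic minorant of \<open>Im \<Phi>\<close>: on the curve because \<open>h \<le> 1\<close>, on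
  the vertical sides and the top because \<open>h = 0\<close>. Evaluation at the centre bounds
  \<open>M\<close>. The bound is uniform over all curves, however close to the axis they
  run.\<close>

lemma crossing_bound:
  assumes hol: "\<Phi> holomorphic_on upper_half_plane"
    and pos: "\<And>z. 0 < Im z \<Longrightarrow> 0 < Im (\<Phi> z)"
    and "x0 < x1"
  obtains M where "\<And>g. path g \<Longrightarrow>
      path_image g \<subseteq> {z. x0 \<le> Re z \<and> Re z \<le> x1 \<and> 0 < Im z \<and> Im z \<le> 1} \<Longrightarrow>
      Re (pathstart g) = x0 \<Longrightarrow> Re (pathfinish g) = x1 \<Longrightarrow>
      \<exists>z\<in>path_image g. Im (\<Phi> z) \<le> M"
proof -
  \<comment> \<open>With this \<mu> the factor \<open>sin (\<mu> * (Re z - x0))\<close> of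
    \<open>h\<close> vanishes on both vertical sides and is positive between them.\<close>
  define \<mu> where "\<mu> = pi / (x1 - x0)"
  have \<mu>: "\<mu> > 0" "\<mu> * (x1 - x0) = pi" using \<open>x0 < x1\<close> by (auto simp: \<mu>_def)
  define xm where "xm = (x0 + x1) / 2"
  define zc where "zc = Complex xm (1/2)"
  define u where "u z = cos (of_real \<mu> * (z - Complex x0 1)) / of_real (sinh \<mu>)" for z
  \<comment> \<open>\<open>Im u\<close> is harmonic and vanishes on all sides of the rectangle but the bottom one\<close>
  define h where "h z = Im (u z)" for z
  have h_eq: "h z = sin (\<mu> * (Re z - x0)) * sinh (\<mu> * (1 - Im z)) / sinh \<mu>" for z
    unfolding h_def u_def by (simp add: Im_cos sinh_def field_simps)
  have shl: "sinh \<mu> > 0" using \<mu> by simp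
  have h0: "h zc > 0"
  proof -
    have "\<mu> * (Re zc - x0) = pi / 2" using \<mu> by (simp add: zc_def xm_def field_simps)
    then have "sin (\<mu> * (Re zc - x0)) = 1" by (simp only: sin_pi_half)
    then show ?thesis using \<mu> shl by (simp add: h_eq zc_def)
  qed
  have contH: "continuous_on upper_half_plane \<Phi>"
    using hol holomorphic_on_imp_continuous_on by blast
  \<comment> \<open>\<open>M\<close> will dominate \<open>Im \<Phi>\<close> on the segment from the
    centre to the top, so the curve cannot meet it. It serves as the last piece of a path from the
    bottom to the top.\<close>
  define S where "S = closed_segment zc (Complex xm 1)"
  have S: "Re z = xm" "1/2 \<le> Im z" "Im z \<le> 1" if "z \<in> S" for z
  proof -
    obtain t where t: "0 \<le> t" "t \<le> 1" "z = (1 - t) *\<^sub>R zc + t *\<^sub>R Complex xm 1"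
      using \<open>z \<in> S\<close> unfolding S_def closed_segment_def by blast
    have "Re z = xm" "Im z = (1 + t) / 2"
      unfolding t(3) zc_def by (simp_all add: algebra_simps add_divide_distrib)
    then show "Re z = xm" "1/2 \<le> Im z" "Im z \<le> 1" using t by auto
  qed
  have "S \<subseteq> upper_half_plane" using S(2) by force
  then have "continuous_on S (\<lambda>z. Im (\<Phi> z))"
    by (intro continuous_intros continuous_on_subset[OF contH])
  moreover have "compact S" "S \<noteq> {}" by (auto simp: S_def)
  ultimately obtain s where s: "s \<in> S" "\<And>z. z \<in> S \<Longrightarrow> Im (\<Phi> z) \<le> Im (\<Phi> s)"
    using continuous_attains_sup[of S "\<lambda>z. Im (\<Phi> z)"] by blast
  \<comment> \<open>The second term is what the comparison at \<open>zc\<close> permits, increased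
    by 1 for a strict contradiction.\<close>
  define M where "M = max (Im (\<Phi> s)) (Im (\<Phi> zc) / h zc + 1)"
  have Mpos: "0 \<le> M" using h0 pos[of zc] by (auto simp: M_def zc_def le_max_iff_disj)
  show thesis
  proof (rule that[of M], rule ccontr)
    fix g assume g: "path g"
      "path_image g \<subseteq> {z. x0 \<le> Re z \<and> Re z \<le> x1 \<and> 0 < Im z \<and> Im z \<le> 1}"
      "Re (pathstart g) = x0" "Re (pathfinish g) = x1"
      "\<not> (\<exists>z\<in>path_image g. Im (\<Phi> z) \<le> M)"
    define R where "R = box (Complex x0 0) (Complex x1 1)"
    have R: "z \<in> R \<longleftrightarrow> x0 < Re z \<and> Re z < x1 \<and> 0 < Im z \<and> Im z < 1" for z
      by (auto simp: R_def in_box_complex_iff)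
    define D where "D = connected_component_set (R - path_image g) zc"
    have Sg: "S \<inter> path_image g = {}" using s(2) g(5) by (fastforce simp: M_def)
    have zc: "zc \<in> R - path_image g"
      using \<open>x0 < x1\<close> Sg by (auto simp: R zc_def xm_def S_def)
    have oRg: "open (R - path_image g)"
      using g(1) by (intro open_Diff compact_imp_closed compact_path_image) (auto simp: R_def)
    have D: "open D" "connected D" "D \<subseteq> R - path_image g" "zc \<in> D"
      unfolding D_def
      by (rule open_connected_component[OF oRg] connected_connected_component
          connected_component_subset)+ (use zc in \<open>simp add: connected_component_refl\<close>)
    have "bounded R" by (simp add: R_def bounded_box)
    then have "bounded D" by (rule bounded_subset) (use D(3) in blast)
    define G where "G z = \<i> * (\<Phi> z - of_real M * u z)" for z
    have ReG: "Re (G z) = M * h z - Im (\<Phi> z)" for z by (simp add: G_def h_def)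
    have G: "G holomorphic_on upper_half_plane"
      unfolding G_def u_def using shl by (intro holomorphic_intros hol) auto
    have "Re (G zc) \<le> 0"
    proof (rule Re_nonpos_of_frontier[OF D(1,2) \<open>bounded D\<close> _ _ D(4)])
      show "G holomorphic_on D" using G D(3) R by (auto intro: holomorphic_on_subset)
    next
      fix l and e :: real assume l: "l \<in> frontier D" and e: "0 < e"
      have "l \<in> closure R" using l D(3) closure_mono[of D R] by (auto simp: frontier_def)
      then have lR: "x0 \<le> Re l" "Re l \<le> x1" "0 \<le> Im l" "Im l \<le> 1"
      proof -
        have "closure R = cbox (Complex x0 0) (Complex x1 1)"
          unfolding R_def by (rule closure_box) (use zc R_def in auto)
        then show "x0 \<le> Re l" "Re l \<le> x1" "0 \<le> Im l" "Im l \<le> 1"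
          using \<open>l \<in> closure R\<close> by (auto simp: in_cbox_complex_iff)
      qed
      have lnot: "l \<notin> R - path_image g"
        using l frontier_of_connected_component_subset[of "R - path_image g" zc] oRg
        by (auto simp: D_def frontier_def interior_open)
      show "\<forall>\<^sub>F w in at l within D. Re (G w) < e"
      proof (cases "Im l = 0")
        case True
        then have "l \<notin> path_image g" using g(2) by auto
        then obtain r where r: "r > 0" "ball l r \<inter> path_image g = {}"
        proof -
          have "open (- path_image g)"
            using g(1) by (intro open_Compl compact_imp_closed compact_path_image)
          then show ?thesis
            using that \<open>l \<notin> path_image g\<close> unfolding open_contains_ball by blast
        qed
        from l r(1) obtain d where d: "d \<in> D" "dist d l < r"
          unfolding frontier_def by (auto simp: closure_approachable)
        have "path_connected D" using D by (simp add: connected_open_path_connected)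
        then obtain p where p: "path p" "path_image p \<subseteq> D" "pathstart p = d" "pathfinish p = zc"
          using d D(4) unfolding path_connected_def by blast
        \<comment> \<open>The bottom side is out of reach of \<open>D\<close>: from a point of
          \<open>D\<close> near \<open>l\<close> this path descends to the bottom inside a disc free
          of the curve, and ascends through \<open>D\<close> and along \<open>S\<close> to the top.
          It would have to cross the curve, but none of its pieces does.\<close>
        define P where "P = linepath (Complex (Re d) 0) d +++ p +++ linepath zc (Complex xm 1)"
        have seg: "z \<in> ball l r \<and> Re z = Re d \<and> 0 \<le> Im z \<and> Im z \<le> Im d"
          if z_in: "z \<in> closed_segment (Complex (Re d) 0) d" for z
        proof -
          have "0 < Im d" using d D(3) R by auto
          obtain t where t: "0 \<le> t" "t \<le> 1" "z = (1 - t) *\<^sub>R Complex (Re d) 0 + t *\<^sub>R d"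
            using z_in unfolding closed_segment_def by blast
          have z: "Re z = Re d" "Im z = t * Im d"
            unfolding t(3) by (simp_all add: algebra_simps)
          have "0 \<le> Im z" "Im z \<le> Im d"
            using z t \<open>0 < Im d\<close> by (auto simp: mult_left_le_one_le)
          moreover have "dist l z \<le> dist d l"
            using z(1) True \<open>0 \<le> Im z\<close> \<open>Im z \<le> Im d\<close>
            by (simp add: dist_norm cmod_def power2_commute[of "Re d"] power_mono)
          ultimately show ?thesis using z d by auto
        qed
        have im: "path_image P = closed_segment (Complex (Re d) 0) d \<union> path_image p \<union> S"
          unfolding P_def S_def using p by (simp add: path_image_join Un_assoc)
        have "path_image g \<inter> path_image P \<noteq> {}"
        proof (rule rectangle_fashoda[of _ _ "Complex x0 0" "Complex x1 1"])
          show "path_image P \<subseteq> cbox (Complex x0 0) (Complex x1 1)"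
          proof
            fix z assume "z \<in> path_image P"
            then consider "z \<in> closed_segment (Complex (Re d) 0) d" | "z \<in> path_image p" | "z \<in> S"
              unfolding im by blast
            then show "z \<in> cbox (Complex x0 0) (Complex x1 1)"
            proof cases
              case 1
              then show ?thesis using seg[OF 1] d D(3) R[of d] by (auto simp: in_cbox_complex_iff)
            next
              case 2
              then show ?thesis using p(2) D(3) R[of z] by (auto simp: in_cbox_complex_iff)
            next
              case 3
              then show ?thesis using S[of z] \<open>x0 < x1\<close> by (auto simp: in_cbox_complex_iff xm_def)
            qed
          qed
        qed (use g p in \<open>auto simp: P_def in_cbox_complex_iff subset_iff\<close>)
        then show ?thesis using im seg r p(2) D(3) Sg by blast
      next
        case False
        then have "0 < Im l" using lR by simp
        have "Re (G l) \<le> 0"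
        proof (cases "l \<in> path_image g")
          case True
          have "h l \<le> 1"
          proof -
            have "sinh (\<mu> * (1 - Im l)) \<le> sinh \<mu>" "0 \<le> sinh (\<mu> * (1 - Im l))"
              using \<mu>(1) lR by (auto simp: mult_left_le)
            moreover have "sin (\<mu> * (Re l - x0)) \<le> 1" by simp
            ultimately have "sin (\<mu> * (Re l - x0)) * sinh (\<mu> * (1 - Im l)) \<le> 1 * sinh \<mu>"
              by (intro mult_mono) auto
            then show ?thesis using shl by (simp add: h_eq)
          qed
          then have "M * h l \<le> M" using Mpos by (simp add: mult_left_le)
          then show ?thesis using True g(5) by (force simp: ReG)
        next
          case False
          then have "l \<notin> R" using lnot by simp
          then have "Re l = x0 \<or> Re l = x1 \<or> Im l = 1" using R lR \<open>0 < Im l\<close> by force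
          then have "h l = 0" using \<mu>(2) by (auto simp: h_eq)
          then show ?thesis using pos[OF \<open>0 < Im l\<close>] by (simp add: ReG)
        qed
        moreover have "isCont (\<lambda>w. Re (G w)) l"
        proof -
          have "continuous_on upper_half_plane G" using G holomorphic_on_imp_continuous_on by blast
          then have "isCont G l"
            by (rule continuous_on_interior)
              (use \<open>0 < Im l\<close> open_halfspace_Im_gt[of 0] in \<open>simp add: interior_open\<close>)
          then show ?thesis by (simp add: isCont_def tendsto_Re)
        qed
        ultimately have "\<forall>\<^sub>F w in at l. Re (G w) < e"
          unfolding isCont_def using e by (elim order_tendstoD(2)) linarith
        then show ?thesis by (rule filter_leD[OF at_le[OF subset_UNIV]])
      qed
    qed
    then have "M \<le> Im (\<Phi> zc) / h zc" using h0 by (simp add: ReG pos_le_divide_eq)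
    then show False by (simp add: M_def)
  qed
qed

text \<open>Isolates the final piece of a curve on its way out of a region: after the last time at
  level \<open>c\<close> it stays beyond that level, so the piece lies in a strip to which
  \<open>crossing_bound\<close> applies.\<close>

lemma last_crossing:
  fixes \<rho> :: "real \<Rightarrow> real"
  assumes "continuous_on {0..s2} \<rho>" "\<rho> 0 \<le> c" "c < \<rho> s2" "0 \<le> s2"
  obtains s1 where "0 \<le> s1" "s1 \<le> s2" "\<rho> s1 = c" "\<And>s. s1 \<le> s \<Longrightarrow> s \<le> s2 \<Longrightarrow> c \<le> \<rho> s"
proof -
  define A where "A = {0..s2} \<inter> \<rho> -` {..c}"
  have "closed A" unfolding A_def
    by (rule continuous_closed_preimage[OF assms(1)]) auto
  then have "compact A"
    using compact_Int_closed[of "{0..s2}" A] by (simp add: A_def Int_absorb1 Int_assoc[symmetric])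
  moreover have "0 \<in> A" using assms by (auto simp: A_def)
  ultimately obtain s1 where s1: "s1 \<in> A" "\<And>s. s \<in> A \<Longrightarrow> s \<le> s1"
    using compact_attains_sup[of A] by blast
  have ge: "c < \<rho> s" if "s1 < s" "s \<le> s2" for s
    using s1(2)[of s] s1(1) that by (cases "c < \<rho> s") (auto simp: A_def)
  have "\<rho> s1 = c"
  proof (rule ccontr)
    assume "\<rho> s1 \<noteq> c"
    then have "\<rho> s1 < c" using s1(1) by (auto simp: A_def)
    moreover have "continuous_on {s1..s2} \<rho>"
      using assms(1) s1(1) by (auto simp: A_def intro: continuous_on_subset)
    ultimately obtain s where "s1 \<le> s" "s \<le> s2" "\<rho> s = c"
      using IVT'[of \<rho> s1 c s2] s1(1) assms(3) by (auto simp: A_def)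
    with ge[of s] \<open>\<rho> s1 < c\<close> show False by (cases "s = s1") auto
  qed
  then show thesis using that[of s1] s1(1) ge by (force simp: A_def less_eq_real_def)
qed

text \<open>To leave the box around \<open>t\<close>, a curve has to meet the top edge, where
  \<open>Im \<Phi>\<close> is bounded by compactness, or to cross one of the strips
  \<open>e \<le> \<bar>Re z - t\<bar> \<le> 2 * e\<close>, where Koebe's bound applies. One
  \<open>M\<close> above these three bounds excludes every exit.\<close>

lemma high_path_stays:
  assumes hol: "\<Phi> holomorphic_on upper_half_plane"
    and pos: "\<And>z. 0 < Im z \<Longrightarrow> 0 < Im (\<Phi> z)"
    and e: "0 < e"
  obtains M where "\<And>g. path g \<Longrightarrow> path_image g \<subseteq> upper_half_plane \<Longrightarrow>
      (\<And>z. z \<in> path_image g \<Longrightarrow> M < Im (\<Phi> z)) \<Longrightarrow>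
      \<bar>Re (pathstart g) - t\<bar> < e \<Longrightarrow> Im (pathstart g) < 1 \<Longrightarrow>
      \<bar>Re (pathfinish g) - t\<bar> < 2 * e \<and> Im (pathfinish g) < 1"
proof -
  obtain M1 where M1: "\<And>g. path g \<Longrightarrow>
      path_image g \<subseteq> {z. t + e \<le> Re z \<and> Re z \<le> t + 2 * e \<and> 0 < Im z \<and> Im z \<le> 1} \<Longrightarrow>
      Re (pathstart g) = t + e \<Longrightarrow> Re (pathfinish g) = t + 2 * e \<Longrightarrow>
      \<exists>z\<in>path_image g. Im (\<Phi> z) \<le> M1"
    by (rule crossing_bound[OF hol pos, of "t + e" "t + 2 * e"]) (use e in auto)
  obtain M2 where M2: "\<And>g. path g \<Longrightarrow>
      path_image g \<subseteq> {z. t - 2 * e \<le> Re z \<and> Re z \<le> t - e \<and> 0 < Im z \<and> Im z \<le> 1} \<Longrightarrow>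
      Re (pathstart g) = t - 2 * e \<Longrightarrow> Re (pathfinish g) = t - e \<Longrightarrow>
      \<exists>z\<in>path_image g. Im (\<Phi> z) \<le> M2"
    by (rule crossing_bound[OF hol pos, of "t - 2 * e" "t - e"]) (use e in auto)
  have contH: "continuous_on upper_half_plane \<Phi>"
    using hol holomorphic_on_imp_continuous_on by blast
  define S where "S = cbox (Complex (t - 2 * e) 1) (Complex (t + 2 * e) 1)"
  have S: "z \<in> S \<longleftrightarrow> \<bar>Re z - t\<bar> \<le> 2 * e \<and> Im z = 1" for z
    by (auto simp: S_def in_cbox_complex_iff)
  have "continuous_on S (\<lambda>z. Im (\<Phi> z))"
    by (intro continuous_intros continuous_on_subset[OF contH]) (auto simp: S)
  moreover have "compact S" by (simp add: S_def)
  moreover have "Complex t 1 \<in> S" using e by (simp add: S)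
  ultimately obtain s where s: "\<And>z. z \<in> S \<Longrightarrow> Im (\<Phi> z) \<le> Im (\<Phi> s)"
    using continuous_attains_sup[of S "\<lambda>z. Im (\<Phi> z)"] by blast
  define M where "M = max (Im (\<Phi> s)) (max M1 M2)"
  show thesis
  proof (rule that[of M], rule ccontr)
    fix g assume g: "path g" "path_image g \<subseteq> upper_half_plane"
      "\<And>z. z \<in> path_image g \<Longrightarrow> M < Im (\<Phi> z)"
      "\<bar>Re (pathstart g) - t\<bar> < e" "Im (pathstart g) < 1"
      "\<not> (\<bar>Re (pathfinish g) - t\<bar> < 2 * e \<and> Im (pathfinish g) < 1)"
    have contg: "continuous_on {0..1} g" using g(1) by (simp add: path_def)
    define Q where "Q = {z. \<bar>Re z - t\<bar> < 2 * e \<and> Im z < 1}"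
    have "open Q"
      unfolding Q_def by (intro open_Collect_conj open_Collect_less continuous_intros)
    define A where "A = {0..1} \<inter> g -` (- Q)"
    have "closed A" unfolding A_def
      by (rule continuous_closed_preimage[OF contg]) (use \<open>open Q\<close> in \<open>auto simp: closed_def\<close>)
    then have "compact A"
      using compact_Int_closed[of "{0..1}" A] by (simp add: A_def Int_absorb1 Int_assoc[symmetric])
    moreover have "1 \<in> A" using g(6) by (auto simp: A_def Q_def pathfinish_def)
    \<comment> \<open>The first time at which the curve is outside the open box
      \<open>Q\<close>.\<close>
    ultimately obtain s2 where s2: "s2 \<in> A" "\<And>s. s \<in> A \<Longrightarrow> s2 \<le> s"
      using compact_attains_inf[of A] by blast
    have s2': "0 \<le> s2" "s2 \<le> 1" using s2(1) by (auto simp: A_def)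
    have before: "g s \<in> Q" if "0 \<le> s" "s < s2" for s
      using that s2(2)[of s] s2' by (force simp: A_def)
    have contg2: "continuous_on {0..s2} g"
      using contg s2' by (auto intro: continuous_on_subset)
    have gim: "g s \<in> path_image g" if "0 \<le> s" "s \<le> s2" for s
      using that s2' by (auto simp: path_image_def)
    have "\<bar>Re (g s2) - t\<bar> \<le> 2 * e"
    proof (rule ccontr)
      assume "\<not> ?thesis"
      moreover have "\<bar>Re (g 0) - t\<bar> \<le> 2 * e" using g(4) e by (simp add: pathstart_def)
      moreover have "continuous_on {0..s2} (\<lambda>s. \<bar>Re (g s) - t\<bar>)"
        by (intro continuous_intros contg2)
      ultimately obtain s where "0 \<le> s" "s \<le> s2" "\<bar>Re (g s) - t\<bar> = 2 * e"
        using IVT'[of "\<lambda>s. \<bar>Re (g s) - t\<bar>" 0 "2 * e" s2] s2' by auto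
      with before[of s] \<open>\<not> ?thesis\<close> show False by (cases "s = s2") (auto simp: Q_def)
    qed
    have "Im (g s2) \<le> 1"
    proof (rule ccontr)
      assume "\<not> ?thesis"
      moreover have "Im (g 0) \<le> 1" using g(5) by (simp add: pathstart_def)
      moreover have "continuous_on {0..s2} (\<lambda>s. Im (g s))"
        by (intro continuous_intros contg2)
      ultimately obtain s where "0 \<le> s" "s \<le> s2" "Im (g s) = 1"
        using IVT'[of "\<lambda>s. Im (g s)" 0 1 s2] s2' by auto
      with before[of s] \<open>\<not> ?thesis\<close> show False by (cases "s = s2") (auto simp: Q_def)
    qed
    have "Im (g s2) \<noteq> 1"
    proof
      assume "Im (g s2) = 1"
      then have "g s2 \<in> S" using \<open>\<bar>Re (g s2) - t\<bar> \<le> 2 * e\<close> by (simp add: S)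
      from s[OF this] g(3)[OF gim[of s2]] s2' show False by (auto simp: M_def)
    qed
    then have Re2: "\<bar>Re (g s2) - t\<bar> = 2 * e"
      using s2(1) \<open>\<bar>Re (g s2) - t\<bar> \<le> 2 * e\<close> \<open>Im (g s2) \<le> 1\<close> by (auto simp: A_def Q_def)
    have inside: "\<bar>Re (g s) - t\<bar> \<le> 2 * e \<and> 0 < Im (g s) \<and> Im (g s) \<le> 1 \<and> M < Im (\<Phi> (g s))"
      if "0 \<le> s" "s \<le> s2" for s
      using before[of s] that \<open>\<bar>Re (g s2) - t\<bar> \<le> 2 * e\<close> \<open>Im (g s2) \<le> 1\<close> gim[OF that] g(2,3)
      by (cases "s = s2") (auto simp: Q_def)
    show False
    proof (cases "Re (g s2) - t > 0")
      case True
      obtain s1 where s1: "0 \<le> s1" "s1 \<le> s2" "Re (g s1) = t + e"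
        "\<And>s. s1 \<le> s \<Longrightarrow> s \<le> s2 \<Longrightarrow> t + e \<le> Re (g s)"
        by (rule last_crossing[of s2 "\<lambda>s. Re (g s)" "t + e"])
          (use True Re2 e g(4) s2' contg2 in \<open>auto simp: pathstart_def intro!: continuous_intros\<close>)
      have sub: "path_image (subpath s1 s2 g) = g ` {s1..s2}"
        using s1(2) by (simp add: path_image_subpath)
      have "\<exists>z\<in>path_image (subpath s1 s2 g). Im (\<Phi> z) \<le> M1"
      proof (rule M1)
        show "path (subpath s1 s2 g)" using g(1) s1 s2' by (intro path_subpath) auto
        show "path_image (subpath s1 s2 g)
            \<subseteq> {z. t + e \<le> Re z \<and> Re z \<le> t + 2 * e \<and> 0 < Im z \<and> Im z \<le> 1}"
          unfolding sub using s1(1,4) inside by (auto simp: abs_le_iff) (smt (verit))+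
      qed (use s1 Re2 True in auto)
      then obtain s where "s1 \<le> s" "s \<le> s2" "Im (\<Phi> (g s)) \<le> M1"
        unfolding sub by auto
      with inside[of s] s1(1) show False by (simp add: M_def)
    next
      case False
      \<comment> \<open>On the left the real part decreases towards the exit, hence the minus signs.
        The reversed piece runs from left to right, as the bound \<open>M2\<close> expects.\<close>
      obtain s1 where s1: "0 \<le> s1" "s1 \<le> s2" "- Re (g s1) = - (t - e)"
        "\<And>s. s1 \<le> s \<Longrightarrow> s \<le> s2 \<Longrightarrow> - (t - e) \<le> - Re (g s)"
        by (rule last_crossing[of s2 "\<lambda>s. - Re (g s)" "- (t - e)"])
          (use False Re2 e g(4) s2' contg2 in \<open>auto simp: pathstart_def intro!: continuous_intros\<close>)
      have sub: "path_image (reversepath (subpath s1 s2 g)) = g ` {s1..s2}"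
        using s1(2) by (simp add: path_image_subpath)
      have "\<exists>z\<in>path_image (reversepath (subpath s1 s2 g)). Im (\<Phi> z) \<le> M2"
      proof (rule M2)
        show "path (reversepath (subpath s1 s2 g))"
          using g(1) s1 s2' by (simp add: path_subpath)
        show "path_image (reversepath (subpath s1 s2 g))
            \<subseteq> {z. t - 2 * e \<le> Re z \<and> Re z \<le> t - e \<and> 0 < Im z \<and> Im z \<le> 1}"
          unfolding sub using s1(1,4) inside by (auto simp: abs_le_iff) (smt (verit))+
      qed (use s1 Re2 False in auto)
      then obtain s where "s1 \<le> s" "s \<le> s2" "Im (\<Phi> (g s)) \<le> M2"
        unfolding sub by auto
      with inside[of s] s1(1) show False by (simp add: M_def)
    qed
  qed
qed

section \<open>Limits at boundary points\<close>

lemma continuous_on_boundary_extension: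
  fixes f g :: "'a::metric_space \<Rightarrow> 'b::metric_space"
  assumes f: "continuous_on A f" and "open A" and "B \<subseteq> closure A" and "A \<inter> B = {}"
    and lim: "\<And>z. z \<in> B \<Longrightarrow> (f \<longlongrightarrow> g z) (at z within A)"
  shows "continuous_on (A \<union> B) (\<lambda>z. if z \<in> A then f z else g z)" (is "continuous_on _ ?h")
  unfolding continuous_on_iff
proof (intro ballI allI impI)
  fix z and e :: real assume z: "z \<in> A \<union> B" and e: "e > 0"
  show "\<exists>d>0. \<forall>x'\<in>A \<union> B. dist x' z < d \<longrightarrow> dist (?h x') (?h z) < e"
  proof (cases "z \<in> A")
    case True
    obtain d1 where d1: "d1 > 0" "\<And>x. x \<in> A \<Longrightarrow> dist x z < d1 \<Longrightarrow> dist (f x) (f z) < e"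
      using f True e unfolding continuous_on_iff by blast
    obtain d2 where d2: "d2 > 0" "\<And>x. dist x z < d2 \<Longrightarrow> x \<in> A"
      using \<open>open A\<close> True unfolding open_dist by blast
    show ?thesis
      by (rule exI[of _ "min d1 d2"]) (use d1 d2 True in auto)
  next
    case False
    then have "z \<in> B" using z by simp
    then obtain d where d: "d > 0" "\<And>x. x \<in> A \<Longrightarrow> x \<noteq> z \<Longrightarrow> dist x z < d \<Longrightarrow> dist (f x) (g z) < e / 2"
      using lim[of z] e unfolding tendsto_iff eventually_at by (metis half_gt_zero)
    \<comment> \<open>The limit values inherit the estimate, since close to \<open>b\<close> the
      function \<open>f\<close> is already within \<open>e / 2\<close> of
      \<open>g z\<close>.\<close>
    have "dist (g b) (g z) \<le> e / 2" if "b \<in> B" "dist b z < d / 2" for b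
    proof (rule tendsto_upperbound)
      show "((\<lambda>x. dist (f x) (g z)) \<longlongrightarrow> dist (g b) (g z)) (at b within A)"
        by (intro tendsto_intros lim that)
      show "at b within A \<noteq> bot"
      proof -
        have "b \<in> closure A" "b \<notin> A" using that assms(3,4) by auto
        then show ?thesis by (simp add: trivial_limit_within islimpt_in_closure)
      qed
      have "dist (f x) (g z) \<le> e / 2" if "x \<in> A" "dist x b < d / 2" for x
      proof -
        have "dist x z < d" using that(2) \<open>dist b z < d / 2\<close> dist_triangle[of x z b] by linarith
        then show ?thesis using d(2)[of x] that(1) False by force
      qed
      then show "\<forall>\<^sub>F x in at b within A. dist (f x) (g z) \<le> e / 2"
        unfolding eventually_at using d(1) by (intro exI[of _ "d / 2"]) auto
    qed
    then show ?thesis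
      using d False e by (intro exI[of _ "d / 2"]) (force simp: dist_commute)
  qed
qed

text \<open>The cluster set \<open>I\<close> of \<Phi> at \<open>t\<close> is a decreasing
  intersection of compact connected sets, the closures of images of half-discs, so it is connected
  and nonempty. It lies in the countable set of solutions of \<open>cos w = c\<close>, and a
  connected countable set has at most one point.\<close>

lemma limit_of_cos_limit:
  fixes \<Phi> :: "complex \<Rightarrow> complex"
  assumes cont: "continuous_on (upper_half_plane \<inter> ball (of_real t) r) \<Phi>" and r: "0 < r"
    and bdd: "\<And>z. z \<in> upper_half_plane \<inter> ball (of_real t) r \<Longrightarrow> norm (\<Phi> z) \<le> K"
    and lim: "((\<lambda>z. cos (\<Phi> z)) \<longlongrightarrow> c) (at_upper t)"
  obtains w where "(\<Phi> \<longlongrightarrow> w) (at_upper t)"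
proof -
  define U where "U n = upper_half_plane \<inter> ball (of_real t) (r / real (Suc n))" for n
  define S where "S n = closure (\<Phi> ` U n)" for n
  have U: "U n \<subseteq> upper_half_plane \<inter> ball (of_real t) r" for n
  proof -
    have "r / real (Suc n) \<le> r / 1" using r by (intro divide_left_mono) auto
    then show ?thesis unfolding U_def by auto
  qed
  have Umono: "U n \<subseteq> U m" if "m \<le> n" for m n
  proof -
    have "r / real (Suc n) \<le> r / real (Suc m)" using r that by (intro divide_left_mono) auto
    then show ?thesis unfolding U_def by auto
  qed
  have Une: "U n \<noteq> {}" for n
  proof -
    have "Complex t (r / real (Suc n) / 2) \<in> U n"
      using r by (auto simp: U_def dist_norm cmod_def intro!: divide_strict_left_mono)
    then show ?thesis by blast
  qed
  have sub: "S n \<subseteq> cball 0 K" for n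
    unfolding S_def by (rule closure_minimal) (use bdd U in force)+
  have comp: "compact (S n)" for n
    using bounded_subset[OF bounded_cball sub[of n]] by (simp add: compact_eq_bounded_closed S_def)
  have "convex (U n)" for n
    unfolding U_def by (intro convex_Int convex_halfspace_Im_gt convex_ball)
  then have "connected (\<Phi> ` U n)" for n
    using U by (intro connected_continuous_image continuous_on_subset[OF cont] convex_connected) auto
  then have conn: "connected (S n)" for n
    unfolding S_def by (rule connected_imp_connected_closure)
  have nest: "S n \<subseteq> S m" if "m \<le> n" for m n
    unfolding S_def by (intro closure_mono image_mono Umono that)
  define I where "I = \<Inter> (range S)"
  have "connected I" unfolding I_def by (rule connected_nest[of S]) (use comp conn nest in auto)
  have cosI: "cos w = c" if "w \<in> I" for w
  proof (rule ccontr)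
    assume ne: "cos w \<noteq> c"
    define e where "e = dist (cos w) c / 2"
    have "e > 0" using ne by (simp add: e_def)
    then obtain d where d: "d > 0"
      "\<And>z. z \<in> upper_half_plane \<Longrightarrow> z \<noteq> of_real t \<Longrightarrow> dist z (of_real t) < d \<Longrightarrow> dist (cos (\<Phi> z)) c < e"
      using lim unfolding tendsto_iff eventually_at by metis
    obtain n where n: "r / real (Suc n) < d"
    proof -
      obtain n where "r / d < real n" using reals_Archimedean2 by blast
      then have "r < d * real (Suc n)" using d(1) by (simp add: field_simps)
      then have "r / real (Suc n) < d" by (simp add: pos_divide_less_eq)
      then show ?thesis by (rule that)
    qed
    have "S n \<subseteq> {z. dist (cos z) c \<le> e}"
      unfolding S_def
    proof (rule closure_minimal)
      show "closed {z. dist (cos z) c \<le> e}"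
        by (intro closed_Collect_le continuous_intros holomorphic_on_imp_continuous_on holomorphic_on_cos holomorphic_on_ident)
      show "\<Phi> ` U n \<subseteq> {z. dist (cos z) c \<le> e}"
        using d(2) n by (force simp: U_def dist_commute)
    qed
    moreover have "w \<in> S n" using that by (auto simp: I_def)
    ultimately have "dist (cos w) c \<le> e" by auto
    then show False using \<open>e > 0\<close> by (simp add: e_def)
  qed
  have "I \<noteq> {}" unfolding I_def
    by (rule compact_nest[of S]) (use comp Une nest in \<open>auto simp: S_def\<close>)
  then obtain w where w: "w \<in> I" by blast
  have "I \<subseteq> (\<Union>n::int. {w + of_real (2 * of_int n * pi), - w + of_real (2 * of_int n * pi)})"
  proof
    fix v assume "v \<in> I"
    then have "cos v = cos w" using cosI w by simp
    then show "v \<in> (\<Union>n::int. {w + of_real (2 * of_int n * pi), - w + of_real (2 * of_int n * pi)})"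
      unfolding complex_cos_eq by (fastforce elim!: Ints_cases)
  qed
  then have "countable I" by (rule countable_subset) auto
  then have Iw: "I = {w}"
    using connected_uncountable[OF \<open>connected I\<close> w] w by blast
  have "(\<Phi> \<longlongrightarrow> w) (at_upper t)"
    unfolding tendsto_iff
  proof (intro allI impI)
    fix e :: real assume "e > 0"
    have "\<exists>n. S n - ball w e = {}"
    proof (rule ccontr)
      assume "\<not> ?thesis"
      then have "\<Inter> (range (\<lambda>n. S n - ball w e)) \<noteq> {}"
        by (intro compact_nest[of "\<lambda>n. S n - ball w e"] compact_diff comp open_ball) (use nest in auto)
      moreover have "\<Inter> (range (\<lambda>n. S n - ball w e)) \<subseteq> I - ball w e" by (auto simp: I_def)
      ultimately show False using Iw \<open>e > 0\<close> by auto
    qed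
    then obtain n where n: "S n \<subseteq> ball w e" by blast
    show "\<forall>\<^sub>F z in at_upper t. dist (\<Phi> z) w < e"
      unfolding eventually_at
    proof (intro exI[of _ "r / real (Suc n)"] conjI ballI impI)
      fix z assume "z \<in> upper_half_plane" "z \<noteq> of_real t \<and> dist z (of_real t) < r / real (Suc n)"
      then have "\<Phi> z \<in> S n" using closure_subset by (force simp: S_def U_def dist_commute)
      then show "dist (\<Phi> z) w < e" using n by (auto simp: dist_commute)
    qed (use r in auto)
  qed
  then show thesis by (rule that)
qed

text \<open>Supplies the continuity up to the axis that Schwarz reflection presupposes. A barrier
  bounds \<open>Im F\<close> by a multiple of the height. On a disc of radius comparable to the
  height this bounds the derivative by a constant, so \<open>F\<close> is Lipschitz near
  \<open>t\<close> and has a limit, which must be real.\<close>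

lemma boundary_limit_of_Im:
  assumes hol: "F holomorphic_on (upper_half_plane \<inter> ball (of_real t) r)" and r: "0 < r"
    and bdd: "\<And>z. z \<in> upper_half_plane \<inter> ball (of_real t) r \<Longrightarrow> norm (F z) \<le> K0"
    and real: "\<And>s e. \<bar>s - t\<bar> < r \<Longrightarrow> 0 < e \<Longrightarrow>
      \<forall>\<^sub>F z in at_upper s. \<bar>Im (F z)\<bar> < e"
  obtains l :: real where "(F \<longlongrightarrow> of_real l) (at_upper t)"
proof -
  define \<rho> where "\<rho> = r / 4"
  define K where "K = max 1 K0"
  have \<rho>: "\<rho> > 0" "r = 4 * \<rho>" and K: "K > 0" "K0 \<le> K" using r by (auto simp: \<rho>_def K_def)
  have inball: "z \<in> ball (of_real t) r" if "\<bar>Re z - t\<bar> \<le> 2 * \<rho>" "0 \<le> Im z" "Im z \<le> \<rho>" for z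
  proof -
    have "norm (z - of_real t) \<le> \<bar>Re (z - of_real t)\<bar> + \<bar>Im (z - of_real t)\<bar>" by (rule cmod_le)
    also have "\<dots> < r" using that \<rho> by simp
    finally show ?thesis by (simp add: dist_norm norm_minus_commute)
  qed
  \<comment> \<open>The sign \<sigma> yields the upper and the lower bound for \<open>Im F\<close>
    from one argument.\<close>
  have barrier: "\<sigma> * Im (F (Complex x0 y)) \<le> 2 * K * y / \<rho>"
    if x0: "\<bar>x0 - t\<bar> < \<rho>" and y: "0 < y" "y < \<rho>" and \<sigma>: "\<bar>\<sigma>\<bar> = 1" for x0 y \<sigma> :: real
  proof -
    define D where "D = box (Complex (x0 - \<rho>) 0) (Complex (x0 + \<rho>) \<rho>)"
    have D: "z \<in> D \<longleftrightarrow> \<bar>Re z - x0\<bar> < \<rho> \<and> 0 < Im z \<and> Im z < \<rho>" for z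
      by (auto simp: D_def in_box_complex_iff)
    have DS: "D \<subseteq> upper_half_plane \<inter> ball (of_real t) r"
    proof
      fix z assume "z \<in> D"
      then show "z \<in> upper_half_plane \<inter> ball (of_real t) r"
        using inball[of z] x0 by (auto simp: D)
    qed
    \<comment> \<open>the subtracted term has the real part \<open>b\<close>, a harmonic majorant of \<open>Im F\<close> vanishing at \<open>x0\<close>\<close>
    define G where "G z = of_real \<sigma> * (- \<i> * F z)
      - of_real (K / \<rho>\<^sup>2) * ((z - of_real x0)\<^sup>2 - 2 * of_real \<rho> * \<i> * (z - of_real x0))" for z
    define b where "b z = K / \<rho>\<^sup>2 * ((Re z - x0)\<^sup>2 - (Im z)\<^sup>2 + 2 * \<rho> * Im z)" for z
    have ReG: "Re (G z) = \<sigma> * Im (F z) - b z" for z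
      by (simp add: G_def b_def power2_eq_square algebra_simps diff_divide_distrib add_divide_distrib)
    have zD: "Complex x0 y \<in> D" using y \<rho> by (simp add: D)
    have clo: "closure D = cbox (Complex (x0 - \<rho>) 0) (Complex (x0 + \<rho>) \<rho>)"
      unfolding D_def by (rule closure_box) (use zD D_def in auto)
    have \<sigma>Im: "\<sigma> * u \<le> \<bar>u\<bar>" for u using \<sigma> by (cases "0 \<le> \<sigma>") auto
    have b0: "0 \<le> b z" if "0 \<le> Im z" "Im z \<le> \<rho>" for z
    proof -
      have "(Im z)\<^sup>2 \<le> \<rho> * Im z" using that unfolding power2_eq_square by (intro mult_right_mono) auto
      also have "\<dots> \<le> 2 * \<rho> * Im z" using that \<rho> by simp
      finally have "0 \<le> (Re z - x0)\<^sup>2 - (Im z)\<^sup>2 + 2 * \<rho> * Im z" by (smt (verit) zero_le_power2)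
      then show ?thesis unfolding b_def using K by (intro mult_nonneg_nonneg) auto
    qed
    have "Re (G (Complex x0 y)) \<le> 0"
    proof (rule Re_nonpos_of_frontier[of D G])
      show "open D" "bounded D" by (auto simp: D_def bounded_box)
      show "connected D" unfolding D_def by (intro convex_connected convex_box)
      show "G holomorphic_on D"
        unfolding G_def by (intro holomorphic_intros holomorphic_on_subset[OF hol] DS)
    next
      fix l and e :: real assume l: "l \<in> frontier D" and e: "0 < e"
      then have "l \<in> cbox (Complex (x0 - \<rho>) 0) (Complex (x0 + \<rho>) \<rho>)"
        using clo by (auto simp: frontier_def)
      then have lc: "\<bar>Re l - x0\<bar> \<le> \<rho>" "0 \<le> Im l" "Im l \<le> \<rho>"
        by (auto simp: in_cbox_complex_iff)
      have lD: "l \<notin> D"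
    proof -
      have "open D" by (simp add: D_def open_box)
      then show ?thesis using l by (simp add: frontier_def interior_open)
    qed
      show "\<forall>\<^sub>F w in at l within D. Re (G w) < e"
      proof (cases "Im l = 0")
        case True
        then have "l = of_real (Re l)" by (simp add: complex_eq_iff)
        moreover have "\<bar>Re l - t\<bar> < r" using lc x0 \<rho> by linarith
        ultimately have "\<forall>\<^sub>F z in at l within upper_half_plane. \<bar>Im (F z)\<bar> < e"
          using real[of "Re l" e] e by simp
        then have "\<forall>\<^sub>F z in at l within D. \<bar>Im (F z)\<bar> < e"
          using at_le[of D upper_half_plane l] DS filter_leD by blast
        moreover have "\<forall>\<^sub>F z in at l within D. z \<in> D" by (simp add: eventually_at_filter)
        ultimately show ?thesis
        proof eventually_elim
          case (elim z)
          then show ?case using \<sigma>Im[of "Im (F z)"] b0[of z] by (simp add: ReG D)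
        qed
      next
        case False
        then have "0 < Im l" using lc by simp
        then have lU: "l \<in> upper_half_plane \<inter> ball (of_real t) r"
          using inball[of l] lc x0 by auto
        have "open (upper_half_plane \<inter> ball (of_real t) r)"
          by (intro open_Int open_halfspace_Im_gt open_ball)
        then have "F \<midarrow>l\<rightarrow> F l"
          using hol lU holomorphic_on_imp_continuous_on continuous_on_eq_continuous_at isCont_def by blast
        then have "((\<lambda>w. Re (G w)) \<longlongrightarrow> \<sigma> * Im (F l) - b l) (at l)"
          unfolding ReG b_def by (intro tendsto_intros)
        moreover have "\<sigma> * Im (F l) - b l \<le> 0"
        proof -
          have "\<rho>\<^sup>2 \<le> (Re l - x0)\<^sup>2 - (Im l)\<^sup>2 + 2 * \<rho> * Im l"
          proof (cases "Im l = \<rho>")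
            case True
            then show ?thesis by (simp add: power2_eq_square)
          next
            case False
            then have "\<bar>Re l - x0\<bar> = \<rho>" using lD lc \<open>0 < Im l\<close> by (auto simp: D)
            then have "(Re l - x0)\<^sup>2 = \<rho>\<^sup>2" by (metis power2_abs)
            moreover have "(Im l)\<^sup>2 \<le> 2 * \<rho> * Im l"
              using lc unfolding power2_eq_square by (intro mult_right_mono) auto
            ultimately show ?thesis by simp
          qed
          then have "K / \<rho>\<^sup>2 * \<rho>\<^sup>2 \<le> b l" unfolding b_def using K by (intro mult_left_mono) auto
          then have "K \<le> b l" using \<rho> by simp
          moreover have "\<sigma> * Im (F l) \<le> K"
            using \<sigma>Im[of "Im (F l)"] abs_Im_le_cmod[of "F l"] bdd[OF lU] K(2) by linarith
          ultimately show ?thesis by simp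
        qed
        ultimately have "\<forall>\<^sub>F w in at l. Re (G w) < e"
          using e by (elim order_tendstoD(2)) linarith
        then show ?thesis by (rule filter_leD[OF at_le[OF subset_UNIV]])
      qed
    qed (rule zD)
    then have "\<sigma> * Im (F (Complex x0 y)) \<le> K / \<rho>\<^sup>2 * (2 * \<rho> * y - y\<^sup>2)"
      by (simp add: ReG b_def)
    also have "\<dots> \<le> K / \<rho>\<^sup>2 * (2 * \<rho> * y)" using K by (intro mult_left_mono) auto
    also have "\<dots> = 2 * K * y / \<rho>" using \<rho> by (simp add: power2_eq_square)
    finally show ?thesis .
  qed
  have ImF: "\<bar>Im (F z)\<bar> \<le> 2 * K * Im z / \<rho>" if "\<bar>Re z - t\<bar> < \<rho>" "0 < Im z" "Im z < \<rho>" for z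
    using barrier[of "Re z" "Im z" 1] barrier[of "Re z" "Im z" "-1"] that by auto
  define S where "S = {z. \<bar>Re z - t\<bar> < \<rho> / 2 \<and> 0 < Im z \<and> Im z < \<rho> / 2}"
  \<comment> \<open>The product of the Cauchy estimate \<open>4 * exp 1 / Im z\<close> for the
    auxiliary \<open>g\<close>, the scale \<open>c = 3 * K * Im z / \<rho>\<close> and the factor
    \<open>exp 1\<close> that bounds \<open>1 / norm (g z)\<close>; the powers of
    \<open>Im z\<close> cancel.\<close>
  define C where "C = 12 * K * exp 1 * exp 1 / \<rho>"
  have SU: "S \<subseteq> upper_half_plane \<inter> ball (of_real t) r" using inball \<rho> by (force simp: S_def)
  have oU: "open (upper_half_plane \<inter> ball (of_real t) r)"
    by (intro open_Int open_halfspace_Im_gt open_ball)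
  have derF: "(F has_field_derivative deriv F z) (at z)" if "z \<in> S" for z
    using holomorphic_derivI[OF hol oU] SU that by blast
  have dF: "norm (deriv F z) \<le> C" if z: "z \<in> S" for z
  proof -
    define c where "c = 3 * K * Im z / \<rho>"
    have y: "0 < Im z" using z by (simp add: S_def)
    have c: "c > 0" using K \<rho> y by (simp add: c_def)
    have near: "w \<in> upper_half_plane \<inter> ball (of_real t) r \<and> \<bar>Im (F w)\<bar> \<le> c"
      if "norm (z - w) < Im z / 2" for w
    proof -
      have 1: "\<bar>Re z - Re w\<bar> < Im z / 2" "\<bar>Im z - Im w\<bar> < Im z / 2"
        using that abs_Re_le_cmod[of "z - w"] abs_Im_le_cmod[of "z - w"] by auto
      have 2: "\<bar>Re w - t\<bar> < \<rho>" "0 < Im w" "Im w < 3 / 2 * Im z" "Im w < \<rho>"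
        using 1 z unfolding S_def by (auto simp: abs_if split: if_splits)
      have "\<bar>Im (F w)\<bar> \<le> 2 * K * Im w / \<rho>" using ImF[of w] 2 by simp
      also have "\<dots> \<le> 2 * K * (3 / 2 * Im z) / \<rho>"
        using 2 K \<rho> by (intro divide_right_mono mult_left_mono) auto
      finally show ?thesis using inball[of w] 2 by (auto simp: c_def)
    qed
    \<comment> \<open>The modulus of \<open>g\<close> depends on \<open>Im F\<close> alone and stays
      between \<open>exp (-1)\<close> and \<open>exp 1\<close> on the disc. Thus Cauchy's inequality
      profits from the small imaginary part although \<open>Re F\<close> is merely bounded.\<close>
    define g where "g w = exp (\<i> * F w / of_real c)" for w
    have gn: "norm (g w) = exp (- Im (F w) / c)" for w by (simp add: g_def)
    have holg: "g holomorphic_on ball z (Im z / 2)"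
      unfolding g_def using c near
      by (intro holomorphic_intros holomorphic_on_subset[OF hol]) (auto simp: dist_norm)
    have cb: "cball z (Im z / 4) \<subseteq> ball z (Im z / 2)" using y by auto
    have "norm ((deriv ^^ 1) g z) \<le> fact 1 * exp 1 / (Im z / 4) ^ 1"
    proof (rule Cauchy_inequality)
      show "g holomorphic_on ball z (Im z / 4)"
        using holg by (rule holomorphic_on_subset) (use y in auto)
      show "continuous_on (cball z (Im z / 4)) g"
        using holomorphic_on_imp_continuous_on[OF holg] cb continuous_on_subset by blast
      show "0 < Im z / 4" using y by simp
      show "norm (g w) \<le> exp 1" if "norm (z - w) = Im z / 4" for w
        using near[of w] that y c by (auto simp: gn field_simps abs_le_iff)
    qed
    then have "norm (deriv g z) \<le> 4 * exp 1 / Im z" by (simp add: mult.commute)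
    moreover have "(g has_field_derivative g z * (\<i> * deriv F z / of_real c)) (at z)"
      unfolding g_def using c by (auto intro!: derivative_eq_intros derF z)
    then have "deriv g z = g z * (\<i> * deriv F z / of_real c)" by (rule DERIV_imp_deriv)
    ultimately have 1: "norm (g z) * (norm (deriv F z) / c) \<le> 4 * exp 1 / Im z"
      using c by (simp add: norm_mult norm_divide)
    have "exp (- 1) \<le> norm (g z)"
      using near[of z] y c by (auto simp: gn field_simps abs_le_iff)
    then have "exp (- 1) * (norm (deriv F z) / c) \<le> 4 * exp 1 / Im z"
      using 1 c mult_right_mono[of "exp (-1)" "norm (g z)" "norm (deriv F z) / c"] by force
    then have "norm (deriv F z) \<le> 4 * exp 1 / Im z * (c * exp 1)"
      using c by (simp add: exp_minus field_simps)
    also have "\<dots> = C" using y \<rho> by (simp add: C_def c_def field_simps)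
    finally show ?thesis .
  qed
  have "convex S"
  proof -
    have "S = box (Complex (t - \<rho> / 2) 0) (Complex (t + \<rho> / 2) (\<rho> / 2))"
      by (intro set_eqI)
        (auto simp only: S_def mem_Collect_eq in_box_complex_iff abs_diff_less_iff complex.sel greaterThanLessThan_iff)
    then show ?thesis by simp
  qed
  have lip: "norm (F z - F w) \<le> C * norm (z - w)" if "z \<in> S" "w \<in> S" for z w
    by (rule field_differentiable_bound[OF \<open>convex S\<close> _ dF])
       (use that derF in \<open>auto intro: has_field_derivative_at_within\<close>)
  have "C > 0" using K \<rho> by (simp add: C_def)
  have "uniformly_continuous_on S F"
    unfolding uniformly_continuous_on_def
  proof (intro allI impI)
    fix e :: real assume "e > 0"
    then have "dist (F w) (F z) < e" if "z \<in> S" "w \<in> S" "dist w z < e / C" for z w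
      using lip[OF that(2,1)] that(3) \<open>C > 0\<close>
      by (simp add: dist_norm field_simps)
    then show "\<exists>d>0. \<forall>x\<in>S. \<forall>x'\<in>S. dist x' x < d \<longrightarrow> dist (F x') (F x) < e"
      using \<open>e > 0\<close> \<open>C > 0\<close> by (intro exI[of _ "e / C"]) auto
  qed
  moreover have "of_real t \<in> closure S"
    unfolding closure_approachable
  proof (intro allI impI)
    fix e :: real assume "e > 0"
    then show "\<exists>y\<in>S. dist y (of_real t) < e"
      using \<rho> by (intro bexI[of _ "Complex t (min (e / 2) (\<rho> / 4))"])
        (auto simp: S_def dist_norm cmod_def)
  qed
  ultimately obtain l where l: "(F \<longlongrightarrow> l) (at (of_real t) within S)"
    using uniformly_continuous_on_extension_at_closure by blast
  have "at (of_real t) within S = at_upper t"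
  proof (rule at_within_nhd)
    show "of_real t \<in> ball (of_real t) (\<rho> / 2)" using \<rho> by simp
    show "S \<inter> ball (of_real t) (\<rho> / 2) - {of_real t} = upper_half_plane \<inter> ball (of_real t) (\<rho> / 2) - {of_real t}"
    proof -
      have "z \<in> S" if "dist (of_real t) z < \<rho> / 2" "0 < Im z" for z
        using abs_Re_le_cmod[of "z - of_real t"] abs_Im_le_cmod[of "z - of_real t"] that
        by (auto simp: S_def dist_norm norm_minus_commute)
      then show ?thesis by (auto simp: S_def)
    qed
  qed auto
  then have lim: "(F \<longlongrightarrow> l) (at_upper t)" using l by simp
  have nb: "at_upper t \<noteq> bot"
  proof -
    have "of_real t \<in> closure upper_half_plane"
      using \<open>of_real t \<in> closure S\<close> closure_mono[of S upper_half_plane] SU by auto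
    then show ?thesis by (simp add: trivial_limit_within islimpt_in_closure)
  qed
  have "((\<lambda>z. Im (F z)) \<longlongrightarrow> 0) (at_upper t)"
    unfolding tendsto_iff using real[of t] r by simp
  then have "Im l = 0" using tendsto_unique[OF nb tendsto_Im[OF lim]] by blast
  then have "l = of_real (Re l)" by (simp add: complex_eq_iff)
  with lim show thesis using that[of "Re l"] by simp
qed

text \<open>With a suitable branch of the logarithm,
  \<open>- \<i> * \<Phi> z + \<sigma> * Ln (z - \<xi>)\<close> converges at \<xi>. Its imaginary
  part is \<open>\<sigma> * Arg (z - \<xi>) - Re (\<Phi> z)\<close>. Along a half-circle the
  argument gains almost pi, so \<open>Re \<Phi>\<close> has to gain almost
  \<open>\<sigma> * pi\<close> while confined to an interval of length \<open>hi - lo\<close>. The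
  exponent is real because the square root will contribute a half.\<close>

lemma argument_variation:
  fixes \<sigma> \<xi> lo hi :: real
  assumes cont: "continuous_on upper_half_plane \<Phi>"
    and lim: "((\<lambda>z. exp (- \<i> * \<Phi> z + of_real \<sigma> * Ln (z - of_real \<xi>))) \<longlongrightarrow> C)
      (at_upper \<xi>)" and C: "C \<noteq> 0"
    and rng: "\<forall>\<^sub>F z in at_upper \<xi>. lo < Re (\<Phi> z) \<and> Re (\<Phi> z) < hi"
  shows "\<sigma> * pi \<le> hi - lo"
proof (rule ccontr)
  assume less: "\<not> \<sigma> * pi \<le> hi - lo"
  \<comment> \<open>A quarter of the supposed excess: the errors are \<open>2 * \<eta>\<close> from
    \<open>Ln (E z)\<close> at two points and \<eta> from the angles cut off.\<close>
  define \<eta> where "\<eta> = (\<sigma> * pi - (hi - lo)) / 4"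
  have \<eta>: "\<eta> > 0" using less by (simp add: \<eta>_def)
  define E where "E z = exp (- \<i> * \<Phi> z + of_real \<sigma> * Ln (z - of_real \<xi>)) / C" for z
  have E1: "(E \<longlongrightarrow> 1) (at_upper \<xi>)"
    unfolding E_def using tendsto_divide[OF lim tendsto_const[of C] C] C by simp
  have "((\<lambda>z. Ln (E z)) \<longlongrightarrow> Ln 1) (at_upper \<xi>)"
    by (rule tendsto_Ln[OF E1]) simp
  then have "\<forall>\<^sub>F z in at_upper \<xi>. norm (Ln (E z)) < \<eta>"
    using \<eta> tendstoD by fastforce
  moreover have "\<forall>\<^sub>F z in at_upper \<xi>. dist (E z) 1 < 1"
    using E1 tendstoD by fastforce
  ultimately have "\<forall>\<^sub>F z in at_upper \<xi>.
      norm (Ln (E z)) < \<eta> \<and> dist (E z) 1 < 1 \<and> lo < Re (\<Phi> z) \<and> Re (\<Phi> z) < hi"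
    using rng by eventually_elim auto
  then obtain d where d: "d > 0" and dd: "\<And>z. 0 < Im z \<Longrightarrow> dist z (of_real \<xi>) < d \<Longrightarrow>
      norm (Ln (E z)) < \<eta> \<and> dist (E z) 1 < 1 \<and> lo < Re (\<Phi> z) \<and> Re (\<Phi> z) < hi"
    unfolding eventually_at by fastforce
  define D where "D = upper_half_plane \<inter> ball (of_real \<xi>) d"
  have D: "norm (Ln (E z)) < \<eta> \<and> dist (E z) 1 < 1 \<and> lo < Re (\<Phi> z) \<and> Re (\<Phi> z) < hi" "0 < Im z"
    if "z \<in> D" for z
    using dd[of z] that by (auto simp: D_def dist_commute)
  have "connected D"
    unfolding D_def by (intro convex_connected convex_Int convex_halfspace_Im_gt convex_ball)
  \<comment> \<open>As \<open>exp (h z) = C\<close>, the values of \<open>h\<close> differ by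
    multiples of \<open>2 * pi * \<i>\<close>, so \<open>h\<close> is constant on the connected set
    \<open>D\<close>. This fixes the branch.\<close>
  define h where "h z = - \<i> * \<Phi> z + of_real \<sigma> * Ln (z - of_real \<xi>) - Ln (E z)" for z
  have E_pos: "0 < Re (E z)" if "z \<in> D" for z
  proof -
    have "norm (E z - 1) < 1" using D(1)[OF that] by (simp add: dist_norm)
    then have "\<bar>Re (E z - 1)\<bar> < 1" using abs_Re_le_cmod[of "E z - 1"] by linarith
    then show ?thesis by simp
  qed
  have Dn: "z - of_real \<xi> \<notin> \<real>\<^sub>\<le>\<^sub>0" "E z \<notin> \<real>\<^sub>\<le>\<^sub>0" if "z \<in> D" for z
    using D(2)[OF that] E_pos[OF that] by (auto simp: complex_nonpos_Reals_iff)
  have contD: "continuous_on D \<Phi>" using cont by (rule continuous_on_subset) (auto simp: D_def)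
  have contE: "continuous_on D E"
    unfolding E_def using C Dn by (intro continuous_intros contD) auto
  have conth: "continuous_on D h"
    unfolding h_def using Dn by (intro continuous_intros contD contE) auto
  have exph: "exp (h z) = C" if "z \<in> D" for z
  proof -
    have "E z \<noteq> 0" using E_pos[OF that] by auto
    then have "exp (h z) = exp (- \<i> * \<Phi> z + of_real \<sigma> * Ln (z - of_real \<xi>)) / E z"
      unfolding h_def by (subst exp_diff) simp
    also have "\<dots> = C" using C by (simp add: E_def)
    finally show ?thesis .
  qed
  have "h constant_on D"
  proof (rule continuous_discrete_range_constant[OF \<open>connected D\<close> conth])
    fix x assume "x \<in> D"
    have "1 \<le> norm (h y - h x)" if "y \<in> D" "h y \<noteq> h x" for y
    proof -
      have "exp (h y) = exp (h x)" using exph that \<open>x \<in> D\<close> by simp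
      then obtain n :: int where n: "h y = h x + (of_int (2 * n) * pi) * \<i>"
        using exp_eq by blast
      then have "n \<noteq> 0" using that by auto
      then have "1 \<le> \<bar>real_of_int n\<bar>" by linarith
      moreover have "norm (h y - h x) = 2 * \<bar>real_of_int n\<bar> * pi"
        using n by (simp add: norm_mult)
      moreover have "2 * 1 * 1 \<le> 2 * \<bar>real_of_int n\<bar> * pi"
        using \<open>1 \<le> \<bar>real_of_int n\<bar>\<close> pi_ge_two by (intro mult_mono) auto
      ultimately show ?thesis by simp
    qed
    then show "\<exists>e>0. \<forall>y. y \<in> D \<and> h y \<noteq> h x \<longrightarrow> e \<le> norm (h y - h x)"
      by (intro exI[of _ 1]) auto
  qed
  then obtain c where c: "\<And>z. z \<in> D \<Longrightarrow> h z = c" unfolding constant_on_def by blast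
  \<comment> \<open>The ends of the half-circle are outside the open half-plane, so an angle
    \<theta> is cut off at each, small enough that together they cost at most \<eta>.\<close>
  define \<theta> where "\<theta> = min 1 (\<eta> / (2 * \<bar>\<sigma>\<bar> + 1))"
  have \<theta>: "0 < \<theta>" "\<theta> \<le> 1" using \<eta> by (auto simp: \<theta>_def)
  have "\<theta> * (2 * \<bar>\<sigma>\<bar> + 1) \<le> \<eta>" by (simp add: \<theta>_def pos_le_divide_eq[symmetric])
  then have \<sigma>\<theta>: "2 * \<bar>\<sigma>\<bar> * \<theta> \<le> \<eta>" using \<theta> by (simp add: algebra_simps)
  have "\<theta> < pi" using \<theta> pi_gt3 by linarith
  define pt where "pt \<beta> = of_real \<xi> + exp (Complex (ln (d / 2)) \<beta>)" for \<beta>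
  have pt: "pt \<beta> \<in> D \<and> Im (h (pt \<beta>)) = - Re (\<Phi> (pt \<beta>)) + \<sigma> * \<beta> - Im (Ln (E (pt \<beta>)))"
    if "0 < \<beta>" "\<beta> < pi" for \<beta>
  proof -
    have "norm (pt \<beta> - of_real \<xi>) = d / 2" using d by (simp add: pt_def)
    moreover have "Im (pt \<beta>) = d / 2 * sin \<beta>" using d by (simp add: pt_def Im_exp)
    ultimately have "pt \<beta> \<in> D"
      using mult_pos_pos[OF half_gt_zero[OF d] sin_gt_zero[OF that]] d by (simp add: D_def dist_norm norm_minus_commute)
    moreover have "Ln (pt \<beta> - of_real \<xi>) = Complex (ln (d / 2)) \<beta>"
      using that by (simp add: pt_def)
    ultimately show ?thesis by (simp add: h_def)
  qed
  have 1: "pt \<theta> \<in> D" "pt (pi - \<theta>) \<in> D"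
    and 2: "- Re (\<Phi> (pt \<theta>)) + \<sigma> * \<theta> - Im (Ln (E (pt \<theta>)))
      = - Re (\<Phi> (pt (pi - \<theta>))) + \<sigma> * (pi - \<theta>) - Im (Ln (E (pt (pi - \<theta>))))"
    using pt[of \<theta>] pt[of "pi - \<theta>"] c \<theta> \<open>\<theta> < pi\<close> by auto
  have 3: "\<bar>Im (Ln (E z))\<bar> < \<eta>" if "z \<in> D" for z
    using D(1)[OF that] abs_Im_le_cmod[of "Ln (E z)"] by linarith
  have "\<sigma> * pi - 2 * \<sigma> * \<theta> = Re (\<Phi> (pt (pi - \<theta>))) - Re (\<Phi> (pt \<theta>))
      + Im (Ln (E (pt (pi - \<theta>)))) - Im (Ln (E (pt \<theta>)))"
    using 2 by (simp add: algebra_simps)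
  also have "\<dots> < hi - lo + 2 * \<eta>"
    using D(1)[OF 1(1)] D(1)[OF 1(2)] 3[OF 1(1)] 3[OF 1(2)] by linarith
  finally have "\<sigma> * pi < hi - lo + 2 * \<eta> + 2 * \<sigma> * \<theta>" by simp
  moreover have "2 * \<sigma> * \<theta> \<le> 2 * \<bar>\<sigma>\<bar> * \<theta>" using \<theta> by (intro mult_right_mono) auto
  ultimately show False using \<sigma>\<theta> \<eta> by (simp add: \<eta>_def field_simps)
qed

lemma obtain_small:
  assumes "\<forall>\<^sub>F \<epsilon> in at_right (0::real). P \<epsilon>"
  obtains \<epsilon> where "0 < \<epsilon>" "\<epsilon> < 1" "P \<epsilon>"
proof -
  have "\<forall>\<^sub>F \<epsilon> in at_right (0::real). \<epsilon> \<in> {0<..<1}" by (rule eventually_at_right_real) simp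
  then have "\<forall>\<^sub>F \<epsilon> in at_right (0::real). \<epsilon> \<in> {0<..<1} \<and> P \<epsilon>" using assms by (rule eventually_conj)
  from eventually_happens'[OF trivial_limit_at_right_real this]
  obtain \<epsilon> where "\<epsilon> \<in> {0<..<1} \<and> P \<epsilon>" ..
  then show ?thesis by (intro that[of \<epsilon>]) auto
qed

section \<open>The square root between the half-plane and the quadrant\<close>

lemma csqrt_first_quadrant:
  assumes "0 < Im z"
  shows "csqrt z \<in> first_quadrant"
proof -
  have "2 * Re (csqrt z) * Im (csqrt z) = Im ((csqrt z)\<^sup>2)" by (simp only: Im_power2)
  then have "0 < Re (csqrt z) * Im (csqrt z)" using assms by (simp del: csqrt.simps)
  then show ?thesis
    using csqrt_principal[of z] by (auto simp: first_quadrant_def zero_less_mult_iff simp del: csqrt.simps)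
qed

lemma first_quadrant_square:
  assumes "z \<in> first_quadrant"
  shows "0 < Im (z\<^sup>2)" "csqrt (z\<^sup>2) = z"
  using assms by (auto simp: first_quadrant_def Im_power2 intro!: csqrt_square)

lemma at_real_within_upper_half_plane_neq_bot:
  "at_upper t \<noteq> (bot :: complex filter)"
proof -
  have "of_real t \<in> closure upper_half_plane"
    unfolding closure_approachable
  proof (intro allI impI)
    fix e :: real assume "e > 0"
    then show "\<exists>y\<in>upper_half_plane. dist y (of_real t) < e"
      by (intro bexI[of _ "Complex t (e / 2)"]) (auto simp: dist_norm cmod_def)
  qed
  then show ?thesis by (simp add: trivial_limit_within islimpt_in_closure)
qed

lemma at_infinity_upper_half_plane_neq_bot:
  "inf at_infinity (principal upper_half_plane) \<noteq> (bot :: complex filter)"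
proof
  assume "inf at_infinity (principal upper_half_plane) = (bot :: complex filter)"
  then have "\<forall>\<^sub>F z :: complex in at_infinity. \<not> 0 < Im z"
    by (simp add: trivial_limit_def eventually_inf_principal)
  then obtain b where b: "\<And>z :: complex. b \<le> norm z \<Longrightarrow> \<not> 0 < Im z"
    unfolding eventually_at_infinity by blast
  have "b \<le> \<bar>b\<bar> + 1" "0 < \<bar>b\<bar> + 1" by linarith+
  then show False using b[of "Complex 0 (\<bar>b\<bar> + 1)"] by (simp add: cmod_def)
qed

lemma csqrt_at_real:
  assumes "0 \<le> t"
  shows "filterlim csqrt (at (of_real (sqrt t)) within first_quadrant)
    (at_upper t)"
  unfolding filterlim_at
proof
  show "\<forall>\<^sub>F z in at_upper t.
      csqrt z \<in> first_quadrant \<and> csqrt z \<noteq> of_real (sqrt t)"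
  proof (rule eventually_mono[of "\<lambda>z. z \<in> upper_half_plane"])
    fix z :: complex assume "z \<in> upper_half_plane"
    then have "csqrt z \<in> first_quadrant" by (simp add: csqrt_first_quadrant)
    then show "csqrt z \<in> first_quadrant \<and> csqrt z \<noteq> of_real (sqrt t)"
      by (auto simp: first_quadrant_def simp del: csqrt.simps)
  qed (simp add: eventually_at_filter)
  show "(csqrt \<longlongrightarrow> of_real (sqrt t)) (at_upper t)"
  proof (cases "t = 0")
    case True
    have "((\<lambda>z :: complex. sqrt (norm z)) \<longlongrightarrow> sqrt (norm (0 :: complex))) (at 0 within upper_half_plane)"
      by (intro tendsto_intros)
    then have "(csqrt \<longlongrightarrow> 0) (at 0 within upper_half_plane)"
      by - (rule tendsto_norm_zero_cancel, simp)
    then show ?thesis using True by simp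
  next
    case False
    then have "isCont csqrt (of_real t)"
      using assms by (intro continuous_at_csqrt) (auto simp: complex_nonpos_Reals_iff)
    then have "csqrt \<midarrow>of_real t\<rightarrow> of_real (sqrt t)"
      using assms by (simp add: isCont_def csqrt_of_real_nonneg)
    then show ?thesis by (rule tendsto_within_subset) auto
  qed
qed

lemma csqrt_at_infinity:
  "filterlim csqrt (inf at_infinity (principal first_quadrant))
     (inf at_infinity (principal upper_half_plane))"
  unfolding filterlim_inf filterlim_principal
proof
  have "LIM z at_infinity. sqrt (norm (z :: complex)) :> at_top"
    by (rule filterlim_compose[OF sqrt_at_top filterlim_norm_at_top])
  then have "LIM z at_infinity. csqrt z :> at_infinity"
    by (intro filterlim_norm_at_top_imp_at_infinity) simp
  then show "LIM z inf at_infinity (principal upper_half_plane). csqrt z :> at_infinity"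
    by (rule filterlim_mono) auto
  show "\<forall>\<^sub>F z in inf at_infinity (principal upper_half_plane). csqrt z \<in> first_quadrant"
    by (auto simp: eventually_inf_principal csqrt_first_quadrant)
qed

lemma at_real_nbhd:
  assumes "\<forall>\<^sub>F z in at_upper t. P z"
  obtains d where "0 < d" "\<And>z. 0 < Im z \<Longrightarrow> dist z (of_real t) < d \<Longrightarrow> P z"
  using assms unfolding eventually_at by fastforce

text \<open>The principal root jumps across the negative axis. In this form its limit from above
  becomes visible, because there \<open>- z\<close> is close to the positive axis, where the root is
  continuous.\<close>

lemma csqrt_rotate:
  assumes "0 < Im z"
  shows "csqrt z = \<i> * csqrt (- z)"
proof -
  have "csqrt (- z) = - \<i> * csqrt z"
  proof (rule csqrt_unique)
    show "(- \<i> * csqrt z)\<^sup>2 = - z" by (simp add: power_mult_distrib)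
    show "0 < Re (- \<i> * csqrt z) \<or> Re (- \<i> * csqrt z) = 0 \<and> 0 \<le> Im (- \<i> * csqrt z)"
      using csqrt_first_quadrant[OF assms] by (auto simp: first_quadrant_def simp del: csqrt.simps)
  qed
  then show ?thesis by simp
qed

text \<open>The case distinction is the reason for dividing by the root: the factor leaves real
  boundary values real on the positive axis and turns imaginary ones into real ones on the negative
  axis.\<close>

lemma inverse_csqrt_at_real:
  assumes "t \<noteq> 0"
  shows "((\<lambda>z. inverse (csqrt z)) \<longlongrightarrow>
    (if 0 < t then of_real (inverse (sqrt t)) else - \<i> * of_real (inverse (sqrt \<bar>t\<bar>))))
    (at_upper t)"
proof (cases "0 < t")
  case True
  then have "(csqrt \<longlongrightarrow> of_real (sqrt t)) (at_upper t)"
    using csqrt_at_real[of t] by (simp add: filterlim_at)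
  then show ?thesis using True tendsto_inverse[of csqrt "of_real (sqrt t)"] by simp
next
  case False
  then have "t < 0" using assms by simp
  have "isCont csqrt (- of_real t)"
    using \<open>t < 0\<close> by (intro continuous_at_csqrt) (auto simp: complex_nonpos_Reals_iff)
  then have "((\<lambda>z. csqrt (- z)) \<longlongrightarrow> csqrt (- of_real t)) (at_upper t)"
    by (rule isCont_tendsto_compose) (intro tendsto_intros)
  moreover have "csqrt (- of_real t) = of_real (sqrt \<bar>t\<bar>)"
    using \<open>t < 0\<close> csqrt_of_real_nonneg[of "\<bar>t\<bar>"] by simp
  ultimately have "((\<lambda>z. csqrt (- z)) \<longlongrightarrow> of_real (sqrt \<bar>t\<bar>)) (at_upper t)"
    by simp
  then have "((\<lambda>z. - \<i> * inverse (csqrt (- z))) \<longlongrightarrow> - \<i> * inverse (of_real (sqrt \<bar>t\<bar>)))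
      (at_upper t)"
    using assms by (intro tendsto_intros) auto
  moreover have "\<forall>\<^sub>F z in at_upper t.
      - \<i> * inverse (csqrt (- z)) = inverse (csqrt z)"
    unfolding eventually_at_filter by (auto simp: csqrt_rotate[of "_ :: complex"] intro!: always_eventually)
  ultimately show ?thesis
    using False by (subst (asm) tendsto_cong) auto
qed

lemma bounded_mult_tendsto_0:
  fixes f g :: "'a \<Rightarrow> real"
  assumes "(f \<longlongrightarrow> 0) F" "\<forall>\<^sub>F x in F. \<bar>g x\<bar> \<le> K"
  shows "((\<lambda>x. g x * f x) \<longlongrightarrow> 0) F"
proof (rule Lim_null_comparison)
  show "\<forall>\<^sub>F x in F. norm (g x * f x) \<le> K * \<bar>f x\<bar>"
    using assms(2) by eventually_elim (auto simp: abs_mult intro: mult_right_mono)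
  show "((\<lambda>x. K * \<bar>f x\<bar>) \<longlongrightarrow> 0) F"
    using tendsto_mult_right_zero[OF tendsto_rabs_zero[OF assms(1)]] by simp
qed

text \<open>This inversion preserves the upper half-plane and exchanges 0 with infinity, which makes
  \<open>argument_variation\<close> available for the channel at infinity.\<close>

lemma minus_inverse_at_0:
  "filterlim (\<lambda>z :: complex. - inverse z) (inf at_infinity (principal upper_half_plane))
     (at 0 within upper_half_plane)"
  unfolding filterlim_inf filterlim_principal
proof
  have "filterlim inverse at_infinity (at (0 :: complex))" by (rule filterlim_inverse_at_infinity)
  then have "filterlim (\<lambda>z :: complex. - inverse z) at_infinity (at 0)"
    unfolding filterlim_at_infinity[OF order_refl] by simp
  then show "LIM z (at (0 :: complex) within upper_half_plane). - inverse z :> at_infinity"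
    by (rule filterlim_mono) (auto simp: at_le)
  show "\<forall>\<^sub>F z in at 0 within upper_half_plane. - inverse (z :: complex) \<in> upper_half_plane"
    by (auto simp: eventually_at_filter Im_complex_div_lemma divide_pos_pos
        add_nonneg_pos intro!: always_eventually)
qed

lemma Ln_minus_inverse:
  assumes "0 < Im z"
  shows "Ln (- inverse z) = \<i> * pi - Ln z"
proof (rule Ln_unique)
  have z: "z \<noteq> 0" using assms by auto
  show "exp (\<i> * pi - Ln z) = - inverse z"
    using z by (simp add: exp_diff inverse_eq_divide exp_pi_i)
  have "0 < Im (Ln z) \<and> Im (Ln z) < pi" using assms z Im_Ln_pos_lt by blast
  then show "- pi < Im (\<i> * pi - Ln z)" "Im (\<i> * pi - Ln z) \<le> pi" by auto
qed

section \<open>Polynomials with alternating values\<close>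

lemma monic_linear_product:
  fixes y :: "nat \<Rightarrow> real"
  shows "degree (\<Prod>j\<in>A. [:- y j, 1:]) = card A" "lead_coeff (\<Prod>j\<in>A. [:- y j, 1:]) = 1"
  by (subst degree_prod_eq_sum_degree; simp) (simp add: lead_coeff_prod)

text \<open>The sum is the divided difference of order \<open>M\<close>, that is, the coefficient of
  degree \<open>M\<close> of the interpolation polynomial \<open>R\<close> in Lagrange form.
  Interpolation reproduces \<open>E\<close>, whose degree is smaller.\<close>

lemma divided_difference_eq_0:
  fixes E :: "real poly" and y :: "nat \<Rightarrow> real"
  assumes inj: "inj_on y {..M}" and deg: "degree E < M"
  shows "(\<Sum>i\<le>M. poly E (y i) / (\<Prod>j\<in>{..M}-{i}. y i - y j)) = 0"
proof -
  define w where "w i = (\<Prod>j\<in>{..M}-{i}. y i - y j)" for i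
  define l where "l i = (\<Prod>j\<in>{..M}-{i}. [:- y j, 1:])" for i
  define R where "R = (\<Sum>i\<le>M. smult (poly E (y i) / w i) (l i))"
  have w: "w i \<noteq> 0" if "i \<le> M" for i
    unfolding w_def using inj that by (auto simp: inj_on_def)
  have l: "degree (l i) = M" "coeff (l i) M = 1" if "i \<le> M" for i
    using monic_linear_product[of y "{..M}-{i}"] that by (simp_all add: l_def)
  have l_poly: "poly (l i) (y h) = (if h = i then w i else 0)" if "h \<le> M" "i \<le> M" for h i
    using that by (auto simp: l_def w_def poly_prod intro!: prod.cong prod_zero)
  have "R = E"
  proof (rule ccontr)
    assume "R \<noteq> E"
    have "degree R \<le> M"
      unfolding R_def by (intro degree_sum_le) (auto intro: order_trans[OF degree_smult_le] simp: l)
    then have degRE: "degree (R - E) \<le> M" using deg by (intro degree_diff_le) auto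
    have "y ` {..M} \<subseteq> {v. poly (R - E) v = 0}"
    proof (rule image_subsetI)
      fix h assume "h \<in> {..M}"
      then have h: "h \<le> M" by simp
      have "poly R (y h) = (\<Sum>i\<le>M. if h = i then poly E (y h) else 0)"
        unfolding R_def poly_sum poly_smult using w h
        by (intro sum.cong) (auto simp: l_poly)
      then have "poly R (y h) = poly E (y h)" using h by simp
      then show "y h \<in> {v. poly (R - E) v = 0}" by simp
    qed
    then have "card (y ` {..M}) \<le> card {v. poly (R - E) v = 0}"
      using \<open>R \<noteq> E\<close> by (intro card_mono poly_roots_finite) auto
    also have "\<dots> \<le> degree (R - E)" using \<open>R \<noteq> E\<close> by (intro card_poly_roots_bound) auto
    finally show False using degRE inj by (simp add: card_image)
  qed
  then have "coeff R M = 0" using deg by (simp add: coeff_eq_0)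
  then show ?thesis by (simp add: R_def coeff_sum l w_def)
qed

text \<open>Exactly the \<open>M - i\<close> factors with \<open>j > i\<close> are negative; the
  exponent \<open>M + i\<close> has the same parity and avoids truncated subtraction.\<close>

lemma node_product_sign:
  fixes y :: "nat \<Rightarrow> real"
  assumes mono: "strict_mono_on {..M} y" and i: "i \<le> M"
  shows "0 < (- 1) ^ (M + i) * (\<Prod>j\<in>{..M}-{i}. y i - y j)"
proof -
  have "{..M} - {i} = {..<i} \<union> {i<..M}" using i by auto
  then have "(\<Prod>j\<in>{..M}-{i}. y i - y j) = (\<Prod>j<i. y i - y j) * (\<Prod>j\<in>{i<..M}. y i - y j)"
    by (metis (no_types, lifting) prod.union_disjoint finite_lessThan finite_greaterThanAtMost ivl_disj_int_two(4) disjoint_iff greaterThanAtMost_iff lessThan_iff not_less_iff_gr_or_eq)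
  also have "(\<Prod>j\<in>{i<..M}. y i - y j) = (\<Prod>j\<in>{i<..M}. (- 1) * (y j - y i))"
    by (intro prod.cong) auto
  also have "\<dots> = (- 1) ^ (M - i) * (\<Prod>j\<in>{i<..M}. y j - y i)"
    by (subst prod.distrib) simp
  finally have eq: "(- 1) ^ (M + i) * (\<Prod>j\<in>{..M}-{i}. y i - y j) =
      ((- 1) ^ (M + i) * (- 1) ^ (M - i)) * ((\<Prod>j<i. y i - y j) * (\<Prod>j\<in>{i<..M}. y j - y i))"
    by simp
  have "(- 1) ^ (M + i) * (- 1) ^ (M - i) = (1 :: real)"
  proof -
    have "(- 1) ^ (M + i) * (- 1) ^ (M - i) = (- 1 :: real) ^ (M + i + (M - i))"
      by (rule power_add[symmetric])
    also have "M + i + (M - i) = 2 * M" using i by simp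
    finally show ?thesis by simp
  qed
  moreover have "0 < (\<Prod>j<i. y i - y j)"
    using mono i by (intro prod_pos) (auto simp: strict_mono_on_def)
  moreover have "0 < (\<Prod>j\<in>{i<..M}. y j - y i)"
    using mono i by (intro prod_pos) (auto simp: strict_mono_on_def)
  ultimately show ?thesis unfolding eq by simp
qed

text \<open>The sign condition gives all terms of the divided difference the same sign, so a
  vanishing sum forces each of them to vanish. Working with weak inequalities avoids counting zeros
  with multiplicity when a competitor attains the extremal error too.\<close>

lemma weak_alternation_zero:
  fixes E :: "real poly" and y :: "nat \<Rightarrow> real"
  assumes mono: "strict_mono_on {..M} y" and deg: "degree E < M"
    and alt: "\<And>i. i \<le> M \<Longrightarrow> 0 \<le> (- 1) ^ i * poly E (y i)"
    and i: "i \<le> M"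
  shows "poly E (y i) = 0"
proof -
  define w where "w i = (\<Prod>j\<in>{..M}-{i}. y i - y j)" for i
  have wpos: "0 < (- 1) ^ (M + j) * w j" if "j \<le> M" for j
    unfolding w_def by (rule node_product_sign[OF mono that])
  have nonneg: "0 \<le> (- 1) ^ M * (poly E (y j) / w j)" if "j \<le> M" for j
  proof -
    have "w j \<noteq> 0" using wpos[OF that] by auto
    then have "(- 1) ^ M * (poly E (y j) / w j) =
        ((- 1) ^ j * poly E (y j)) * ((- 1) ^ (M + j) * w j) / (w j * w j)"
      by (simp add: power_add field_simps flip: power_mult_distrib)
    also have "0 \<le> \<dots>"
      by (intro divide_nonneg_nonneg mult_nonneg_nonneg[OF alt[OF that] less_imp_le[OF wpos[OF that]]]
          zero_le_square)
    finally show ?thesis .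
  qed
  have "(\<Sum>j\<le>M. (- 1) ^ M * (poly E (y j) / w j)) = 0"
    using divided_difference_eq_0[OF strict_mono_on_imp_inj_on[OF mono] deg]
    unfolding sum_distrib_left[symmetric] by (simp only: w_def mult_zero_right)
  then have "(- 1) ^ M * (poly E (y i) / w i) = 0"
    using nonneg i by (subst (asm) sum_nonneg_eq_0_iff) auto
  then show ?thesis using wpos[OF i] by auto
qed

lemma sum_even_indices:
  fixes h :: "nat \<Rightarrow> real"
  shows "(\<Sum>i\<le>2 * n. if even i then h i else 0) = (\<Sum>i\<le>n. h (2 * i))"
  by (induction n) simp_all

lemma even_part_sum:
  fixes c :: "nat \<Rightarrow> real"
  shows "(\<Sum>i\<le>2 * n. c i * t ^ i) + (\<Sum>i\<le>2 * n. c i * (- t) ^ i) = 2 * (\<Sum>i\<le>n. c (2 * i) * (t\<^sup>2) ^ i)"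
proof -
  have "(\<Sum>i\<le>2 * n. c i * t ^ i) + (\<Sum>i\<le>2 * n. c i * (- t) ^ i) =
      (\<Sum>i\<le>2 * n. if even i then 2 * (c i * t ^ i) else 0)"
    unfolding sum.distrib[symmetric] by (intro sum.cong) auto
  also have "\<dots> = (\<Sum>i\<le>n. 2 * (c (2 * i) * t ^ (2 * i)))" by (rule sum_even_indices)
  finally show ?thesis by (simp add: sum_distrib_left power_mult)
qed

text \<open>The sign pattern is mirrored at 0, so plain alternation of \<open>D\<close> breaks at
  the gap between the two intervals. The even part restores it: as a polynomial in the square it has
  degree at most \<open>M - 1\<close> and alternates at \<open>M + 1\<close> points, so it vanishes
  there. Two values of the same weak sign with sum 0 are both 0, which gives \<open>D\<close> the
  \<open>2 * (M + 1)\<close> zeros that its degree forbids.\<close>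

lemma symmetric_alternation_zero:
  fixes D :: "real poly" and u :: "nat \<Rightarrow> real"
  assumes deg: "degree D \<le> 2 * (M - 1)" and "0 < M"
    and mono: "strict_mono_on {..M} u" and u0: "\<And>i. i \<le> M \<Longrightarrow> 0 < u i"
    and alt: "\<And>i. i \<le> M \<Longrightarrow> 0 \<le> (- 1) ^ i * poly D (sqrt (u i))"
      "\<And>i. i \<le> M \<Longrightarrow> 0 \<le> (- 1) ^ i * poly D (- sqrt (u i))"
  shows "D = 0"
proof (rule ccontr)
  assume "D \<noteq> 0"
  define E where "E = (\<Sum>i\<le>M - 1. monom (coeff D (2 * i)) i)"
  have D_sum: "poly D t = (\<Sum>i\<le>2 * (M - 1). coeff D i * t ^ i)" for t
    unfolding poly_altdef using deg by (intro sum.mono_neutral_left) (auto simp: coeff_eq_0)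
  have even: "poly D t + poly D (- t) = 2 * poly E (t\<^sup>2)" for t
    unfolding D_sum even_part_sum by (simp add: E_def poly_sum poly_monom)
  have "degree E \<le> M - 1"
    unfolding E_def by (intro degree_sum_le) (auto intro: order_trans[OF degree_monom_le])
  then have degE: "degree E < M" using \<open>0 < M\<close> by simp
  have E2: "2 * poly E (u i) = poly D (sqrt (u i)) + poly D (- sqrt (u i))" if "i \<le> M" for i
    using even[of "sqrt (u i)"] u0[OF that] by simp
  have E0: "poly E (u i) = 0" if "i \<le> M" for i
  proof (rule weak_alternation_zero[OF mono degE _ that])
    fix j assume j: "j \<le> M"
    have "0 \<le> (- 1) ^ j * (2 * poly E (u j))"
      unfolding E2[OF j] distrib_left using alt[OF j] by (intro add_nonneg_nonneg)
    moreover have "(- 1) ^ j * (2 * poly E (u j)) = 2 * ((- 1) ^ j * poly E (u j))" by simp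
    ultimately show "0 \<le> (- 1) ^ j * poly E (u j)" by linarith
  qed
  have D0: "poly D (sqrt (u i)) = 0 \<and> poly D (- sqrt (u i)) = 0" if "i \<le> M" for i
    using E2[OF that] E0[OF that] alt[OF that] by (cases "even i") auto
  define A where "A = (\<lambda>i. sqrt (u i)) ` {..M}"
  have inj: "inj_on (\<lambda>i. sqrt (u i)) {..M}"
    using strict_mono_on_imp_inj_on[OF mono] by (auto simp: inj_on_def)
  have "A \<inter> uminus ` A = {}"
  proof -
    have pos: "0 < v" if "v \<in> A" for v using that u0 by (auto simp: A_def)
    have False if "v \<in> A" "w \<in> A" "v = - w" for v w
      using pos[OF that(1)] pos[OF that(2)] that(3) by simp
    then show ?thesis by blast
  qed
  then have "card (A \<union> uminus ` A) = card A + card (uminus ` A)"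
    by (intro card_Un_disjoint) (auto simp: A_def)
  also have "\<dots> = 2 * (M + 1)"
    using inj by (simp add: A_def card_image)
  finally have "2 * (M + 1) = card (A \<union> uminus ` A)" by simp
  also have "\<dots> \<le> card {v. poly D v = 0}"
    using D0 \<open>D \<noteq> 0\<close> by (intro card_mono poly_roots_finite) (auto simp: A_def)
  also have "\<dots> \<le> degree D" using \<open>D \<noteq> 0\<close> by (rule card_poly_roots_bound)
  finally show False using deg by simp
qed

section \<open>Channels of the comb domain\<close>

locale comb =
  fixes q p m :: nat and k :: "nat \<Rightarrow> nat" and x B :: "nat \<Rightarrow> real" and a :: real
    and \<phi> :: "complex \<Rightarrow> complex"
  assumes qp: "q \<le> p" and m: "0 < m" and k: "\<forall>j\<in>{0..p}. 0 < k j"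
    and a0: "0 < a" and a1: "a < 1"
    and x_mono: "strict_mono_on {1..p} x"
    and x_left: "\<forall>j\<in>{1..q}. 0 < x j \<and> x j < a"
    and x_right: "\<forall>j\<in>{q+1..p}. 1 < x j"
    and B: "\<forall>j\<in>{0..p}. 0 < B j"
    and normalized: "normalized_comb_map q m p k B a \<phi>"
    and ends: "prescribed_ends q m p k B x \<phi>"
begin

abbreviation \<Omega> :: "complex set" where "\<Omega> \<equiv> comb_domain q m p k B"

abbreviation W :: real where "W \<equiv> strip_width m p k"

definition N :: nat where "N = (\<Sum>j=0..q. k j)"

definition c :: real where "c = pi * N"

text \<open>From left to right the channels are \<open>(\<alpha> (j + 1), \<alpha> j)\<close> for \<open>j = q, \<dots>, 0\<close>, then comes
  the cut, centred at \<open>c = \<alpha> 0\<close>, then \<open>(c, \<beta> p)\<close> and \<open>(\<beta> j, \<beta> (j - 1))\<close> for \<open>j = p, \<dots>, q + 1\<close>.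
  With \<open>x\<^sub>0 = 0\<close>, the channel \<open>(lo j, hi j)\<close> belongs to \<open>x\<^sub>j\<close>, and \<open>(c, \<beta> p)\<close> belongs to infinity.\<close>

definition \<alpha> :: "nat \<Rightarrow> real" where "\<alpha> j = pi * real (\<Sum>i=j..q. k i)"

definition \<beta> :: "nat \<Rightarrow> real" where "\<beta> j = pi * real (N + m + (\<Sum>i=j+1..p. k i))"

definition lo :: "nat \<Rightarrow> real" where "lo j = (if j \<le> q then \<alpha> (j + 1) else \<beta> j)"

definition hi :: "nat \<Rightarrow> real" where "hi j = (if j \<le> q then \<alpha> j else \<beta> (j - 1))"

definition X :: "nat \<Rightarrow> real" where "X j = (if j = 0 then 0 else x j)"

text \<open>A common upper bound for the levels \<open>B j\<close>. At points of the domain above it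
  the real part avoids all rays and the axis of the cut, so the channels are separated
  there.\<close>

definition height :: real where "height = (\<Sum>j\<le>p. B j)"

lemma B_le_height: "j \<le> p \<Longrightarrow> B j \<le> height"
  unfolding height_def using B by (intro member_le_sum) (auto simp: less_imp_le)

lemma ray_abscissa_eq: "ray_abscissa q m p k j = (if j \<le> q then \<alpha> j else \<beta> j)"
  by (simp add: ray_abscissa_def \<alpha>_def \<beta>_def N_def)

lemma alpha_ends: "\<alpha> 0 = c" "\<alpha> (Suc q) = 0"
  by (simp_all add: \<alpha>_def c_def N_def)

lemma alpha_step: "j \<le> q \<Longrightarrow> \<alpha> j = \<alpha> (Suc j) + pi * k j"
  by (simp add: \<alpha>_def sum.atLeast_Suc_atMost algebra_simps)

lemma alpha_antimono: "i \<le> j \<Longrightarrow> \<alpha> j \<le> \<alpha> i"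
  unfolding \<alpha>_def by (intro mult_left_mono of_nat_mono sum_mono2) auto

lemma beta_ends: "\<beta> p = c + pi * m" "\<beta> q = W"
proof -
  have "(\<Sum>j=0..p. k j) = N + (\<Sum>i=q+1..p. k i)"
    unfolding N_def using qp sum.ub_add_nat[of 0 q k "p - q"] by simp
  then show "\<beta> q = W" by (simp add: \<beta>_def strip_width_def algebra_simps)
qed (simp add: \<beta>_def c_def algebra_simps)

lemma beta_step: "0 < j \<Longrightarrow> j \<le> p \<Longrightarrow> \<beta> (j - 1) = \<beta> j + pi * k j"
  by (simp add: \<beta>_def sum.atLeast_Suc_atMost algebra_simps)

lemma beta_antimono: "i \<le> j \<Longrightarrow> \<beta> j \<le> \<beta> i"
  unfolding \<beta>_def by (intro mult_left_mono of_nat_mono add_mono sum_mono2) auto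

lemma k_ge: "j \<le> p \<Longrightarrow> pi \<le> pi * k j"
  using k by (auto simp: Suc_le_eq[symmetric] simp del: of_nat_0_less_iff)

lemma m_ge: "pi \<le> pi * m" using m by simp

lemma alpha_1: "\<alpha> 1 = c - pi * k 0"
  using alpha_step[of 0] alpha_ends by simp

lemma alpha_nonneg: "0 \<le> \<alpha> j" by (simp add: \<alpha>_def sum_nonneg)

lemma beta_ge: "c + pi \<le> \<beta> j"
proof -
  have "\<beta> j \<ge> pi * real (N + m)" unfolding \<beta>_def by (intro mult_left_mono of_nat_mono) auto
  then have "\<beta> j \<ge> c + pi * m" by (simp add: c_def algebra_simps)
  then show ?thesis using m_ge by linarith
qed

lemma c_ge: "pi \<le> c"
  using alpha_1 alpha_nonneg[of 1] k_ge[of 0] by linarith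

lemma W_ge: "c + pi \<le> W" using beta_ge[of q] beta_ends by simp

lemma hi_lo: "j \<le> p \<Longrightarrow> hi j = lo j + pi * k j"
  using alpha_step[of j] beta_step[of j] by (auto simp: hi_def lo_def)

lemma B0: "0 < B 0" using B by simp

lemma cosh_B0: "1 < cosh (B 0)"
  using B0 cosh_real_strict_mono[of 0 "B 0"] by simp

lemma cosh_ratio:
  assumes "B 0 \<le> v"
  shows "0 < cosh (B 0) / cosh v" "cosh (B 0) / cosh v \<le> 1"
  using assms B0 cosh_real_nonneg_le_iff[of "B 0" v] by auto

lemma comb_cut_iff:
  "w \<in> comb_cut q k (B 0) \<longleftrightarrow> B 0 \<le> Im w \<and> \<bar>Re w - c\<bar> \<le> arccos (cosh (B 0) / cosh (Im w))"
  by (simp add: comb_cut_def c_def N_def)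

lemma arccos_ratio:
  assumes "B 0 \<le> v"
  shows "0 \<le> arccos (cosh (B 0) / cosh v)" "arccos (cosh (B 0) / cosh v) < pi / 2"
proof -
  note r = cosh_ratio[OF assms]
  have "- 1 \<le> cosh (B 0) / cosh v" using r(1) by linarith
  then show "0 \<le> arccos (cosh (B 0) / cosh v)" using r(2) by (rule arccos_lbound)
  show "arccos (cosh (B 0) / cosh v) < pi / 2"
    using arccos_less_arccos[of 0 "cosh (B 0) / cosh v"] r by simp
qed

lemma in_comb_domain:
  "w \<in> \<Omega> \<longleftrightarrow> 0 < Im w \<and> 0 < Re w \<and> Re w < W \<and> w \<notin> comb_cut q k (B 0) \<and>
    (\<forall>j\<in>{1..p}. Re w = ray_abscissa q m p k j \<longrightarrow> Im w < B j)"
  by (force simp: comb_domain_def comb_ray_def)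

lemma high_points:
  assumes "w \<in> \<Omega>" "height < Im w"
  shows "Re w \<noteq> 0" "Re w \<noteq> W" "Re w \<noteq> c" "j \<in> {1..p} \<Longrightarrow> Re w \<noteq> ray_abscissa q m p k j"
proof -
  have "B 0 \<le> Im w" using B_le_height[of 0] assms by simp
  then show "Re w \<noteq> c"
    using assms arccos_ratio(1)[of "Im w"] by (auto simp: in_comb_domain comb_cut_iff)
  show "j \<in> {1..p} \<Longrightarrow> Re w \<noteq> ray_abscissa q m p k j"
    using assms B_le_height[of j] by (force simp: in_comb_domain)
qed (use assms in \<open>auto simp: in_comb_domain\<close>)

text \<open>The path runs horizontally first and then upwards. The order matters because the cut
  widens with the height. At the level of \<open>w\<close> the segment stays as far from the axis of
  the cut as the nearer of its end points, while a vertical line clears the cut at every height once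
  its distance from the axis is at least \<open>pi / 2\<close>.\<close>

lemma channel_connected:
  assumes lohi: "0 \<le> l" "h \<le> W" "c \<le> l \<or> h \<le> c"
    and rays: "\<And>j. j \<in> {1..p} \<Longrightarrow> \<not> (l < ray_abscissa q m p k j \<and> ray_abscissa q m p k j < h)"
    and u: "l < u" "u < h" "pi / 2 \<le> \<bar>u - c\<bar>"
    and w: "w \<in> \<Omega>" "l < Re w" "Re w < h" "R < Im w" and t: "Im w \<le> t"
  shows "connected_component (\<Omega> \<inter> {z. R < Im z}) w (Complex u t)"
proof -
  define S where "S = closed_segment w (Complex u (Im w)) \<union>
    closed_segment (Complex u (Im w)) (Complex u t)"
  have inS: "v \<in> \<Omega> \<inter> {z. R < Im z}"
    if v: "l < Re v" "Re v < h" "Im w \<le> Im v"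
      and cut: "Im v = Im w \<and> min \<bar>Re w - c\<bar> \<bar>u - c\<bar> \<le> \<bar>Re v - c\<bar> \<or> Re v = u" for v
  proof -
    have "v \<notin> comb_cut q k (B 0)"
    proof
      assume v': "v \<in> comb_cut q k (B 0)"
      then have "\<bar>Re v - c\<bar> < pi / 2"
        using arccos_ratio(2)[of "Im v"] by (auto simp: comb_cut_iff)
      then have "Im v = Im w" "\<bar>Re w - c\<bar> \<le> \<bar>Re v - c\<bar>"
        using cut u(3) by (auto simp: min_def split: if_splits)
      then have "w \<in> comb_cut q k (B 0)" using v' by (auto simp: comb_cut_iff)
      then show False using w(1) by (simp add: in_comb_domain)
    qed
    then show ?thesis
      using v lohi rays w by (auto simp: in_comb_domain)
  qed
  have "connected S"
    unfolding S_def by (intro connected_Un connected_segment) auto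
  moreover have "S \<subseteq> \<Omega> \<inter> {z. R < Im z}"
  proof
    fix v assume "v \<in> S"
    then consider "v \<in> closed_segment w (Complex u (Im w))"
      | "v \<in> closed_segment (Complex u (Im w)) (Complex u t)"
      unfolding S_def by blast
    then show "v \<in> \<Omega> \<inter> {z. R < Im z}"
    proof cases
      case 1
      then obtain s where s: "0 \<le> s" "s \<le> 1" "v = (1 - s) *\<^sub>R w + s *\<^sub>R Complex u (Im w)"
        unfolding closed_segment_def by blast
      have Im_v: "Im v = Im w" unfolding s(3) by (simp add: algebra_simps)
      have Re_v: "Re v \<in> closed_segment (Re w) u"
        unfolding closed_segment_def using s by auto
      then have "min (Re w) u \<le> Re v" "Re v \<le> max (Re w) u"
        by (auto simp: closed_segment_eq_real_ivl split: if_splits)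
      then show ?thesis
        using lohi(3) u w by (intro inS) (auto simp: Im_v min_def max_def abs_if split: if_splits)
    next
      case 2
      then obtain s where s: "0 \<le> s" "s \<le> 1" "v = (1 - s) *\<^sub>R Complex u (Im w) + s *\<^sub>R Complex u t"
        unfolding closed_segment_def by blast
      have Re_v: "Re v = u" unfolding s(3) by (simp add: algebra_simps)
      have "Im v = Im w + s * (t - Im w)" unfolding s(3) by (simp add: algebra_simps)
      then have "Im w \<le> Im v" using s t by simp
      then show ?thesis using Re_v u by (intro inS) auto
    qed
  qed
  moreover have "w \<in> S" "Complex u t \<in> S" unfolding S_def by auto
  ultimately show ?thesis unfolding connected_component_def by blast
qed

text \<open>The content of convergence to an end that the sequel uses. The last clause joins any
  point of the channel, above any level below it, to the values of \<open>f\<close> far along the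
  filter; pulled back by \<Phi> this becomes a curve on which \<open>Im \<Phi>\<close> is
  large.\<close>

definition reaches_channel ::
    "(complex \<Rightarrow> complex) \<Rightarrow> complex filter \<Rightarrow> real \<Rightarrow> real \<Rightarrow> bool" where
  "reaches_channel f F l h \<longleftrightarrow>
     (\<forall>R. \<forall>\<^sub>F z in F. R < Im (f z)) \<and>
     (\<forall>\<^sub>F z in F. l < Re (f z) \<and> Re (f z) < h) \<and>
     (\<forall>w R. w \<in> \<Omega> \<longrightarrow> l < Re w \<longrightarrow> Re w < h \<longrightarrow> R < Im w \<longrightarrow>
        (\<forall>\<^sub>F z in F. connected_component (\<Omega> \<inter> {z. R < Im z}) w (f z)))"

text \<open>A connected set of domain points above \<open>height\<close> cannot leave the channel,
  as its real parts form an interval that avoids both edges. For the last clause, the path from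
  \<open>channel_connected\<close> is joined to the component that defines the end.\<close>

lemma reaches_channelI:
  assumes lim: "filterlim \<phi> (end_at_infinity \<Omega> (\<lambda>v. Complex u v)) F"
    and lohi: "0 \<le> l" "h \<le> W" "c \<le> l \<or> h \<le> c"
    and rays: "\<And>j. j \<in> {1..p} \<Longrightarrow> \<not> (l < ray_abscissa q m p k j \<and> ray_abscissa q m p k j < h)"
    and u: "l < u" "u < h" "pi / 2 \<le> \<bar>u - c\<bar>"
    and block: "\<And>w. w \<in> \<Omega> \<Longrightarrow> height < Im w \<Longrightarrow> Re w \<noteq> l \<and> Re w \<noteq> h"
  shows "reaches_channel \<phi> F l h"
proof -
  have ev: "\<forall>\<^sub>F z in F. \<forall>\<^sub>F t in at_top. connected_component (\<Omega> \<inter> {z. R < Im z}) (Complex u t) (\<phi> z)"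
    for R
  proof -
    have "filterlim \<phi> (principal {w. \<forall>\<^sub>F t in at_top.
        connected_component (\<Omega> \<inter> {z. R < Im z}) (Complex u t) w}) F"
      using lim unfolding end_at_infinity_def by (rule filterlim_mono) (auto intro: INF_lower)
    then show ?thesis by (simp add: filterlim_principal)
  qed
  have ex: "\<exists>t. P t" if "\<forall>\<^sub>F t in at_top. P t" for P :: "real \<Rightarrow> bool"
    using that trivial_limit_at_top_linorder by (rule eventually_happens'[rotated])
  have "\<forall>\<^sub>F z in F. R < Im (\<phi> z)" for R
    using ev[of R]
  proof eventually_elim
    case (elim z)
    then obtain t where "connected_component (\<Omega> \<inter> {z. R < Im z}) (Complex u t) (\<phi> z)"
      using ex by blast
    then show ?case using connected_component_in by blast
  qed
  moreover have "\<forall>\<^sub>F z in F. l < Re (\<phi> z) \<and> Re (\<phi> z) < h"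
    using ev[of height]
  proof eventually_elim
    case (elim z)
    then obtain t where "connected_component (\<Omega> \<inter> {z. height < Im z}) (Complex u t) (\<phi> z)"
      using ex by blast
    then obtain S where S: "connected S" "S \<subseteq> \<Omega> \<inter> {z. height < Im z}" "Complex u t \<in> S" "\<phi> z \<in> S"
      unfolding connected_component_def by blast
    have "connected (Re ` S)" by (intro connected_continuous_image continuous_intros S)
    moreover have "u \<in> Re ` S" using S(3) by force
    moreover have "Re (\<phi> z) \<in> Re ` S" using S(4) by force
    moreover have "l \<notin> Re ` S" "h \<notin> Re ` S" using block S(2) by force+
    ultimately show ?case
      using u connectedD_interval[of "Re ` S" "Re (\<phi> z)" u l] connectedD_interval[of "Re ` S" u "Re (\<phi> z)" h]
      by (metis not_le less_imp_le)
  qed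
  moreover have "\<forall>\<^sub>F z in F. connected_component (\<Omega> \<inter> {z. R < Im z}) w (\<phi> z)"
    if w: "w \<in> \<Omega>" "l < Re w" "Re w < h" "R < Im w" for w R
    using ev[of R]
  proof eventually_elim
    case (elim z)
    then have "\<forall>\<^sub>F t in at_top. Im w \<le> t \<and> connected_component (\<Omega> \<inter> {z. R < Im z}) (Complex u t) (\<phi> z)"
      by (intro eventually_conj eventually_ge_at_top)
    then obtain t where "Im w \<le> t" "connected_component (\<Omega> \<inter> {z. R < Im z}) (Complex u t) (\<phi> z)"
      using ex by blast
    with channel_connected[OF lohi rays u w] show ?case using connected_component_trans by blast
  qed
  ultimately show ?thesis unfolding reaches_channel_def by blast
qed

lemma channel_no_ray:
  assumes "j \<le> p" "i \<in> {1..p}"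
  shows "\<not> (lo j < ray_abscissa q m p k i \<and> ray_abscissa q m p k i < hi j)"
proof (cases "j \<le> q")
  case True
  show ?thesis
  proof (cases "i \<le> j")
    case True
    then show ?thesis using \<open>j \<le> q\<close> alpha_antimono[of i j] by (auto simp: hi_def ray_abscissa_eq)
  next
    case False
    moreover have "\<alpha> j \<le> \<beta> i"
      using alpha_antimono[of 0 j] alpha_ends beta_ge[of i] pi_gt_zero by linarith
    ultimately show ?thesis
      using \<open>j \<le> q\<close> alpha_antimono[of "j + 1" i] by (auto simp: hi_def lo_def ray_abscissa_eq)
  qed
next
  case False
  have "\<alpha> i \<le> \<beta> j"
    using alpha_antimono[of 0 i] alpha_ends beta_ge[of j] pi_gt_zero by linarith
  moreover have "i \<le> j - 1 \<or> j \<le> i" by linarith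
  ultimately show ?thesis
    using False beta_antimono[of i "j - 1"] beta_antimono[of j i]
    by (elim disjE) (auto simp: hi_def lo_def ray_abscissa_eq)
qed

lemma central_channel_no_ray:
  assumes "i \<in> {1..p}"
  shows "\<not> (c < ray_abscissa q m p k i \<and> ray_abscissa q m p k i < \<beta> p)"
  using assms alpha_antimono[of 0 i] alpha_ends beta_antimono[of i p] by (auto simp: ray_abscissa_eq)

lemma channel_block:
  assumes "j \<le> p" "w \<in> \<Omega>" "height < Im w"
  shows "Re w \<noteq> lo j \<and> Re w \<noteq> hi j"
proof -
  have *: "Re w \<noteq> \<alpha> i" if "i \<le> Suc q" for i
  proof (cases "i = 0 \<or> i = Suc q")
    case True
    then show ?thesis using high_points(1,3)[OF assms(2,3)] alpha_ends by auto
  next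
    case False
    then show ?thesis
      using high_points(4)[OF assms(2,3), of i] qp that by (auto simp: ray_abscissa_eq)
  qed
  have **: "Re w \<noteq> \<beta> i" if "q \<le> i" "i \<le> p" for i
  proof (cases "i = q")
    case True
    then show ?thesis using high_points(2)[OF assms(2,3)] beta_ends by auto
  next
    case False
    then show ?thesis
      using high_points(4)[OF assms(2,3), of i] that by (auto simp: ray_abscissa_eq)
  qed
  show ?thesis using * ** \<open>j \<le> p\<close> by (auto simp: lo_def hi_def)
qed

lemma central_channel_block:
  assumes "w \<in> \<Omega>" "height < Im w"
  shows "Re w \<noteq> c \<and> Re w \<noteq> \<beta> p"
proof (cases "q < p")
  case True
  then show ?thesis
    using high_points(3)[OF assms] high_points(4)[OF assms, of p] by (auto simp: ray_abscissa_eq)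
next
  case False
  then show ?thesis using high_points(2,3)[OF assms] beta_ends qp by auto
qed

text \<open>A single \<epsilon> from the definition of the end is enough. With
  \<open>\<epsilon> < 1\<close> the path lies inside the channel, whose width is at least pi, and
  even next to the cut its distance from the axis is at least \<open>pi - 1\<close>, which exceeds
  \<open>pi / 2\<close>.\<close>

lemma reaches_finite:
  assumes "j \<le> p"
  shows "reaches_channel \<phi> (at (of_real (X j)) within first_quadrant) (lo j) (hi j)"
proof -
  note pi = pi_gt3
  have lohi: "0 \<le> lo j" "hi j \<le> W" "c \<le> lo j \<or> hi j \<le> c"
  proof -
    show "0 \<le> lo j" using alpha_nonneg beta_ge[of j] c_ge pi by (auto simp: lo_def intro: order_trans)
    show "hi j \<le> W"
      using alpha_antimono[of 0 j] alpha_ends W_ge pi beta_antimono[of q "j - 1"] beta_ends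
      by (auto simp: hi_def)
    show "c \<le> lo j \<or> hi j \<le> c"
      using alpha_antimono[of 0 j] alpha_ends beta_ge[of j] pi by (auto simp: lo_def hi_def)
  qed
  note * = reaches_channelI[OF _ lohi channel_no_ray[OF assms] _ _ _ channel_block[OF assms]]
  have width: "lo j + 3 < hi j" using hi_lo[OF assms] k_ge[OF assms] pi by linarith
  consider "j = 0" | "1 \<le> j" "j \<le> q" | "q < j" by linarith
  then show ?thesis
  proof cases
    case 1
    have "tends_right_end \<Omega> (\<alpha> 1) \<phi> (at 0 within first_quadrant)"
      using ends alpha_ends(2) unfolding prescribed_ends_def ray_abscissa_eq
      by (cases "0 < q") auto
    then obtain \<epsilon> where "0 < \<epsilon>" "\<epsilon> < 1" and lim: "filterlim \<phi> (end_at_infinity \<Omega> (\<lambda>v. Complex (\<alpha> 1 + \<epsilon>) v))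
        (at 0 within first_quadrant)"
      unfolding tends_right_end_def using obtain_small by blast
    show ?thesis
    proof (intro *[of "\<alpha> 1 + \<epsilon>"])
      have "pi / 2 \<le> c - (\<alpha> 1 + \<epsilon>)"
        using alpha_1 k_ge[of 0] \<open>\<epsilon> < 1\<close> pi by linarith
      then show "pi / 2 \<le> \<bar>\<alpha> 1 + \<epsilon> - c\<bar>" by linarith
    qed (use 1 width \<open>0 < \<epsilon>\<close> \<open>\<epsilon> < 1\<close> lim in \<open>auto simp: X_def lo_def\<close>)
  next
    case 2
    then have "tends_left_end \<Omega> (\<alpha> j) \<phi> (at (of_real (x j)) within first_quadrant)"
      using ends unfolding prescribed_ends_def ray_abscissa_eq by auto
    then obtain \<epsilon> where "0 < \<epsilon>" "\<epsilon> < 1" and lim: "filterlim \<phi> (end_at_infinity \<Omega> (\<lambda>v. Complex (\<alpha> j - \<epsilon>) v))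
        (at (of_real (x j)) within first_quadrant)"
      unfolding tends_left_end_def using obtain_small by blast
    show ?thesis
    proof (intro *[of "\<alpha> j - \<epsilon>"])
      have "pi / 2 \<le> c - (\<alpha> j - \<epsilon>)"
        using alpha_1 k_ge[of 0] alpha_antimono[OF 2(1)] \<open>0 < \<epsilon>\<close> pi by linarith
      then show "pi / 2 \<le> \<bar>\<alpha> j - \<epsilon> - c\<bar>" by linarith
    qed (use 2 width \<open>0 < \<epsilon>\<close> \<open>\<epsilon> < 1\<close> lim in \<open>auto simp: X_def hi_def\<close>)
  next
    case 3
    then have "tends_right_end \<Omega> (\<beta> j) \<phi> (at (of_real (x j)) within first_quadrant)"
      using ends assms unfolding prescribed_ends_def ray_abscissa_eq by auto
    then obtain \<epsilon> where "0 < \<epsilon>" "\<epsilon> < 1" "filterlim \<phi> (end_at_infinity \<Omega> (\<lambda>v. Complex (\<beta> j + \<epsilon>) v))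
        (at (of_real (x j)) within first_quadrant)"
      unfolding tends_right_end_def using obtain_small by blast
    then show ?thesis
      using 3 width pi beta_ge[of j] by (intro *[of "\<beta> j + \<epsilon>"]) (auto simp: X_def lo_def)
  qed
qed

lemma reaches_infinity:
  "reaches_channel \<phi> (inf at_infinity (principal first_quadrant)) c (\<beta> p)"
proof -
  note pi = pi_gt3
  have "tends_left_end \<Omega> (\<beta> p) \<phi> (inf at_infinity (principal first_quadrant))"
    using normalized beta_ends qp unfolding normalized_comb_map_def ray_abscissa_eq
    by (cases "q < p") auto
  then obtain \<epsilon> where \<epsilon>: "0 < \<epsilon>" "\<epsilon> < 1" "filterlim \<phi> (end_at_infinity \<Omega> (\<lambda>v. Complex (\<beta> p - \<epsilon>) v))
      (inf at_infinity (principal first_quadrant))"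
    unfolding tends_left_end_def using obtain_small by blast
  have "c < \<beta> p - \<epsilon>" "pi / 2 \<le> \<beta> p - \<epsilon> - c" "0 \<le> c" "\<beta> p \<le> W"
    using \<epsilon> pi beta_ge[of p] c_ge beta_antimono[OF qp] beta_ends(2) by linarith+
  then show ?thesis
    using \<epsilon>(1)
    by (intro reaches_channelI[OF \<epsilon>(3) _ _ _ central_channel_no_ray _ _ _ central_channel_block]) auto
qed

lemma channel_cover:
  assumes w: "w \<in> \<Omega>" "height < Im w"
  obtains (side) j where "j \<le> p" "lo j < Re w" "Re w < hi j"
    | (central) "c < Re w" "Re w < \<beta> p"
proof -
  note hp = high_points[OF w]
  have strip: "0 < Re w" "Re w < W" using w by (auto simp: in_comb_domain)
  consider "Re w < c" | "c < Re w" "Re w < \<beta> p" | "\<beta> p < Re w"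
    using central_channel_block[OF w] by linarith
  then show thesis
  proof cases
    case 1
    \<comment> \<open>The abscissas decrease with the index, so the largest index whose line is to
      the right of \<open>w\<close> determines the channel. To the right of the cut it is the
      smallest index whose line is to the left.\<close>
    define j where "j = Max {j. j \<le> q \<and> Re w < \<alpha> j}"
    have fin: "finite {j. j \<le> q \<and> Re w < \<alpha> j}" by auto
    have "0 \<in> {j. j \<le> q \<and> Re w < \<alpha> j}" using 1 alpha_ends by simp
    then have j: "j \<le> q" "Re w < \<alpha> j" using Max_in[OF fin] unfolding j_def by blast+
    have "\<alpha> (Suc j) \<le> Re w"
    proof (cases "j = q")
      case True
      then show ?thesis using strip alpha_ends by simp
    next
      case False
      show ?thesis
      proof (rule ccontr)
        assume "\<not> \<alpha> (Suc j) \<le> Re w"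
        then have "Suc j \<in> {j. j \<le> q \<and> Re w < \<alpha> j}" using j False by simp
        from Max_ge[OF fin this] show False by (simp flip: j_def)
      qed
    qed
    then have "lo j < Re w" "Re w < hi j"
      using j qp channel_block[OF _ w, of j] by (auto simp: lo_def hi_def)
    with order_trans[OF j(1) qp] show thesis by (rule side)
  next
    case 2
    then show thesis by (rule central)
  next
    case 3
    define j where "j = Min {j. j \<le> p \<and> \<beta> j < Re w}"
    have fin: "finite {j. j \<le> p \<and> \<beta> j < Re w}" by auto
    have "p \<in> {j. j \<le> p \<and> \<beta> j < Re w}" using 3 by simp
    then have j: "j \<le> p" "\<beta> j < Re w" using Min_in[OF fin] unfolding j_def by blast+
    have "q < j"
      using j strip beta_ends beta_antimono[of j q] by (cases "q < j") auto
    have "Re w \<le> \<beta> (j - 1)"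
    proof (rule ccontr)
      assume "\<not> Re w \<le> \<beta> (j - 1)"
      then have "j - 1 \<in> {j. j \<le> p \<and> \<beta> j < Re w}" using j by simp
      from Min_le[OF fin this] show False using \<open>q < j\<close> by (simp flip: j_def)
    qed
    then have "lo j < Re w" "Re w < hi j"
      using j \<open>q < j\<close> channel_block[OF j(1) w] by (auto simp: lo_def hi_def)
    with j(1) show thesis by (rule side)
  qed
qed

section \<open>Boundary correspondence\<close>

definition \<Phi> :: "complex \<Rightarrow> complex" where "\<Phi> z = \<phi> (csqrt z)"

definition \<xi> :: "nat \<Rightarrow> real" where "\<xi> j = (X j)\<^sup>2"

text \<open>Together with \<open>line_side\<close>, disjoint open neighbourhoods of the two parts of
  the finite boundary. The edge of the cut lies within \<open>pi / 2\<close> of its axis and not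
  below \<open>B 0\<close>; the walls and rays are at least pi away from the axis, and the base has
  height 0. The thresholds separate the two.\<close>

definition cut_side :: "complex set" where
  "cut_side = {w. \<bar>Re w - c\<bar> < pi / 2 \<and> B 0 / 2 < Im w}"

definition line_side :: "complex set" where
  "line_side = {w. pi / 2 < \<bar>Re w - c\<bar> \<or> Im w < B 0 / 2}"

lemma sides: "open cut_side" "open line_side" "cut_side \<inter> line_side = {}"
proof -
  show "open cut_side" "open line_side" unfolding cut_side_def line_side_def
    by (intro open_Collect_conj open_Collect_disj open_Collect_less continuous_intros)+
  show "cut_side \<inter> line_side = {}" by (auto simp: cut_side_def line_side_def)
qed

lemma X_pos:
  assumes "j \<le> p" "j \<noteq> 0"
  shows "0 < X j"
proof (cases "j \<le> q")
  case True
  then show ?thesis using x_left assms by (simp add: X_def)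
next
  case False
  then have "1 < x j" using x_right assms by simp
  then show ?thesis using assms by (simp add: X_def)
qed

lemma X_nonneg: "j \<le> p \<Longrightarrow> 0 \<le> X j"
  using X_pos[of j] by (cases "j = 0") (auto simp: X_def)

lemma sqrt_xi: "j \<le> p \<Longrightarrow> sqrt (\<xi> j) = X j"
  using X_nonneg by (simp add: \<xi>_def)

lemma xi_0: "\<xi> 0 = 0" by (simp add: \<xi>_def X_def)

lemma xi_nonneg: "0 \<le> \<xi> j" by (simp add: \<xi>_def)

lemma Phi_comp: "\<Phi> = \<phi> \<circ> csqrt" by (simp add: \<Phi>_def fun_eq_iff)

lemma Phi_hol: "\<Phi> holomorphic_on upper_half_plane"
proof -
  have "\<phi> \<circ> csqrt holomorphic_on upper_half_plane"
  proof (rule holomorphic_on_compose_gen)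
    show "csqrt holomorphic_on upper_half_plane"
      by (intro holomorphic_on_subset[OF holomorphic_on_csqrt]) (auto simp: complex_nonpos_Reals_iff)
    show "\<phi> holomorphic_on first_quadrant" using normalized by (simp add: normalized_comb_map_def)
  qed (auto simp: csqrt_first_quadrant)
  then show ?thesis by (simp only: Phi_comp)
qed

lemma Phi_cont: "continuous_on upper_half_plane \<Phi>"
  using Phi_hol holomorphic_on_imp_continuous_on by blast

lemma Phi_bij: "bij_betw \<Phi> upper_half_plane \<Omega>"
proof -
  have "bij_betw csqrt upper_half_plane first_quadrant"
    by (rule bij_betwI[of _ _ _ "\<lambda>z. z\<^sup>2"])
       (auto simp: csqrt_first_quadrant first_quadrant_square)
  then have "bij_betw (\<phi> \<circ> csqrt) upper_half_plane \<Omega>"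
    using normalized by (intro bij_betw_trans) (auto simp: normalized_comb_map_def)
  then show ?thesis by (simp only: Phi_comp)
qed

lemma Phi_in: "0 < Im z \<Longrightarrow> \<Phi> z \<in> \<Omega>"
  using Phi_bij by (auto simp: bij_betw_def)

lemma Phi_strip: "0 < Im z \<Longrightarrow> 0 < Im (\<Phi> z) \<and> 0 < Re (\<Phi> z) \<and> Re (\<Phi> z) < W"
  using Phi_in[of z] by (simp add: in_comb_domain)

lemma open_comb_domain: "open \<Omega>"
proof -
  have "open (\<Phi> ` upper_half_plane)"
    using Phi_bij by (intro open_mapping_thm3[OF Phi_hol] open_halfspace_Im_gt) (auto simp: bij_betw_def)
  then show ?thesis using Phi_bij by (simp add: bij_betw_def)
qed

lemma Phi_inverse:
  obtains \<psi> where "continuous_on \<Omega> \<psi>" "\<And>w. w \<in> \<Omega> \<Longrightarrow> 0 < Im (\<psi> w) \<and> \<Phi> (\<psi> w) = w"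
    "\<And>z. 0 < Im z \<Longrightarrow> \<psi> (\<Phi> z) = z"
proof -
  have inj: "inj_on \<Phi> upper_half_plane" and im: "\<Phi> ` upper_half_plane = \<Omega>"
    using Phi_bij by (auto simp: bij_betw_def)
  obtain \<psi> where \<psi>: "\<psi> holomorphic_on \<Phi> ` upper_half_plane"
    "\<And>z. z \<in> upper_half_plane \<Longrightarrow> \<psi> (\<Phi> z) = z"
    using holomorphic_has_inverse[OF Phi_hol open_halfspace_Im_gt inj] by metis
  have "0 < Im (\<psi> w) \<and> \<Phi> (\<psi> w) = w" if "w \<in> \<Omega>" for w
    using that \<psi>(2) unfolding im[symmetric] by auto
  then show thesis
    using that[of \<psi>] \<psi> im holomorphic_on_imp_continuous_on[of \<psi>] by simp
qed

lemma reaches_compose: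
  assumes "reaches_channel \<phi> F l h" "filterlim csqrt F F'"
  shows "reaches_channel \<Phi> F' l h"
proof -
  have "\<forall>\<^sub>F z in F'. P (\<Phi> z)" if "\<forall>\<^sub>F z in F. P (\<phi> z)" for P
    using assms(2) that unfolding filterlim_iff \<Phi>_def by blast
  note * = this
  have 1: "\<forall>\<^sub>F z in F. R < Im (\<phi> z)" "\<forall>\<^sub>F z in F. l < Re (\<phi> z) \<and> Re (\<phi> z) < h" for R
    using assms(1) unfolding reaches_channel_def by blast+
  have 2: "\<forall>\<^sub>F z in F. connected_component (\<Omega> \<inter> {z. R < Im z}) w (\<phi> z)"
    if "w \<in> \<Omega>" "l < Re w" "Re w < h" "R < Im w" for w R
    using assms(1) that unfolding reaches_channel_def by blast
  show ?thesis
    unfolding reaches_channel_def using *[OF 1(1)] *[OF 1(2)] *[OF 2] by blast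
qed

lemma Phi_reaches_finite:
  assumes "j \<le> p"
  shows "reaches_channel \<Phi> (at_upper (\<xi> j)) (lo j) (hi j)"
  using reaches_compose[OF reaches_finite[OF assms]] csqrt_at_real[OF xi_nonneg, of j]
  by (simp add: sqrt_xi[OF assms])

lemma Phi_reaches_infinity:
  "reaches_channel \<Phi> (inf at_infinity (principal upper_half_plane)) c (\<beta> p)"
  by (rule reaches_compose[OF reaches_infinity csqrt_at_infinity])

text \<open>The link between the channels and Koebe's lemma: connections in the comb domain become
  curves of the kind that \<open>high_path_stays\<close> restricts.\<close>

lemma lift_path:
  assumes "0 < Im z" "0 < Im z'" "connected_component (\<Omega> \<inter> {w. M < Im w}) (\<Phi> z) (\<Phi> z')"
  obtains g where "path g" "path_image g \<subseteq> upper_half_plane" "pathstart g = z" "pathfinish g = z'"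
    "\<And>u. u \<in> path_image g \<Longrightarrow> M < Im (\<Phi> u)"
proof -
  obtain \<psi> where \<psi>: "continuous_on \<Omega> \<psi>" "\<And>w. w \<in> \<Omega> \<Longrightarrow> 0 < Im (\<psi> w) \<and> \<Phi> (\<psi> w) = w"
    "\<And>z. 0 < Im z \<Longrightarrow> \<psi> (\<Phi> z) = z"
    using Phi_inverse by blast
  define T where "T = \<Omega> \<inter> {w. M < Im w}"
  have "open T" unfolding T_def by (intro open_Int open_comb_domain open_halfspace_Im_gt)
  then have "path_connected (connected_component_set T (\<Phi> z))"
    by (intro connected_open_path_connected open_connected_component connected_connected_component)
  moreover have "\<Phi> z \<in> connected_component_set T (\<Phi> z)" "\<Phi> z' \<in> connected_component_set T (\<Phi> z)"
    using assms(3) connected_component_in(1)[OF assms(3)] by (auto simp: T_def)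
  ultimately obtain g where g: "path g" "path_image g \<subseteq> connected_component_set T (\<Phi> z)"
    "pathstart g = \<Phi> z" "pathfinish g = \<Phi> z'"
    unfolding path_connected_def by blast
  then have gT: "path_image g \<subseteq> T" using connected_component_subset by blast
  show thesis
  proof (rule that[of "\<psi> \<circ> g"])
    show "path (\<psi> \<circ> g)"
      using g(1) gT by (intro path_continuous_image continuous_on_subset[OF \<psi>(1)]) (auto simp: T_def)
    show "path_image (\<psi> \<circ> g) \<subseteq> upper_half_plane"
      using gT \<psi>(2) by (auto simp: path_image_compose T_def)
    show "pathstart (\<psi> \<circ> g) = z" "pathfinish (\<psi> \<circ> g) = z'"
      using g(3,4) \<psi>(3) assms(1,2) by (auto simp: pathstart_compose pathfinish_compose)
    show "M < Im (\<Phi> u)" if "u \<in> path_image (\<psi> \<circ> g)" for u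
    proof -
      obtain v where "v \<in> path_image g" "u = \<psi> v"
        using \<open>u \<in> path_image (\<psi> \<circ> g)\<close> by (auto simp: path_image_compose)
      then have "v \<in> T" using gT by blast
      then show ?thesis using \<psi>(2)[of v] \<open>u = \<psi> v\<close> by (simp add: T_def)
    qed
  qed
qed

section \<open>Behaviour of \<Phi> near the real axis\<close>

definition special :: "real set" where "special = \<xi> ` {0..p}"

text \<open>If \<Phi> is very high at a point near \<open>t\<close>, its value lies in a channel,
  and that channel leads to some \<open>\<xi> j\<close> or to infinity. The lifted connection starts
  next to \<open>t\<close> and ends far from it with \<open>Im \<Phi>\<close> large throughout,
  contrary to \<open>high_path_stays\<close>. The strip bounds the real part.\<close>

lemma bounded_near:
  assumes "t \<notin> special"
  obtains r K where "0 < r" "\<And>z. 0 < Im z \<Longrightarrow> dist z (of_real t) < r \<Longrightarrow> norm (\<Phi> z) \<le> K"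
proof -
  have "closed special" unfolding special_def by (intro finite_imp_closed) auto
  then obtain e0 where e0: "0 < e0" "ball t e0 \<inter> special = {}"
    using assms unfolding closed_def open_contains_ball by blast
  \<comment> \<open>A quarter of the gap keeps the box of half-width \<open>2 * e\<close> around
    \<open>t\<close> apart from the points within \<open>e\<close> of any
    \<open>\<xi> j\<close>.\<close>
  define e where "e = e0 / 4"
  have e: "0 < e" "\<And>j. j \<le> p \<Longrightarrow> 4 * e \<le> \<bar>\<xi> j - t\<bar>"
  proof -
    show "0 < e" using e0 by (simp add: e_def)
    fix j assume "j \<le> p"
    then have "\<xi> j \<in> special" by (auto simp: special_def)
    then show "4 * e \<le> \<bar>\<xi> j - t\<bar>" using e0(2) by (force simp: e_def dist_real_def)
  qed
  have pos: "\<And>z. 0 < Im z \<Longrightarrow> 0 < Im (\<Phi> z)" using Phi_strip by blast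
  obtain M0 where M0: "\<And>g. path g \<Longrightarrow> path_image g \<subseteq> upper_half_plane \<Longrightarrow>
      (\<And>z. z \<in> path_image g \<Longrightarrow> M0 < Im (\<Phi> z)) \<Longrightarrow>
      \<bar>Re (pathstart g) - t\<bar> < e \<Longrightarrow> Im (pathstart g) < 1 \<Longrightarrow>
      \<bar>Re (pathfinish g) - t\<bar> < 2 * e \<and> Im (pathfinish g) < 1"
    using high_path_stays[OF Phi_hol pos e(1), where t=t] by metis
  define M where "M = max M0 height"
  have key: False
    if z: "0 < Im z" "dist z (of_real t) < min e 1" "M < Im (\<Phi> z)"
      and F: "F \<noteq> bot" "\<forall>\<^sub>F u in F. 0 < Im u \<and> \<not> (\<bar>Re u - t\<bar> < 2 * e \<and> Im u < 1)"
        "reaches_channel \<Phi> F l h" "l < Re (\<Phi> z)" "Re (\<Phi> z) < h" for z F l h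
  proof -
    have "\<forall>\<^sub>F u in F. connected_component (\<Omega> \<inter> {w. M < Im w}) (\<Phi> z) (\<Phi> u)"
      using F(3-5) z(3) Phi_in[OF z(1)] unfolding reaches_channel_def by blast
    with F(2) have "\<forall>\<^sub>F u in F. (0 < Im u \<and> \<not> (\<bar>Re u - t\<bar> < 2 * e \<and> Im u < 1)) \<and>
        connected_component (\<Omega> \<inter> {w. M < Im w}) (\<Phi> z) (\<Phi> u)"
      by (rule eventually_conj)
    then obtain u where u: "0 < Im u" "\<not> (\<bar>Re u - t\<bar> < 2 * e \<and> Im u < 1)"
      "connected_component (\<Omega> \<inter> {w. M < Im w}) (\<Phi> z) (\<Phi> u)"
      using eventually_happens'[OF F(1)] by blast
    obtain g where g: "path g" "path_image g \<subseteq> upper_half_plane" "pathstart g = z" "pathfinish g = u"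
      "\<And>v. v \<in> path_image g \<Longrightarrow> M < Im (\<Phi> v)"
      using lift_path[OF z(1) u(1,3)] by blast
    have "\<bar>Re z - t\<bar> < e" "Im z < 1"
      using z(2) abs_Re_le_cmod[of "z - of_real t"] abs_Im_le_cmod[of "z - of_real t"]
      by (auto simp: dist_norm)
    then have "\<bar>Re u - t\<bar> < 2 * e \<and> Im u < 1"
      using M0[OF g(1,2)] g(3,4,5) by (force simp: M_def)
    with u(2) show False by blast
  qed
  have bound: "Im (\<Phi> z) \<le> M" if z: "0 < Im z" "dist z (of_real t) < min e 1" for z
  proof (rule ccontr)
    assume "\<not> Im (\<Phi> z) \<le> M"
    then have hz: "M < Im (\<Phi> z)" by simp
    then have "height < Im (\<Phi> z)" by (simp add: M_def)
    with Phi_in[OF z(1)] show False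
    proof (cases rule: channel_cover)
      case (side j)
      show False
      proof (rule key[OF z hz at_real_within_upper_half_plane_neq_bot _ Phi_reaches_finite side(2,3)])
        show "j \<le> p" by (rule side)
        show "\<forall>\<^sub>F u in at_upper (\<xi> j).
            0 < Im u \<and> \<not> (\<bar>Re u - t\<bar> < 2 * e \<and> Im u < 1)"
          unfolding eventually_at
        proof (intro exI[of _ e] conjI ballI impI e(1))
          fix u assume "u \<in> upper_half_plane" "u \<noteq> of_real (\<xi> j) \<and> dist u (of_real (\<xi> j)) < e"
          then have "0 < Im u" "\<bar>Re u - \<xi> j\<bar> < e"
            using abs_Re_le_cmod[of "u - of_real (\<xi> j)"] by (auto simp: dist_norm)
          then show "0 < Im u" "\<not> (\<bar>Re u - t\<bar> < 2 * e \<and> Im u < 1)"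
            using e(2)[OF side(1)] e(1) by linarith+
        qed
      qed
    next
      case central
      show False
      proof (rule key[OF z hz at_infinity_upper_half_plane_neq_bot _ Phi_reaches_infinity central])
        have "norm u < \<bar>t\<bar> + 2 * e + 1" if "0 < Im u" "\<bar>Re u - t\<bar> < 2 * e" "Im u < 1" for u
          using cmod_le[of u] that by linarith
        then show "\<forall>\<^sub>F u in inf at_infinity (principal upper_half_plane).
            0 < Im u \<and> \<not> (\<bar>Re u - t\<bar> < 2 * e \<and> Im u < 1)"
          unfolding eventually_inf_principal eventually_at_infinity
          by (intro exI[of _ "\<bar>t\<bar> + 2 * e + 1"]) (auto simp: not_less[symmetric])
      qed
    qed
  qed
  show thesis
  proof (rule that[of "min e 1" "W + M"])
    fix z assume z: "0 < Im z" "dist z (of_real t) < min e 1"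
    show "norm (\<Phi> z) \<le> W + M"
      using cmod_le[of "\<Phi> z"] bound[OF z] Phi_strip[OF z(1)] by linarith
  qed (use e in auto)
qed

text \<open>The inverse of \<Phi> maps \<open>K\<close> to a compact subset of the open half-plane,
  which keeps a positive distance from the real point.\<close>

lemma Phi_proper:
  assumes "compact K" "K \<subseteq> \<Omega>"
  shows "\<forall>\<^sub>F z in at_upper t. \<Phi> z \<notin> K"
proof -
  obtain \<psi> where \<psi>: "continuous_on \<Omega> \<psi>" "\<And>w. w \<in> \<Omega> \<Longrightarrow> 0 < Im (\<psi> w) \<and> \<Phi> (\<psi> w) = w"
    "\<And>z. 0 < Im z \<Longrightarrow> \<psi> (\<Phi> z) = z"
    using Phi_inverse by blast
  have "compact (\<psi> ` K)"
    using assms by (intro compact_continuous_image continuous_on_subset[OF \<psi>(1)])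
  then have "open (- \<psi> ` K)" by (simp add: compact_imp_closed open_Compl)
  moreover have "of_real t \<in> - \<psi> ` K"
  proof
    assume "of_real t \<in> \<psi> ` K"
    then obtain w where "w \<in> K" "of_real t = \<psi> w" by blast
    then show False using \<psi>(2)[of w] assms(2) by (metis Im_complex_of_real less_irrefl subsetD)
  qed
  ultimately have "\<forall>\<^sub>F z in at (of_real t). z \<in> - \<psi> ` K" by (rule eventually_at_in_open')
  then have "\<forall>\<^sub>F z in at_upper t. z \<in> - \<psi> ` K"
    by (rule filter_leD[OF at_le[OF subset_UNIV]])
  moreover have "\<forall>\<^sub>F z in at_upper t. 0 < Im z"
    by (simp add: eventually_at_filter)
  ultimately show ?thesis
  proof eventually_elim
    case (elim z)
    then show ?case using \<psi>(3)[of z] by (metis ComplD imageI)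
  qed
qed

lemma alpha_le: "1 \<le> j \<Longrightarrow> \<alpha> j \<le> c - pi"
  using alpha_antimono[of 1 j] alpha_1 k_ge[of 0] by linarith

lemma far_line_side: "pi \<le> \<bar>Re w - c\<bar> \<Longrightarrow> w \<in> line_side"
  unfolding line_side_def using pi_gt_zero by (simp only: mem_Collect_eq) linarith

lemma ray_distance: "pi \<le> \<bar>ray_abscissa q m p k j - c\<bar>" if "1 \<le> j"
proof (cases "j \<le> q")
  case True
  then show ?thesis using alpha_le[OF that] by (simp add: ray_abscissa_eq)
next
  case False
  then show ?thesis using beta_ge[of j] by (auto simp: ray_abscissa_eq)
qed

text \<open>A point inside the cut is not a limit of points of the domain, so on the cut only its
  edge occurs. Taking the cosine in the equation of the edge gives the form that later reads
  \<open>Re f = 0\<close>.\<close>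

lemma boundary_types:
  assumes w: "w \<in> closure \<Omega>" "w \<notin> \<Omega>"
  shows "w \<in> cut_side \<and> cos (Re w - c) * cosh (Im w) = cosh (B 0) \<or>
    w \<in> line_side \<and> (Im w = 0 \<or> Re w = 0 \<or> Re w = W \<or>
      (\<exists>j\<in>{1..p}. Re w = ray_abscissa q m p k j \<and> B j \<le> Im w))"
proof -
  have "closure \<Omega> \<subseteq> {w. 0 \<le> Im w \<and> 0 \<le> Re w \<and> Re w \<le> W}"
  proof (rule closure_minimal)
    show "\<Omega> \<subseteq> {w. 0 \<le> Im w \<and> 0 \<le> Re w \<and> Re w \<le> W}" by (auto simp: in_comb_domain)
    show "closed {w. 0 \<le> Im w \<and> 0 \<le> Re w \<and> Re w \<le> W}"
      by (intro closed_Collect_conj closed_Collect_le continuous_intros)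
  qed
  then have strip: "0 \<le> Im w" "0 \<le> Re w" "Re w \<le> W" using w(1) by auto
  show ?thesis
  proof (cases "w \<in> comb_cut q k (B 0)")
    case True
    then have cut: "B 0 \<le> Im w" "\<bar>Re w - c\<bar> \<le> arccos (cosh (B 0) / cosh (Im w))"
      by (auto simp: comb_cut_iff)
    define y where "y = cosh (B 0) / cosh (Im w)"
    have y: "0 < y" "y \<le> 1" using cosh_ratio[OF cut(1)] by (auto simp: y_def)
    have ay: "0 \<le> arccos y" "arccos y < pi / 2" using arccos_ratio[OF cut(1)] by (auto simp: y_def)
    have "\<bar>Re w - c\<bar> = arccos y"
    proof (rule ccontr)
      assume "\<bar>Re w - c\<bar> \<noteq> arccos y"
      then have less: "\<bar>Re w - c\<bar> < arccos y" using cut(2) by (simp add: y_def)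
      \<comment> \<open>The interior of the cut, written with the cosine so that openness is
        evident.\<close>
      define U where "U = {v. B 0 < Im v \<and> \<bar>Re v - c\<bar> < pi / 2 \<and> cosh (B 0) < cos (Re v - c) * cosh (Im v)}"
      have "open U"
        unfolding U_def by (intro open_Collect_conj open_Collect_less continuous_intros)
      have "U \<inter> \<Omega> = {}"
      proof -
        have "v \<in> comb_cut q k (B 0)" if "v \<in> U" for v
        proof -
          have v: "B 0 < Im v" "\<bar>Re v - c\<bar> < pi / 2" "cosh (B 0) < cos (Re v - c) * cosh (Im v)"
            using that by (auto simp: U_def)
          have "cosh (B 0) / cosh (Im v) \<le> cos \<bar>Re v - c\<bar>"
            using v(3) by (simp add: cos_abs_real pos_divide_le_eq)
          moreover have "0 < cosh (B 0) / cosh (Im v)" by simp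
          ultimately have "arccos (cos \<bar>Re v - c\<bar>) \<le> arccos (cosh (B 0) / cosh (Im v))"
            by (intro arccos_le_arccos) (auto intro: order_trans[of "-1" 0] less_imp_le simp del: cos_abs_real)
          moreover have "arccos (cos \<bar>Re v - c\<bar>) = \<bar>Re v - c\<bar>" by (rule arccos_cos) (use v(2) pi_gt_zero in linarith)+
          ultimately show ?thesis using v(1) by (simp add: comb_cut_iff)
        qed
        then show ?thesis by (auto simp: in_comb_domain)
      qed
      moreover have "w \<in> U"
      proof -
        have "Im w \<noteq> B 0"
        proof
          assume "Im w = B 0"
          then have "y = 1" using cosh_B0 by (simp add: y_def)
          then show False using less by simp
        qed
        moreover have "cos (arccos y) < cos \<bar>Re w - c\<bar>"
          using less ay by (intro cos_monotone_0_pi) auto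
        then have "y < cos (Re w - c)" using y by (simp add: cos_abs_real cos_arccos)
        then have "cosh (B 0) < cos (Re w - c) * cosh (Im w)" by (simp add: y_def pos_divide_less_eq)
        ultimately show ?thesis using cut less ay by (auto simp: U_def)
      qed
      ultimately show False using w(1) \<open>open U\<close> by (auto simp: closure_iff_nhds_not_empty)
    qed
    then have "cos (Re w - c) = y" using y \<open>\<bar>Re w - c\<bar> = arccos y\<close> cos_arccos[of y] by (simp flip: cos_abs_real[of "Re w - c"])
    then have "cos (Re w - c) * cosh (Im w) = cosh (B 0)" by (simp add: y_def)
    moreover have "w \<in> cut_side"
      using \<open>\<bar>Re w - c\<bar> = arccos y\<close> ay cut(1) B0 by (auto simp: cut_side_def)
    ultimately show ?thesis by blast
  next
    case False
    have line: "Re w = u \<Longrightarrow> pi \<le> \<bar>u - c\<bar> \<Longrightarrow> w \<in> line_side" for u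
      by (simp add: far_line_side)
    consider "Im w = 0" | "Re w = 0" | "Re w = W"
      | j where "j \<in> {1..p}" "Re w = ray_abscissa q m p k j" "B j \<le> Im w"
      using w(2) strip False unfolding in_comb_domain by (meson less_eq_real_def not_le)
    then show ?thesis
    proof cases
      case 1
      then show ?thesis using B0 by (auto simp: line_side_def)
    next
      case 2
      then show ?thesis using line[of 0] c_ge by auto
    next
      case 3
      then show ?thesis using line[of W] W_ge by auto
    next
      case 4
      then show ?thesis using line[of "ray_abscissa q m p k j"] ray_distance[of j] by auto
    qed
  qed
qed

text \<open>Boundedness near \<open>t\<close> makes the relevant part of the closure outside
  \<open>V\<close> compact. It is contained in the domain, so properness drives \<Phi> out of
  it.\<close>

lemma near_boundary:
  assumes t: "t \<notin> special" and "open V" and V: "closure \<Omega> - \<Omega> \<subseteq> V"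
  shows "\<forall>\<^sub>F z in at_upper t. \<Phi> z \<in> V"
proof -
  obtain r K where r: "0 < r" "\<And>z. 0 < Im z \<Longrightarrow> dist z (of_real t) < r \<Longrightarrow> norm (\<Phi> z) \<le> K"
    using bounded_near[OF t] by blast
  define C where "C = closure \<Omega> \<inter> cball 0 K - V"
  have "compact C"
    unfolding C_def by (intro compact_diff closed_Int_compact compact_cball \<open>open V\<close>) auto
  moreover have "C \<subseteq> \<Omega>" using V by (auto simp: C_def)
  ultimately have "\<forall>\<^sub>F z in at_upper t. \<Phi> z \<notin> C" by (rule Phi_proper)
  moreover have "\<forall>\<^sub>F z in at_upper t. \<Phi> z \<in> closure \<Omega> \<inter> cball 0 K"
    unfolding eventually_at
  proof (intro exI[of _ r] conjI ballI impI r(1))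
    fix z assume z: "z \<in> upper_half_plane" "z \<noteq> of_real t \<and> dist z (of_real t) < r"
    then have "\<Phi> z \<in> closure \<Omega>" using Phi_in[of z] closure_subset by auto
    then show "\<Phi> z \<in> closure \<Omega> \<inter> cball 0 K" using r(2)[of z] z by simp
  qed
  ultimately show ?thesis by eventually_elim (auto simp: C_def)
qed

text \<open>The image of a small half-disc is connected and is covered by two disjoint open
  sets.\<close>

lemma side_dichotomy:
  assumes t: "t \<notin> special"
  shows "(\<forall>\<^sub>F z in at_upper t. \<Phi> z \<in> cut_side) \<or>
    (\<forall>\<^sub>F z in at_upper t. \<Phi> z \<in> line_side)"
proof -
  have "\<forall>\<^sub>F z in at_upper t. \<Phi> z \<in> cut_side \<union> line_side"
    using boundary_types by (intro near_boundary[OF t] open_Un sides) auto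
  then obtain d where d: "0 < d" "\<And>z. 0 < Im z \<Longrightarrow> dist z (of_real t) < d \<Longrightarrow> \<Phi> z \<in> cut_side \<union> line_side"
    using at_real_nbhd by blast
  define U where "U = upper_half_plane \<inter> ball (of_real t) d"
  have "connected U"
    unfolding U_def by (intro convex_connected convex_Int convex_halfspace_Im_gt convex_ball)
  then have "connected (\<Phi> ` U)"
    by (rule connected_continuous_image[rotated]) (auto simp: U_def intro: continuous_on_subset[OF Phi_cont])
  moreover have sub: "\<Phi> ` U \<subseteq> cut_side \<union> line_side"
  proof (rule image_subsetI)
    fix z assume "z \<in> U"
    then show "\<Phi> z \<in> cut_side \<union> line_side" using d(2)[of z] by (simp add: U_def dist_commute)
  qed
  ultimately have "cut_side \<inter> \<Phi> ` U = {} \<or> line_side \<inter> \<Phi> ` U = {}"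
    using connectedD[of "\<Phi> ` U" cut_side line_side] sides by blast
  then have "\<Phi> ` U \<subseteq> cut_side \<or> \<Phi> ` U \<subseteq> line_side" using sub by blast
  moreover have "\<forall>\<^sub>F z in at_upper t. z \<in> U"
    unfolding eventually_at U_def using d(1) by (intro exI[of _ d]) (auto simp: dist_commute)
  ultimately show ?thesis by (metis (mono_tags, lifting) eventually_mono image_subset_iff)
qed

lemma eventually_nearby:
  assumes "\<forall>\<^sub>F z in at_upper t. P z"
  shows "\<forall>\<^sub>F s in at t within A. \<forall>\<^sub>F z in at_upper s. P z"
proof -
  obtain d where d: "0 < d" "\<And>z. 0 < Im z \<Longrightarrow> dist z (of_real t) < d \<Longrightarrow> P z"
    using at_real_nbhd[OF assms] by blast
  have "\<forall>\<^sub>F z in at_upper s. P z" if "dist s t < d" for s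
    unfolding eventually_at
  proof (intro exI[of _ "d - dist s t"] conjI ballI impI)
    fix z assume z: "z \<in> upper_half_plane" "z \<noteq> of_real s \<and> dist z (of_real s) < d - dist s t"
    have "dist z (of_real t) \<le> dist z (of_real s) + dist (of_real s) (of_real t :: complex)"
      by (rule dist_triangle)
    then show "P z" using z d(2)[of z] by (simp add: dist_of_real)
  qed (use that in auto)
  then show ?thesis unfolding eventually_at using d(1) by blast
qed

text \<open>Among the special points only 0 has a channel bordering the cut. The channel of any
  other one stays at least pi away from the axis, so the line side persists across it; at the
  remaining points both alternatives of the dichotomy carry over to nearby points.\<close>

lemma line_side_locally_constant:
  fixes A :: "real set"
  defines "L t \<equiv> \<forall>\<^sub>F z in at_upper t. \<Phi> z \<in> line_side"
  assumes A: "connected A" "s \<in> A" "t \<in> A"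
    and sp: "\<And>j. j \<le> p \<Longrightarrow> \<xi> j \<in> A \<Longrightarrow> 1 \<le> j"
  shows "L s = L t"
proof (rule connected_local_const[OF A], intro ballI)
  fix u assume "u \<in> A"
  have "L u \<or> (\<forall>\<^sub>F z in at_upper u. \<Phi> z \<in> cut_side)"
  proof (cases "u \<in> special")
    case True
    then obtain j where j: "j \<le> p" "u = \<xi> j" by (auto simp: special_def)
    then have "1 \<le> j" using sp \<open>u \<in> A\<close> by blast
    have "hi j \<le> c - pi \<or> c + pi \<le> lo j"
    proof (cases "j \<le> q")
      case True
      then show ?thesis using alpha_le[OF \<open>1 \<le> j\<close>] by (simp add: hi_def)
    next
      case False
      then show ?thesis using beta_ge[of j] by (simp add: lo_def)
    qed
    moreover have "\<forall>\<^sub>F z in at_upper u. lo j < Re (\<Phi> z) \<and> Re (\<Phi> z) < hi j"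
      using Phi_reaches_finite[OF j(1)] j(2) unfolding reaches_channel_def by blast
    ultimately have "L u"
      unfolding L_def by (elim eventually_mono) (auto intro!: far_line_side)
    then show ?thesis ..
  next
    case False
    then show ?thesis using side_dichotomy unfolding L_def by blast
  qed
  then show "\<forall>\<^sub>F v in at u within A. L u = L v"
  proof
    assume "L u"
    then show ?thesis
      using eventually_nearby[of "\<lambda>z. \<Phi> z \<in> line_side" u A] unfolding L_def by simp
  next
    have notL: "\<not> L v" if "\<forall>\<^sub>F z in at_upper v. \<Phi> z \<in> cut_side" for v
    proof
      assume "L v"
      with that have "\<forall>\<^sub>F z in at_upper v. False"
        unfolding L_def by eventually_elim (use sides in auto)
      then show False using at_real_within_upper_half_plane_neq_bot by simp
    qed
    assume C: "\<forall>\<^sub>F z in at_upper u. \<Phi> z \<in> cut_side"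
    then have "\<not> L u" by (rule notL)
    moreover have "\<forall>\<^sub>F v in at u within A. \<not> L v"
      using eventually_nearby[OF C, of A] by (rule eventually_mono) (rule notL)
    ultimately show ?thesis by simp
  qed
qed

lemma Phi_limit:
  assumes "0 < t" "(\<phi> \<longlongrightarrow> w) (at (of_real t) within first_quadrant)"
  shows "(\<Phi> \<longlongrightarrow> w) (at_upper (t\<^sup>2))"
  unfolding Phi_comp comp_def
  using filterlim_compose[OF assms(2), of csqrt] csqrt_at_real[of "t\<^sup>2"] assms(1) by simp

lemma positive_line_side:
  assumes "0 < t"
  shows "\<forall>\<^sub>F z in at_upper t. \<Phi> z \<in> line_side"
proof -
  have "(\<Phi> \<longlongrightarrow> 0) (at_upper (a\<^sup>2))"
    using Phi_limit[OF a0] normalized by (simp add: normalized_comb_map_def)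
  moreover have "0 \<in> line_side" using B0 by (simp add: line_side_def)
  ultimately have "\<forall>\<^sub>F z in at_upper (a\<^sup>2). \<Phi> z \<in> line_side"
    using sides(2) topological_tendstoD by blast
  moreover have "1 \<le> j" if "\<xi> j \<in> {0<..}" for j
    using that xi_0 by (cases "j = 0") auto
  ultimately show ?thesis
    using line_side_locally_constant[of "{0<..}" "a\<^sup>2" t] assms a0 connected_Ioi by auto
qed

text \<open>Otherwise no boundary point could account for the tip of the cut. Points
  \<open>w n\<close> approaching the tip from below have preimages with a cluster point. In the open
  half-plane it would be mapped to the tip, which is outside the domain; at a real point nearby
  values of \<Phi> are on the line side or above \<open>B 0\<close>, and the \<open>w n\<close> are
  neither.\<close>

lemma negative_cut_side:
  assumes "t < 0"
  shows "\<forall>\<^sub>F z in at_upper t. \<Phi> z \<in> cut_side"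
proof (rule ccontr)
  assume neg: "\<not> ?thesis"
  have ns: "u \<notin> special" if "u < 0" for u
    using that xi_nonneg by (auto simp: special_def not_less[symmetric])
  have L: "\<forall>\<^sub>F z in at_upper u. \<Phi> z \<in> line_side" if "u < 0" for u
  proof -
    have "\<forall>\<^sub>F z in at_upper t. \<Phi> z \<in> line_side"
      using side_dichotomy[OF ns[OF assms]] neg by blast
    moreover have "1 \<le> j" if "\<xi> j \<in> {..<0}" for j using that xi_nonneg[of j] by simp
    ultimately show ?thesis
      using line_side_locally_constant[of "{..<0}" t u] assms that connected_Iio by auto
  qed
  define tip where "tip = Complex c (B 0)"
  \<comment> \<open>The shift by 3 keeps the heights above \<open>B 0 / 2\<close>, hence outside
    \<open>line_side\<close>.\<close>
  define w where "w n = Complex c (B 0 - B 0 / real (n + 3))" for n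
  have wlim: "w \<longlonglongrightarrow> tip"
  proof -
    have "(\<lambda>n. B 0 / real (n + 3)) \<longlonglongrightarrow> 0"
      by (rule LIMSEQ_ignore_initial_segment[OF lim_const_over_n])
    then have "(\<lambda>n. B 0 - B 0 / real (n + 3)) \<longlonglongrightarrow> B 0 - 0" by (intro tendsto_intros)
    then show ?thesis unfolding w_def tip_def by (intro tendsto_Complex) auto
  qed
  have wIm: "B 0 / 2 < Im (w n)" "Im (w n) < B 0" for n
  proof -
    have "B 0 / real (n + 3) \<le> B 0 / 3" using B0 by (intro divide_left_mono) auto
    moreover have "0 < B 0 / real (n + 3)" using B0 by simp
    ultimately show "B 0 / 2 < Im (w n)" "Im (w n) < B 0" using B0 by (auto simp: w_def)
  qed
  have w_in: "w n \<in> \<Omega>" for n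
  proof -
    have "0 < Im (w n)" using wIm[of n] B0 by simp
    moreover have Re_w: "Re (w n) = c" by (simp add: w_def)
    moreover have "0 < c" "c < W" using c_ge W_ge pi_gt_zero by linarith+
    moreover have "c \<noteq> ray_abscissa q m p k j" if "j \<in> {1..p}" for j
    proof
      assume "c = ray_abscissa q m p k j"
      then have "pi \<le> 0" using ray_distance[of j] that by simp
      then show False using pi_gt_zero by linarith
    qed
    ultimately show ?thesis
      unfolding in_comb_domain comb_cut_iff using wIm(2)[of n] by auto
  qed
  have not_line: "w n \<notin> line_side" for n
    using wIm[of n] pi_gt_zero by (auto simp: line_side_def w_def)
  have tip: "tip \<notin> \<Omega>"
    using cosh_B0 by (auto simp: in_comb_domain comb_cut_iff tip_def)
  obtain \<psi> where \<psi>: "continuous_on \<Omega> \<psi>" "\<And>w. w \<in> \<Omega> \<Longrightarrow> 0 < Im (\<psi> w) \<and> \<Phi> (\<psi> w) = w"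
    "\<And>z. 0 < Im z \<Longrightarrow> \<psi> (\<Phi> z) = z"
    using Phi_inverse by blast
  define z where "z n = \<psi> (w n)" for n
  have z: "0 < Im (z n)" "\<Phi> (z n) = w n" for n using \<psi>(2)[OF w_in] by (auto simp: z_def)
  have "\<forall>\<^sub>F u in inf at_infinity (principal upper_half_plane). B 0 < Im (\<Phi> u)"
    using Phi_reaches_infinity unfolding reaches_channel_def by blast
  \<comment> \<open>Far out \<Phi> is higher than the tip, which confines the preimages of the
    \<open>w n\<close> to a disc.\<close>
  then obtain b where b: "\<And>u. b \<le> norm u \<Longrightarrow> 0 < Im u \<Longrightarrow> B 0 < Im (\<Phi> u)"
    unfolding eventually_inf_principal eventually_at_infinity by blast
  have "norm (z n) \<le> b" for n
    using b[of "z n"] z[of n] wIm[of n] by force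
  then have "bounded (range z)" unfolding bounded_iff by blast
  then obtain l r where lr: "strict_mono r" "(z \<circ> r) \<longlonglongrightarrow> l"
    using bounded_imp_convergent_subsequence by blast
  have wr: "(\<lambda>n. w (r n)) \<longlonglongrightarrow> tip"
    using LIMSEQ_subseq_LIMSEQ[OF wlim lr(1)] by (simp add: comp_def)
  have "0 \<le> Im l"
    using tendsto_lowerbound[OF tendsto_Im[OF lr(2)], of 0] z(1) by (auto simp: less_imp_le)
  then consider "0 < Im l" | "Im l = 0" by linarith
  then show False
  proof cases
    case 1
    then have "isCont \<Phi> l"
      using continuous_on_interior[OF Phi_cont, of l] open_halfspace_Im_gt[of 0] by (simp add: interior_open)
    then have "(\<lambda>n. \<Phi> (z (r n))) \<longlonglongrightarrow> \<Phi> l"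
      using isCont_tendsto_compose lr(2) by (fastforce simp: comp_def)
    then have "tip = \<Phi> l" using wr LIMSEQ_unique by (simp add: z)
    then show False using Phi_in[OF 1] tip by simp
  next
    case 2
    then have l: "l = of_real (Re l)" by (simp add: complex_eq_iff)
    have "\<forall>\<^sub>F u in at_upper (Re l). \<Phi> u \<in> line_side \<or> B 0 < Im (\<Phi> u)"
    proof (cases "Re l \<in> special")
      case True
      then obtain j where j: "j \<le> p" "Re l = \<xi> j" by (auto simp: special_def)
      have "\<forall>\<^sub>F u in at_upper (Re l). B 0 < Im (\<Phi> u)"
        using Phi_reaches_finite[OF j(1)] j(2) unfolding reaches_channel_def by simp
      then show ?thesis by (rule eventually_mono) simp
    next
      case False
      then have "Re l \<noteq> 0" using xi_0 by (auto simp: special_def)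
      then have "\<forall>\<^sub>F u in at_upper (Re l). \<Phi> u \<in> line_side"
        using L[of "Re l"] positive_line_side[of "Re l"] by linarith
      then show ?thesis by (rule eventually_mono) simp
    qed
    then obtain d where d: "0 < d" "\<And>u. 0 < Im u \<Longrightarrow> dist u (of_real (Re l)) < d \<Longrightarrow>
        \<Phi> u \<in> line_side \<or> B 0 < Im (\<Phi> u)"
      using at_real_nbhd by blast
    obtain n where "dist (z (r n)) l < d"
      using lr(2) d(1) unfolding lim_sequentially by (auto simp: comp_def)
    then have "dist (z (r n)) (of_real (Re l)) < d" using l by metis
    from d(2)[OF z(1) this] show False using z(2) not_line wIm(2)[of "r n"] by force
  qed
qed

lemma vanishes_at_boundary:
  fixes g :: "complex \<Rightarrow> real"
  assumes t: "t \<notin> special" and g: "continuous_on UNIV g" and "open V"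
    and side: "\<forall>\<^sub>F z in at_upper t. \<Phi> z \<notin> V"
    and g0: "\<And>w. w \<in> closure \<Omega> \<Longrightarrow> w \<notin> \<Omega> \<Longrightarrow> w \<notin> V \<Longrightarrow> g w = 0"
  shows "((\<lambda>z. g (\<Phi> z)) \<longlongrightarrow> 0) (at_upper t)"
  unfolding tendsto_iff
proof (intro allI impI)
  fix e :: real assume e: "0 < e"
  have "open {w. \<bar>g w\<bar> < e}" by (intro open_Collect_less continuous_intros g)
  then have "\<forall>\<^sub>F z in at_upper t. \<Phi> z \<in> V \<union> {w. \<bar>g w\<bar> < e}"
    using g0 e by (intro near_boundary[OF t] open_Un \<open>open V\<close>) force+
  with side show "\<forall>\<^sub>F z in at_upper t. dist (g (\<Phi> z)) 0 < e"
    by eventually_elim auto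
qed

section \<open>Reflection and rationality\<close>

definition s :: real where "s = (- 1) ^ N"

definition L :: real where "L = 1 / cosh (B 0)"

definition f :: "complex \<Rightarrow> complex" where "f z = 1 - of_real (s * L) * cos (\<Phi> z)"

definition T :: "complex \<Rightarrow> complex" where "T z = f z * inverse (csqrt z)"

lemma s_square: "s * s = 1" "\<bar>s\<bar> = 1" by (auto simp: s_def power_mult_distrib[symmetric] power_abs)

lemma L_pos: "0 < L" "L < 1" using cosh_B0 by (auto simp: L_def)

lemma cos_minus_c: "cos (u - c) = s * cos u"
  by (simp add: cos_diff c_def s_def mult.commute[of pi])

text \<open>The abscissas of walls and rays are multiples of pi, so the sine vanishes there; on the
  base \<open>sinh\<close> does. On the cut the factor \<open>s\<close> accounts for the shift by
  \<open>c\<close> and the value of \<open>L\<close> normalizes the equation of the edge.\<close>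

lemma boundary_cos:
  assumes "w \<in> closure \<Omega>" "w \<notin> \<Omega>"
  shows "w \<notin> cut_side \<Longrightarrow> Im (cos w) = 0"
    and "w \<notin> line_side \<Longrightarrow> Re (1 - of_real (s * L) * cos w) = 0"
proof -
  have Im_cos': "Im (cos w) = - sin (Re w) * sinh (Im w)"
    by (simp add: Im_cos sinh_def field_simps)
  have Re_cos': "Re (cos w) = cos (Re w) * cosh (Im w)"
    by (simp add: Re_cos cosh_def field_simps)
  have sinW: "sin W = 0" unfolding strip_width_def by (rule sin_npi2)
  have sinr: "sin (ray_abscissa q m p k j) = 0" for j
    unfolding ray_abscissa_def by (split if_split) (intro conjI impI sin_npi2)
  show "w \<notin> cut_side \<Longrightarrow> Im (cos w) = 0"
    using boundary_types[OF assms] sinW sinr by (auto simp: Im_cos')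
  assume "w \<notin> line_side"
  then have "cos (Re w - c) * cosh (Im w) = cosh (B 0)" using boundary_types[OF assms] by blast
  then have "s * L * (cos (Re w) * cosh (Im w)) = 1"
    using cosh_B0 by (simp add: cos_minus_c L_def field_simps)
  then show "Re (1 - of_real (s * L) * cos w) = 0" by (simp add: Re_cos')
qed

lemma T_hol: "T holomorphic_on upper_half_plane"
proof -
  have "z \<notin> \<real>\<^sub>\<le>\<^sub>0" "csqrt z \<noteq> 0" if "0 < Im z" for z
    using that by (auto simp: complex_nonpos_Reals_iff)
  then show ?thesis
    unfolding T_def f_def by (intro holomorphic_intros Phi_hol) auto
qed

lemma zero_special: "0 \<in> special"
  unfolding special_def using xi_0 by (intro image_eqI[of _ _ 0]) auto

lemma bounded_T_near:
  assumes "t \<notin> special"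
  obtains r K where "0 < r" "\<And>z. 0 < Im z \<Longrightarrow> dist z (of_real t) < r \<Longrightarrow> norm (f z) \<le> K \<and> norm (T z) \<le> K"
proof -
  have t0: "t \<noteq> 0" using assms zero_special by auto
  obtain r K where r: "0 < r" "\<And>z. 0 < Im z \<Longrightarrow> dist z (of_real t) < r \<Longrightarrow> norm (\<Phi> z) \<le> K"
    using bounded_near[OF assms] by blast
  have "compact ((\<lambda>w. 1 - of_real (s * L) * cos w :: complex) ` cball 0 K)"
    by (intro compact_continuous_image holomorphic_on_imp_continuous_on holomorphic_intros compact_cball)
  from compact_imp_bounded[OF this]
  obtain K1 where K1: "\<And>w. norm w \<le> K \<Longrightarrow> norm (1 - of_real (s * L) * cos w :: complex) \<le> K1"
    unfolding bounded_iff by (metis (no_types, lifting) image_eqI mem_cball_0)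
  define K2 where "K2 = inverse (sqrt (\<bar>t\<bar> / 2))"
  show thesis
  proof (rule that[of "min r (\<bar>t\<bar> / 2)" "max K1 (K1 * K2)"])
    show "0 < min r (\<bar>t\<bar> / 2)" using r t0 by simp
    fix z assume z: "0 < Im z" "dist z (of_real t) < min r (\<bar>t\<bar> / 2)"
    have fz: "norm (f z) \<le> K1" unfolding f_def using r(2)[of z] z by (intro K1) auto
    have "\<bar>t\<bar> \<le> norm z + dist z (of_real t)"
      using norm_triangle_sub[of "of_real t" z] by (simp add: dist_norm norm_minus_commute)
    then have "\<bar>t\<bar> / 2 \<le> norm z" using z(2) by simp
    then have "sqrt (\<bar>t\<bar> / 2) \<le> norm (csqrt z)" by simp
    then have "inverse (norm (csqrt z)) \<le> K2"
      unfolding K2_def using t0 by (intro le_imp_inverse_le) auto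
    then have "norm (f z) * inverse (norm (csqrt z)) \<le> K1 * K2"
      using fz by (intro mult_mono) (auto intro: order_trans[OF norm_ge_zero])
    then have "norm (T z) \<le> K1 * K2" by (simp add: T_def norm_mult norm_inverse)
    then show "norm (f z) \<le> max K1 (K1 * K2) \<and> norm (T z) \<le> max K1 (K1 * K2)" using fz by auto
  qed
qed

text \<open>On either half-axis the part of \<open>f\<close> that tends to 0 meets a convergent
  factor, while the other part is only bounded and meets the part of
  \<open>inverse (csqrt z)\<close> that tends to 0. This works although \<open>f\<close> is not yet
  known to converge.\<close>

lemma Im_T_vanishes:
  assumes t: "t \<notin> special"
  shows "((\<lambda>z. Im (T z)) \<longlongrightarrow> 0) (at_upper t)"
proof -
  have t0: "t \<noteq> 0" using assms zero_special by auto
  let ?F = "at_upper t"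
  obtain r K where r: "0 < r" "\<And>z. 0 < Im z \<Longrightarrow> dist z (of_real t) < r \<Longrightarrow> norm (f z) \<le> K \<and> norm (T z) \<le> K"
    using bounded_T_near[OF t] by blast
  have fK: "\<forall>\<^sub>F z in ?F. norm (f z) \<le> K"
    unfolding eventually_at using r by blast
  have ReK: "\<forall>\<^sub>F z in ?F. \<bar>Re (f z)\<bar> \<le> K" and ImK: "\<forall>\<^sub>F z in ?F. \<bar>Im (f z)\<bar> \<le> K"
    using fK by (auto elim!: eventually_mono intro: order_trans[OF abs_Re_le_cmod] order_trans[OF abs_Im_le_cmod])
  note g = inverse_csqrt_at_real[OF t0]
  have Im_T: "Im (T z) = Re (f z) * Im (inverse (csqrt z)) + Im (f z) * Re (inverse (csqrt z))" for z
    by (simp only: T_def times_complex.sel)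
  show ?thesis
  proof (cases "0 < t")
    case True
    have "\<forall>\<^sub>F z in ?F. \<Phi> z \<notin> cut_side"
      using positive_line_side[OF True] by eventually_elim (use sides in auto)
    then have "((\<lambda>z. Im (cos (\<Phi> z))) \<longlongrightarrow> 0) ?F"
      by (intro vanishes_at_boundary[OF t, where V = cut_side] sides boundary_cos(1) continuous_on_Im
          holomorphic_on_imp_continuous_on holomorphic_on_cos holomorphic_on_ident)
    then have "((\<lambda>z. - (s * L) * Im (cos (\<Phi> z))) \<longlongrightarrow> 0) ?F"
      by (rule tendsto_mult_right_zero)
    then have Imf: "((\<lambda>z. Im (f z)) \<longlongrightarrow> 0) ?F" by (simp add: f_def)
    have "((\<lambda>z. Im (inverse (csqrt z))) \<longlongrightarrow> 0) ?F"
      using tendsto_Im[OF g] True by simp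
    from bounded_mult_tendsto_0[OF this ReK] tendsto_mult[OF Imf tendsto_Re[OF g]]
    show ?thesis unfolding Im_T using tendsto_add by fastforce
  next
    case False
    then have "t < 0" using t0 by simp
    have "\<forall>\<^sub>F z in ?F. \<Phi> z \<notin> line_side"
      using negative_cut_side[OF \<open>t < 0\<close>] by eventually_elim (use sides in auto)
    then have Ref: "((\<lambda>z. Re (f z)) \<longlongrightarrow> 0) ?F"
      unfolding f_def
      by (intro vanishes_at_boundary[OF t, where V = line_side and g = "\<lambda>w. Re (1 - of_real (s * L) * cos w)"]
          sides boundary_cos(2) continuous_on_Re
          holomorphic_on_imp_continuous_on holomorphic_intros)
    have "((\<lambda>z. Re (inverse (csqrt z))) \<longlongrightarrow> 0) ?F"
      using tendsto_Re[OF g] False by simp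
    from bounded_mult_tendsto_0[OF this ImK] tendsto_mult[OF Ref tendsto_Im[OF g]]
    show ?thesis unfolding Im_T using tendsto_add by fastforce
  qed
qed

lemma special_gap:
  assumes "t \<notin> special"
  obtains e where "0 < e" "\<And>u. \<bar>u - t\<bar> < e \<Longrightarrow> u \<notin> special"
proof -
  have "closed special" unfolding special_def by (intro finite_imp_closed) auto
  then obtain e where "0 < e" "ball t e \<subseteq> - special"
    using assms unfolding closed_def open_contains_ball by blast
  then show thesis by (intro that[of e]) (auto simp: dist_real_def subset_iff abs_minus_commute)
qed

lemma T_limit:
  assumes t: "t \<notin> special"
  obtains l :: real where "(T \<longlongrightarrow> of_real l) (at_upper t)"
proof -
  obtain r K where r: "0 < r" "\<And>z. 0 < Im z \<Longrightarrow> dist z (of_real t) < r \<Longrightarrow> norm (f z) \<le> K \<and> norm (T z) \<le> K"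
    using bounded_T_near[OF t] by blast
  obtain e where e: "0 < e" "\<And>u. \<bar>u - t\<bar> < e \<Longrightarrow> u \<notin> special"
    using special_gap[OF t] by blast
  show thesis
  proof (rule boundary_limit_of_Im[of T t "min r e" K])
    show "T holomorphic_on upper_half_plane \<inter> ball (of_real t) (min r e)"
      using T_hol by (rule holomorphic_on_subset) auto
    show "norm (T z) \<le> K" if "z \<in> upper_half_plane \<inter> ball (of_real t) (min r e)" for z
      using r(2)[of z] that by (simp add: dist_commute)
    show "\<forall>\<^sub>F z in at_upper u. \<bar>Im (T z)\<bar> < \<epsilon>"
      if "\<bar>u - t\<bar> < min r e" "0 < \<epsilon>" for u \<epsilon>
      using Im_T_vanishes[of u] e(2)[of u] that unfolding tendsto_iff by simp
  qed (use r e that in auto)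
qed

definition \<tau> :: "real \<Rightarrow> real" where
  "\<tau> t = (SOME l. (T \<longlongrightarrow> of_real l) (at_upper t))"

lemma T_tau: "t \<notin> special \<Longrightarrow> (T \<longlongrightarrow> of_real (\<tau> t)) (at_upper t)"
  unfolding \<tau>_def using T_limit[of t] by (metis someI)

definition T1 :: "complex \<Rightarrow> complex" where
  "T1 z = (if z \<in> upper_half_plane then T z else of_real (\<tau> (Re z)))"

definition T2 :: "complex \<Rightarrow> complex" where
  "T2 z = (if 0 \<le> Im z then T1 z else cnj (T1 (cnj z)))"

definition poles :: "complex set" where "poles = of_real ` special"

lemma finite_poles: "finite poles" by (simp add: poles_def special_def)

lemma T1_cont: "continuous_on (- poles \<inter> {z. 0 \<le> Im z}) T1"
proof -
  define R where "R = of_real ` (- special :: real set) \<inter> (UNIV :: complex set)"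
  have "continuous_on (upper_half_plane \<union> R) (\<lambda>z. if z \<in> upper_half_plane then T z else of_real (\<tau> (Re z)))"
  proof (rule continuous_on_boundary_extension)
    show "continuous_on upper_half_plane T" using T_hol holomorphic_on_imp_continuous_on by blast
    show "open upper_half_plane" by (rule open_halfspace_Im_gt)
    show "R \<subseteq> closure upper_half_plane"
      using at_real_within_upper_half_plane_neq_bot
      by (auto simp: R_def trivial_limit_within islimpt_in_closure intro: closure_mono[THEN subsetD, rotated])
    show "upper_half_plane \<inter> R = {}" by (auto simp: R_def)
    show "(T \<longlongrightarrow> of_real (\<tau> (Re z))) (at z within upper_half_plane)" if "z \<in> R" for z
      using that T_tau by (auto simp: R_def)
  qed
  moreover have "- poles \<inter> {z. 0 \<le> Im z} \<subseteq> upper_half_plane \<union> R"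
  proof
    fix z assume z: "z \<in> - poles \<inter> {z. 0 \<le> Im z}"
    show "z \<in> upper_half_plane \<union> R"
    proof (cases "Im z = 0")
      case True
      then have "z = of_real (Re z)" by (simp add: complex_eq_iff)
      with z show ?thesis unfolding poles_def R_def by (metis (no_types, lifting) ComplD ComplI IntD1 IntI UNIV_I UnI2 image_eqI)
    qed (use z in auto)
  qed
  ultimately show ?thesis unfolding T1_def using continuous_on_subset by blast
qed

lemma T2_hol: "T2 holomorphic_on - poles"
  unfolding T2_def
proof (rule Schwarz_reflection)
  show "open (- poles)" using finite_poles by (simp add: finite_imp_closed open_Compl)
  show "cnj ` (- poles) \<subseteq> - poles"
    by (auto simp: poles_def) (metis complex_cnj_cnj complex_cnj_complex_of_real image_eqI)
  show "T1 holomorphic_on - poles \<inter> {z. 0 < Im z}"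
    by (rule holomorphic_transform[OF holomorphic_on_subset[OF T_hol]]) (auto simp: T1_def)
  show "continuous_on (- poles \<inter> {z. 0 \<le> Im z}) T1" by (rule T1_cont)
  show "T1 z \<in> \<real>" if "z \<in> \<real>" for z
    using that by (auto simp: T1_def complex_is_Real_iff)
qed

lemma T2_upper: "0 < Im z \<Longrightarrow> T2 z = T z" by (simp add: T2_def T1_def)

lemma T2_real: "T2 (of_real t) = of_real (\<tau> t)" by (simp add: T2_def T1_def)

lemma T2_cnj: "T2 (cnj z) = cnj (T2 z)"
proof (cases "Im z = 0")
  case True
  then have "z = of_real (Re z)" by (simp add: complex_eq_iff)
  then show ?thesis using T2_real by (metis complex_cnj_complex_of_real)
qed (auto simp: T2_def)

text \<open>A lower bound for \<open>T\<close> on a half-neighbourhood carries over to the real points by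
  passing to the limit, and to the lower half-plane by reflection.\<close>

lemma T2_norm_transfer:
  fixes b :: "complex \<Rightarrow> real"
  assumes bound: "\<And>z. 0 < Im z \<Longrightarrow> z \<in> U \<Longrightarrow> b z \<le> norm (T z)"
    and "open U" and U: "cnj ` U \<subseteq> U" and b: "continuous_on U b" "\<And>z. b (cnj z) = b z"
    and z: "z \<in> U" "z \<notin> poles"
  shows "b z \<le> norm (T2 z)"
proof -
  have up: "b z \<le> norm (T2 z)" if z: "z \<in> U" "z \<notin> poles" "0 \<le> Im z" for z
  proof (cases "Im z = 0")
    case False
    then show ?thesis using bound[of z] z by (simp add: T2_upper)
  next
    case True
    then have zr: "z = of_real (Re z)" by (simp add: complex_eq_iff)
    then have ns: "Re z \<notin> special" using z(2) unfolding poles_def by blast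
    have "((\<lambda>u. norm (T u)) \<longlongrightarrow> norm (T2 z)) (at z within upper_half_plane)"
      using tendsto_norm[OF T_tau[OF ns]] zr T2_real by metis
    moreover have "at z within upper_half_plane \<noteq> bot"
      using at_real_within_upper_half_plane_neq_bot zr by metis
    moreover have "(b \<longlongrightarrow> b z) (at z within upper_half_plane)"
    proof -
      have "b \<midarrow>z\<rightarrow> b z"
        using b(1) \<open>open U\<close> z(1) by (simp add: continuous_on_eq_continuous_at isCont_def)
      then show ?thesis by (rule tendsto_within_subset) simp
    qed
    moreover have "\<forall>\<^sub>F u in at z within upper_half_plane. b u \<le> norm (T u)"
    proof -
      have "\<forall>\<^sub>F u in at z. u \<in> U" by (rule eventually_at_in_open'[OF \<open>open U\<close> z(1)])
      then show ?thesis
        unfolding eventually_at_filter by (rule eventually_mono) (use bound in auto)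
    qed
    ultimately show ?thesis by (intro tendsto_le)
  qed
  show ?thesis
  proof (cases "0 \<le> Im z")
    case True
    then show ?thesis using up z by blast
  next
    case False
    have "cnj z \<in> U" using U z by blast
    moreover have "cnj z \<notin> poles"
      using z(2) by (auto simp: poles_def) (metis complex_cnj_cnj complex_cnj_complex_of_real image_eqI)
    ultimately have "b (cnj z) \<le> norm (T2 (cnj z))" using False by (intro up) auto
    then show ?thesis by (simp add: T2_cnj b(2))
  qed
qed

section \<open>Orders at the poles and at infinity\<close>

lemma exp_i_Phi_tendsto_0:
  assumes "reaches_channel \<Phi> F l h"
  shows "((\<lambda>z. exp (\<i> * \<Phi> z)) \<longlongrightarrow> 0) F"
proof (rule tendsto_norm_zero_cancel)
  have "filterlim (\<lambda>z. Im (\<Phi> z)) at_top F"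
    unfolding filterlim_at_top_dense using assms unfolding reaches_channel_def by blast
  then have "filterlim (\<lambda>z. - Im (\<Phi> z)) at_bot F" by (simp add: filterlim_uminus_at_top)
  then have "((\<lambda>z. exp (- Im (\<Phi> z))) \<longlongrightarrow> 0) F"
    by (rule filterlim_compose[OF exp_at_bot])
  then show "((\<lambda>z. norm (exp (\<i> * \<Phi> z))) \<longlongrightarrow> 0) F" by simp
qed

lemma f_exp_eq: "f z * exp (\<i> * \<Phi> z) =
  exp (\<i> * \<Phi> z) - of_real (s * L) / 2 * (exp (\<i> * \<Phi> z) * exp (\<i> * \<Phi> z) + 1)"
proof -
  have "exp (- (\<i> * \<Phi> z)) * exp (\<i> * \<Phi> z) = 1" by (simp flip: exp_add)
  then show ?thesis by (simp add: f_def cos_exp_eq algebra_simps add_divide_distrib)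
qed

text \<open>As \<open>Im \<Phi>\<close> tends to infinity, \<open>cos \<Phi>\<close> is asymptotic
  to \<open>exp (- \<i> * \<Phi>) / 2\<close>. The limit is not 0, so \<open>f\<close> may be
  exchanged for this exponential in the order estimates.\<close>

lemma f_exp_limit:
  assumes "reaches_channel \<Phi> F l h"
  shows "((\<lambda>z. f z * exp (\<i> * \<Phi> z)) \<longlongrightarrow> - of_real (s * L) / 2) F"
proof -
  note E = exp_i_Phi_tendsto_0[OF assms]
  have "((\<lambda>z. exp (\<i> * \<Phi> z) - of_real (s * L) / 2 * (exp (\<i> * \<Phi> z) * exp (\<i> * \<Phi> z) + 1))
      \<longlongrightarrow> 0 - of_real (s * L) / 2 * (0 * 0 + 1)) F"
    by (intro tendsto_intros E)
  then show ?thesis by (simp add: f_exp_eq)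
qed

lemma limit_neq_0: "- of_real (s * L) / 2 \<noteq> (0 :: complex)"
  using L_pos s_square by auto

lemma filterlim_f:
  assumes "reaches_channel \<Phi> F l h"
  shows "filterlim f at_infinity F"
proof -
  have "filterlim (\<lambda>z. exp (\<i> * \<Phi> z)) (at 0) F"
    using exp_i_Phi_tendsto_0[OF assms] by (simp add: filterlim_at)
  then have "filterlim (\<lambda>z. (f z * exp (\<i> * \<Phi> z)) / exp (\<i> * \<Phi> z)) at_infinity F"
    by (rule filterlim_divide_at_infinity[OF f_exp_limit[OF assms] _ limit_neq_0])
  then show ?thesis by simp
qed

lemma csqrt_limit: "j \<le> p \<Longrightarrow> (csqrt \<longlongrightarrow> of_real (X j)) (at_upper (\<xi> j))"
  using csqrt_at_real[OF xi_nonneg, of j] by (simp add: filterlim_at sqrt_xi)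

lemma filterlim_T:
  assumes "j \<le> p"
  shows "filterlim T at_infinity (at_upper (\<xi> j))"
proof -
  let ?F = "at_upper (\<xi> j)"
  note R = Phi_reaches_finite[OF assms]
  have "((\<lambda>z. exp (\<i> * \<Phi> z) * csqrt z) \<longlongrightarrow> 0 * of_real (X j)) ?F"
    by (intro tendsto_intros exp_i_Phi_tendsto_0[OF R] csqrt_limit assms)
  moreover have "\<forall>\<^sub>F z in ?F. exp (\<i> * \<Phi> z) * csqrt z \<noteq> 0"
    by (auto simp: eventually_at_filter intro!: always_eventually)
  ultimately have "filterlim (\<lambda>z. exp (\<i> * \<Phi> z) * csqrt z) (at 0) ?F"
    by (simp add: filterlim_at)
  then have "filterlim (\<lambda>z. (f z * exp (\<i> * \<Phi> z)) / (exp (\<i> * \<Phi> z) * csqrt z)) at_infinity ?F"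
    by (rule filterlim_divide_at_infinity[OF f_exp_limit[OF R] _ limit_neq_0])
  moreover have "(f z * exp (\<i> * \<Phi> z)) / (exp (\<i> * \<Phi> z) * csqrt z) = T z" for z
  proof -
    have "(f z * exp (\<i> * \<Phi> z)) / (exp (\<i> * \<Phi> z) * csqrt z) = f z / csqrt z"
      by (simp add: mult.commute[of "f z"])
    then show ?thesis by (simp add: T_def divide_inverse)
  qed
  ultimately show ?thesis by simp
qed

lemma xi_pole: "j \<le> p \<Longrightarrow> of_real (\<xi> j) \<in> poles"
  by (auto simp: poles_def special_def)

text \<open>Excludes essential singularities before any order is estimated: the local form
  \<open>g z / (z - \<xi> j) ^ n\<close> in \<open>pole_order\<close> depends on it.\<close>

lemma is_pole_T2:
  assumes "j \<le> p"
  shows "is_pole T2 (of_real (\<xi> j))"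
  unfolding is_pole_def filterlim_at_infinity[OF order_refl]
proof (intro allI impI)
  let ?z = "of_real (\<xi> j) :: complex"
  fix b :: real assume "0 < b"
  then have "\<forall>\<^sub>F z in at ?z within upper_half_plane. b \<le> norm (T z)"
    using filterlim_T[OF assms] by (simp add: filterlim_at_infinity[OF order_refl])
  then obtain d where d: "0 < d" "\<And>z. 0 < Im z \<Longrightarrow> dist z ?z < d \<Longrightarrow> b \<le> norm (T z)"
    using at_real_nbhd by blast
  have "open (- (poles - {?z}))"
    by (intro open_Compl finite_imp_closed finite_Diff finite_poles)
  then have "\<forall>\<^sub>F z in at ?z. z \<in> - (poles - {?z})" by (rule eventually_at_in_open') simp
  moreover have "\<forall>\<^sub>F z in at ?z. z \<in> ball ?z d" by (rule eventually_at_in_open') (use d in auto)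
  moreover have "\<forall>\<^sub>F z in at ?z. z \<noteq> ?z" by (rule eventually_neq_at_within)
  ultimately show "\<forall>\<^sub>F z in at ?z. b \<le> norm (T2 z)"
  proof eventually_elim
    case (elim z)
    have "dist (cnj u) ?z = dist u ?z" for u
      using complex_mod_cnj[of "u - ?z"] by (simp add: dist_norm)
    then show ?case
      using elim d by (intro T2_norm_transfer[where U = "ball ?z d" and b = "\<lambda>_. b"]) (auto simp: dist_commute)
  qed
qed

text \<open>Comparing the local form of \<open>T2\<close> with the growth of \<open>f\<close> shows
  that \<open>exp (- \<i> * \<Phi> z) * (z - \<xi> j) ^ n / csqrt z\<close> has a nonzero limit.
  Then \<open>argument_variation\<close> bounds the order by the width of the channel divided by pi.
  The bound is put as an \<open>O(1)\<close> estimate for the removal of singularities.\<close>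

lemma pole_order:
  assumes j: "j \<le> p"
  shows "(\<lambda>z. T2 z * (z - of_real (\<xi> j)) ^ k j) \<in> O[at (of_real (\<xi> j))](\<lambda>_. 1)"
proof -
  let ?z = "of_real (\<xi> j) :: complex"
  let ?F = "at ?z within upper_half_plane"
  note R = Phi_reaches_finite[OF j]
  have "T2 holomorphic_on - (poles - {?z}) - {?z}"
    using T2_hol by (rule holomorphic_on_subset) auto
  moreover have "open (- (poles - {?z}))"
    by (intro open_Compl finite_imp_closed finite_Diff finite_poles)
  ultimately obtain n g r where g: "g ?z \<noteq> 0" "0 < r" "g holomorphic_on cball ?z r"
    "\<And>w. w \<in> cball ?z r - {?z} \<Longrightarrow> T2 w = g w / (w - ?z) ^ n"
    using zorder_exist_pole[of T2 "- (poles - {?z})" ?z] is_pole_T2[OF j] by blast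
  have gcont: "isCont g ?z"
    using g(2,3) continuous_on_interior[OF holomorphic_on_imp_continuous_on[OF g(3)], of ?z] by simp
  have glim: "(g \<longlongrightarrow> g ?z) ?F"
    using gcont unfolding isCont_def by (rule tendsto_within_subset) simp
  have "\<forall>\<^sub>F z in ?F. 1 \<le> norm (f z)"
    using filterlim_f[OF R] by (simp add: filterlim_at_infinity[OF order_refl])
  moreover have "\<forall>\<^sub>F z in ?F. 0 < Im z \<and> T z = g z / (z - ?z) ^ n"
    unfolding eventually_at
  proof (intro exI[of _ r] conjI ballI impI g(2))
    fix z assume z: "z \<in> upper_half_plane" "z \<noteq> ?z \<and> dist z ?z < r"
    then show "0 < Im z" by simp
    show "T z = g z / (z - ?z) ^ n"
      using g(4)[of z] z T2_upper[of z] by (auto simp: dist_commute)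
  qed
  ultimately have near: "\<forall>\<^sub>F z in ?F. f z \<noteq> 0 \<and> 0 < Im z \<and> T z = g z / (z - ?z) ^ n"
    by eventually_elim auto
  define C where "C = g ?z / (- of_real (s * L) / 2)"
  have C: "C \<noteq> 0" using g(1) limit_neq_0 by (simp add: C_def)
  have quot: "((\<lambda>z. g z / (f z * exp (\<i> * \<Phi> z))) \<longlongrightarrow> C) ?F"
    unfolding C_def by (intro tendsto_divide glim f_exp_limit[OF R] limit_neq_0)
  have key: "exp (- \<i> * \<Phi> z) * (z - ?z) ^ n / csqrt z = g z / (f z * exp (\<i> * \<Phi> z))"
    if z: "0 < Im z" "T z = g z / (z - ?z) ^ n" "f z \<noteq> 0" for z
  proof -
    have nz: "z - ?z \<noteq> 0" "csqrt z \<noteq> 0" using z(1) by auto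
    then have fz: "f z = g z / (z - ?z) ^ n * csqrt z" using z(2) by (simp add: T_def field_simps)
    have "g z \<noteq> 0" using fz z(3) by auto
    then show ?thesis unfolding fz using nz by (simp add: exp_minus field_simps)
  qed
  have "n \<le> k j"
  proof (cases "j = 0")
    case True
    then have z0: "?z = 0" by (simp add: xi_0)
    \<comment> \<open>At 0 the root is itself a half power, so the exponent is
      \<open>n - 1 / 2\<close>. Since \<open>n\<close> is an integer,
      \<open>n - 1 / 2 \<le> k 0\<close> still gives \<open>n \<le> k 0\<close>.\<close>
    have "((\<lambda>z. exp (- \<i> * \<Phi> z + of_real (real n - 1 / 2) * Ln (z - ?z))) \<longlongrightarrow> C) ?F"
    proof (rule Lim_transform_eventually[OF quot])
      show "\<forall>\<^sub>F z in ?F. g z / (f z * exp (\<i> * \<Phi> z)) =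
          exp (- \<i> * \<Phi> z + of_real (real n - 1 / 2) * Ln (z - ?z))"
        using near
      proof eventually_elim
        case (elim z)
        then have "z \<noteq> 0" by auto
        have "exp (- \<i> * \<Phi> z + of_real (real n - 1 / 2) * Ln (z - ?z))
            = exp (- \<i> * \<Phi> z) * (exp (of_nat n * Ln z) / exp (Ln z / 2))"
          unfolding z0 by (simp add: algebra_simps flip: exp_diff exp_add)
        also have "\<dots> = exp (- \<i> * \<Phi> z) * (z - ?z) ^ n / csqrt z"
          using \<open>z \<noteq> 0\<close> by (simp add: exp_of_nat_mult csqrt_exp_Ln z0)
        finally show ?case using key[of z] elim by simp
      qed
    qed
    from argument_variation[OF Phi_cont this C, of "lo j" "hi j"] R
    have "(real n - 1 / 2) * pi \<le> hi j - lo j" unfolding reaches_channel_def by blast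
    then have "real n - 1 / 2 \<le> real (k j)" using hi_lo[OF j] by (simp add: mult.commute)
    then show ?thesis by linarith
  next
    case False
    then have Xj: "X j \<noteq> 0" using X_pos[OF j] by simp
    \<comment> \<open>Away from 0 the root has the nonzero limit \<open>X j\<close> and can be moved
      into the constant.\<close>
    have "((\<lambda>z. g z / (f z * exp (\<i> * \<Phi> z)) * csqrt z) \<longlongrightarrow> C * of_real (X j)) ?F"
      by (intro tendsto_intros quot csqrt_limit j)
    then have "((\<lambda>z. exp (- \<i> * \<Phi> z + of_real (real n) * Ln (z - ?z))) \<longlongrightarrow> C * of_real (X j)) ?F"
    proof (rule Lim_transform_eventually)
      show "\<forall>\<^sub>F z in ?F. g z / (f z * exp (\<i> * \<Phi> z)) * csqrt z =
          exp (- \<i> * \<Phi> z + of_real (real n) * Ln (z - ?z))"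
        using near
      proof eventually_elim
        case (elim z)
        then have nz: "z - ?z \<noteq> 0" "csqrt z \<noteq> 0" by auto
        have "exp (- \<i> * \<Phi> z + of_real (real n) * Ln (z - ?z)) = exp (- \<i> * \<Phi> z) * (z - ?z) ^ n"
        proof -
          have "exp (of_real (real n) * Ln (z - ?z)) = (z - ?z) ^ n"
            using nz(1) by (simp add: exp_of_nat_mult)
          then show ?thesis by (simp only: exp_add)
        qed
        also have "\<dots> = g z / (f z * exp (\<i> * \<Phi> z)) * csqrt z"
          using key[of z] elim nz by (simp add: field_simps)
        finally show ?case by simp
      qed
    qed
    from argument_variation[OF Phi_cont this, of "lo j" "hi j"] R C Xj
    have "real n * pi \<le> hi j - lo j" unfolding reaches_channel_def by auto
    then show ?thesis using hi_lo[OF j] by (simp add: mult.commute)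
  qed
  have lim: "((\<lambda>z. g z * (z - ?z) ^ (k j - n)) \<longlongrightarrow> g ?z * (?z - ?z) ^ (k j - n)) (at ?z)"
    using gcont unfolding isCont_def by (intro tendsto_intros)
  have "((\<lambda>z. T2 z * (z - ?z) ^ k j) \<longlongrightarrow> g ?z * (?z - ?z) ^ (k j - n)) (at ?z)"
  proof (rule Lim_transform_eventually[OF lim])
    have "\<forall>\<^sub>F z in at ?z. z \<in> ball ?z r - {?z}" by (rule eventually_at_in_open) (use g(2) in auto)
    then show "\<forall>\<^sub>F z in at ?z. g z * (z - ?z) ^ (k j - n) = T2 z * (z - ?z) ^ k j"
    proof eventually_elim
      case (elim z)
      then have "T2 z = g z / (z - ?z) ^ n" "z - ?z \<noteq> 0" using g(4)[of z] by auto
      then show ?case using \<open>n \<le> k j\<close> by (simp add: power_diff)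
    qed
  qed
  then show ?thesis by (intro bigoI_tendsto) auto
qed

definition K :: nat where "K = (\<Sum>j=0..p. k j)"

definition Q :: "complex \<Rightarrow> complex" where "Q z = (\<Prod>j=0..p. (z - of_real (\<xi> j)) ^ k j)"

lemma Q_0: "Q z = z ^ k 0 * (\<Prod>j=1..p. (z - of_real (\<xi> j)) ^ k j)"
  unfolding Q_def by (simp add: prod.atLeast_Suc_atMost xi_0)

lemma Q_neq_0: "z \<notin> poles \<Longrightarrow> Q z \<noteq> 0"
  using xi_pole by (auto simp: Q_def)

lemma entire_extension:
  obtains G where "G holomorphic_on UNIV" "\<And>z. z \<notin> poles \<Longrightarrow> G z = T2 z * Q z"
proof -
  have Q_hol: "Q holomorphic_on A" for A unfolding Q_def by (intro holomorphic_intros)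
  have "\<exists>G. G holomorphic_on UNIV \<and> (\<forall>z\<in>UNIV - poles. G z = T2 z * Q z)"
  proof (rule removable_singularities[OF finite_poles])
    show "(\<lambda>z. T2 z * Q z) holomorphic_on UNIV - poles"
      using T2_hol by (intro holomorphic_intros Q_hol) (simp add: Compl_eq_Diff_UNIV)
    fix z assume "z \<in> poles"
    then obtain j where j: "j \<le> p" "z = of_real (\<xi> j)" by (auto simp: poles_def special_def)
    define R where "R z = (\<Prod>i\<in>{0..p}-{j}. (z - of_real (\<xi> i)) ^ k i :: complex)" for z
    have "R \<midarrow>z\<rightarrow> R z" unfolding R_def by (intro tendsto_intros)
    then have "R \<in> O[at z](\<lambda>_. 1)" by (intro bigoI_tendsto) auto
    from landau_o.big.mult[OF pole_order[OF j(1)] this[unfolded j(2)]]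
    have "(\<lambda>w. T2 w * (w - of_real (\<xi> j)) ^ k j * R w) \<in> O[at z](\<lambda>_. 1)" by (simp add: j(2))
    moreover have "Q w = (w - of_real (\<xi> j)) ^ k j * R w" for w
      unfolding Q_def R_def using j(1) by (intro prod.remove) auto
    ultimately show "(\<lambda>z. T2 z * Q z) \<in> O[at z](\<lambda>_. 1)" by (simp add: mult.assoc)
  qed auto
  then show thesis using that by auto
qed

lemma Q_large:
  obtains R where "1 \<le> R" "\<And>z. R \<le> norm z \<Longrightarrow> norm z \<le> norm (Q z) \<and> z \<notin> poles"
proof -
  \<comment> \<open>Outside this radius every \<open>\<xi> j\<close> is at distance at least 1, so
    the factors of \<open>Q\<close> other than \<open>z ^ k 0\<close> have modulus at least
    1.\<close>
  define R where "R = 2 + (\<Sum>j=0..p. \<xi> j)"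
  have R: "\<xi> j + 2 \<le> R" if "j \<le> p" for j
    unfolding R_def using that xi_nonneg member_le_sum[of j "{0..p}" \<xi>] by auto
  have far: "1 \<le> norm (z - of_real (\<xi> j))" if "R \<le> norm z" "j \<le> p" for z :: complex and j
    using norm_triangle_ineq2[of z "complex_of_real (\<xi> j)"] R[OF that(2)] that(1) xi_nonneg[of j] by simp
  have "2 \<le> R" using R[of 0] xi_nonneg[of 0] by simp
  show thesis
  proof (rule that[of R])
    show "1 \<le> R" using \<open>2 \<le> R\<close> by simp
    fix z :: complex assume z: "R \<le> norm z"
    have "1 \<le> norm z" using z \<open>2 \<le> R\<close> by linarith
    have "1 \<le> norm (\<Prod>j=1..p. (z - of_real (\<xi> j)) ^ k j)"
      unfolding prod_norm[symmetric] by (rule prod_ge_1) (use far[OF z] in \<open>auto simp: norm_power one_le_power\<close>)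
    moreover have "norm z \<le> norm (z ^ k 0)"
      using \<open>1 \<le> norm z\<close> k self_le_power[of "norm z" "k 0"] by (simp add: norm_power)
    ultimately have "norm z * 1 \<le> norm (z ^ k 0) * norm (\<Prod>j=1..p. (z - of_real (\<xi> j)) ^ k j)"
      by (intro mult_mono) auto
    then have "norm z \<le> norm (Q z)" by (simp add: Q_0 norm_mult)
    moreover have "z \<notin> poles" using far[OF z] by (fastforce simp: poles_def special_def)
    ultimately show "norm z \<le> norm (Q z) \<and> z \<notin> poles" ..
  qed
qed

text \<open>Makes infinity a pole of the entire extension, which is therefore a polynomial. The
  crude bound \<open>b / norm z\<close> for \<open>T2\<close> is enough, because \<open>Q\<close>
  grows at least linearly.\<close>

lemma T2_large:
  assumes "0 < b"
  shows "\<forall>\<^sub>F z in at_infinity. z \<notin> poles \<and> b \<le> norm (T2 z * Q z)"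
proof -
  obtain R where R: "1 \<le> R" "\<And>z. R \<le> norm z \<Longrightarrow> norm z \<le> norm (Q z) \<and> z \<notin> poles"
    using Q_large by blast
  have "\<forall>\<^sub>F z in inf at_infinity (principal upper_half_plane). b \<le> norm (f z)"
    using filterlim_f[OF Phi_reaches_infinity] assms by (simp add: filterlim_at_infinity[OF order_refl])
  then obtain R1 where R1: "\<And>z. R1 \<le> norm z \<Longrightarrow> 0 < Im z \<Longrightarrow> b \<le> norm (f z)"
    unfolding eventually_inf_principal eventually_at_infinity by blast
  define U where "U = {z :: complex. max R R1 < norm z}"
  have U: "1 \<le> norm z" "R \<le> norm z" "R1 \<le> norm z" if "z \<in> U" for z
    using that R(1) by (auto simp: U_def)
  have bT: "b / norm z \<le> norm (T2 z)" if "z \<in> U" for z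
  proof (rule T2_norm_transfer[where U = U])
    show "b / norm z \<le> norm (T z)" if "0 < Im z" "z \<in> U" for z
    proof -
      have "1 \<le> sqrt (norm z)" using U(1)[OF that(2)] by simp
      then have "sqrt (norm z) * 1 \<le> sqrt (norm z) * sqrt (norm z)" by (intro mult_left_mono) auto
      then have "sqrt (norm z) \<le> norm z" by simp
      then have "b / norm z \<le> norm (f z) / sqrt (norm z)"
        using R1[OF U(3)[OF that(2)] that(1)] U(1)[OF that(2)] assms by (intro frac_le) auto
      then show ?thesis by (simp add: T_def norm_mult norm_inverse divide_inverse)
    qed
    show "open U" unfolding U_def by (intro open_Collect_less continuous_intros)
    show "continuous_on U (\<lambda>z. b / norm z)" using U(1) by (intro continuous_intros) force
  qed (use that R(2) U in \<open>auto simp: U_def\<close>)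
  show ?thesis
    unfolding eventually_at_infinity
  proof (intro exI allI impI)
    fix z :: complex assume "max R R1 + 1 \<le> norm z"
    then have "max R R1 < norm z" by linarith
    then have z: "z \<in> U" unfolding U_def by blast
    have "b = b / norm z * norm z" using U(1)[OF z] by auto
    also have "\<dots> \<le> norm (T2 z) * norm (Q z)"
      using bT[OF z] R(2)[OF U(2)[OF z]] assms by (intro mult_mono) auto
    finally show "z \<notin> poles \<and> b \<le> norm (T2 z * Q z)"
      using R(2)[OF U(2)[OF z]] by (simp add: norm_mult)
  qed
qed

lemma Q_asymp: "((\<lambda>z. z ^ K / Q z) \<longlongrightarrow> 1) at_infinity"
proof -
  have "((\<lambda>z. \<Prod>j=0..p. (1 - of_real (\<xi> j) / z :: complex) ^ k j) \<longlongrightarrow> (\<Prod>j=0..p. (1 - 0) ^ k j)) at_infinity"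
    by (intro tendsto_intros tendsto_divide_0[OF tendsto_const] filterlim_ident)
  then have "((\<lambda>z. inverse (\<Prod>j=0..p. (1 - of_real (\<xi> j) / z :: complex) ^ k j)) \<longlongrightarrow> inverse 1) at_infinity"
    by (intro tendsto_inverse) auto
  then have *: "((\<lambda>z. inverse (\<Prod>j=0..p. (1 - of_real (\<xi> j) / z :: complex) ^ k j)) \<longlongrightarrow> 1) at_infinity"
    by simp
  show ?thesis
  proof (rule Lim_transform_eventually[OF *])
    have "inverse (\<Prod>j=0..p. (1 - of_real (\<xi> j) / z) ^ k j) = z ^ K / Q z" if "z \<noteq> 0" for z :: complex
    proof -
      have "Q z = (\<Prod>j=0..p. z ^ k j * (1 - of_real (\<xi> j) / z) ^ k j)"
        unfolding Q_def using that
        by (intro prod.cong refl) (simp add: field_simps flip: power_mult_distrib)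
      also have "\<dots> = z ^ K * (\<Prod>j=0..p. (1 - of_real (\<xi> j) / z) ^ k j)"
        by (simp add: prod.distrib power_sum K_def)
      finally show ?thesis using that by (simp add: divide_simps)
    qed
    then show "\<forall>\<^sub>F z in at_infinity. inverse (\<Prod>j=0..p. (1 - of_real (\<xi> j) / z) ^ k j) = z ^ K / Q z"
      unfolding eventually_at_infinity
    proof (intro exI[of _ 1] allI impI)
      fix z :: complex assume "1 \<le> norm z"
      then have "z \<noteq> 0" by auto
      then show "inverse (\<Prod>j=0..p. (1 - of_real (\<xi> j) / z) ^ k j) = z ^ K / Q z" by fact
    qed
  qed
qed

text \<open>The entire extension of \<open>T2 * Q\<close> tends to infinity, so it is a polynomial.
  Its degree is read off in the channel at infinity, of width \<open>pi * m\<close>: there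
  \<open>exp (- \<i> * \<Phi>)\<close> behaves like a constant times the power \<sigma> of
  \<open>z\<close>, so \<open>\<sigma> \<le> m\<close>.\<close>

lemma T2_polynomial:
  obtains P :: "complex poly" where "degree P \<le> m + K - 1"
    "\<And>z. z \<notin> poles \<Longrightarrow> poly P z = T2 z * Q z"
proof -
  obtain G where G: "G holomorphic_on UNIV" "\<And>z. z \<notin> poles \<Longrightarrow> G z = T2 z * Q z"
    using entire_extension by blast
  have "filterlim G at_infinity at_infinity"
    unfolding filterlim_at_infinity[OF order_refl]
  proof (intro allI impI)
    fix b :: real assume "0 < b"
    from T2_large[OF this] show "\<forall>\<^sub>F z in at_infinity. b \<le> norm (G z)"
      by (rule eventually_mono) (simp add: G(2))
  qed
  then have "((inverse \<circ> G) \<longlongrightarrow> 0) at_infinity"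
    unfolding comp_def by (rule filterlim_compose[OF tendsto_inverse_0])
  then obtain a n where an: "\<And>z. G z = (\<Sum>i\<le>n. a i * z ^ i)"
    using pole_at_infinity[OF G(1)] by metis
  define P where "P = (\<Sum>i\<le>n. monom (a i) i)"
  have PG: "poly P z = G z" for z by (simp add: P_def poly_sum poly_monom an)
  have P0: "P \<noteq> 0"
  proof
    assume "P = 0"
    then have "G z = 0" for z using PG[of z] by simp
    then have "\<not> (z \<notin> poles \<and> 1 \<le> norm (T2 z * Q z))" for z
      using G(2)[of z] by (metis norm_zero not_one_le_zero)
    then show False
      using eventually_happens'[OF trivial_limit_at_infinity T2_large[of 1]] by auto
  qed
  define d where "d = degree P"
  let ?F = "inf at_infinity (principal upper_half_plane) :: complex filter"
  define C where "C = lead_coeff P * 1 / (- of_real (s * L) / 2)"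
  have C: "C \<noteq> 0" using P0 limit_neq_0 by (simp add: C_def)
  have le: "?F \<le> at_infinity" by simp
  have quot: "((\<lambda>z. poly P z / z ^ d * (z ^ K / Q z) / (f z * exp (\<i> * \<Phi> z))) \<longlongrightarrow> C) ?F"
    unfolding C_def d_def
    by (intro tendsto_divide tendsto_mult f_exp_limit[OF Phi_reaches_infinity] limit_neq_0
        tendsto_mono[OF le poly_divide_tendsto_aux] tendsto_mono[OF le Q_asymp])
  \<comment> \<open>The order of \<open>f = csqrt z * P / Q\<close> at infinity, with
    \<open>1 / 2\<close> from the root. As \<open>d\<close> is an integer,
    \<open>\<sigma> \<le> m\<close> gives \<open>d \<le> m + K - 1\<close>.\<close>
  define \<sigma> :: real where "\<sigma> = real d + 1 / 2 - real K"
  have "((\<lambda>z. exp (- \<i> * \<Phi> z - of_real \<sigma> * Ln z)) \<longlongrightarrow> C) ?F"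
  proof (rule Lim_transform_eventually[OF quot])
    have "\<forall>\<^sub>F z in ?F. 1 \<le> norm (f z)"
      using filterlim_f[OF Phi_reaches_infinity] by (simp add: filterlim_at_infinity[OF order_refl])
    moreover have "\<forall>\<^sub>F z in ?F. z \<notin> poles"
      by (rule filter_leD[OF le], rule eventually_mono[OF T2_large[of 1]]) auto
    moreover have "\<forall>\<^sub>F z in ?F. 0 < Im z" by (simp add: eventually_inf_principal)
    ultimately show "\<forall>\<^sub>F z in ?F. poly P z / z ^ d * (z ^ K / Q z) / (f z * exp (\<i> * \<Phi> z)) =
        exp (- \<i> * \<Phi> z - of_real \<sigma> * Ln z)"
    proof eventually_elim
      case (elim z)
      then have nz: "z \<noteq> 0" "csqrt z \<noteq> 0" "f z \<noteq> 0" "Q z \<noteq> 0" using Q_neq_0 by auto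
      have "poly P z = f z / csqrt z * Q z"
        using G(2)[of z] elim PG by (simp add: T2_upper T_def divide_inverse)
      then have "poly P z / z ^ d * (z ^ K / Q z) / (f z * exp (\<i> * \<Phi> z)) =
          exp (- \<i> * \<Phi> z) * (z ^ K / (z ^ d * csqrt z))"
        using nz by (simp add: exp_minus field_simps)
      also have "z ^ K / (z ^ d * csqrt z) = exp (- of_real \<sigma> * Ln z)"
      proof -
        have "- of_real \<sigma> * Ln z = of_nat K * Ln z - (of_nat d * Ln z + Ln z / 2)"
          by (simp add: \<sigma>_def algebra_simps)
        then show ?thesis
          using nz by (simp add: exp_diff exp_add exp_of_nat_mult csqrt_exp_Ln)
      qed
      also have "exp (- \<i> * \<Phi> z) * exp (- of_real \<sigma> * Ln z) = exp (- \<i> * \<Phi> z - of_real \<sigma> * Ln z)"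
        by (simp flip: exp_add)
      finally show ?case .
    qed
  qed
  \<comment> \<open>By \<open>Ln_minus_inverse\<close> the inversion turns
    \<open>- \<sigma> * Ln\<close> into \<open>\<sigma> * Ln\<close> up to the constant
    \<open>- \<i> * pi * \<sigma>\<close>; the extra exponential factor cancels that
    constant.\<close>
  from filterlim_compose[OF this minus_inverse_at_0]
  have "((\<lambda>z. exp (- \<i> * \<Phi> (- inverse z) - of_real \<sigma> * Ln (- inverse z)) * exp (\<i> * pi * \<sigma>))
      \<longlongrightarrow> C * exp (\<i> * pi * \<sigma>)) (at 0 within upper_half_plane)"
    by (intro tendsto_intros)
  then have lim: "((\<lambda>z. exp (- \<i> * \<Phi> (- inverse z) + of_real \<sigma> * Ln (z - of_real 0)))
      \<longlongrightarrow> C * exp (\<i> * pi * \<sigma>)) (at_upper 0)"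
    unfolding of_real_0
  proof (rule Lim_transform_eventually)
    show "\<forall>\<^sub>F z in at 0 within upper_half_plane.
        exp (- \<i> * \<Phi> (- inverse z) - of_real \<sigma> * Ln (- inverse z)) * exp (\<i> * pi * \<sigma>) =
        exp (- \<i> * \<Phi> (- inverse z) + of_real \<sigma> * Ln (z - 0))"
      unfolding eventually_at_filter
      by (auto simp: Ln_minus_inverse algebra_simps simp flip: exp_add intro!: always_eventually)
  qed
  have cont: "continuous_on upper_half_plane (\<lambda>z. \<Phi> (- inverse z))"
  proof (rule continuous_on_compose2[OF Phi_cont])
    show "continuous_on upper_half_plane (\<lambda>z. - inverse z)" by (intro continuous_intros) auto
    show "(\<lambda>z. - inverse z) ` upper_half_plane \<subseteq> upper_half_plane"
      by (auto simp: divide_pos_pos add_nonneg_pos)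
  qed
  have "\<forall>\<^sub>F z in ?F. c < Re (\<Phi> z) \<and> Re (\<Phi> z) < \<beta> p"
    using Phi_reaches_infinity unfolding reaches_channel_def by blast
  then have "\<forall>\<^sub>F z in at_upper 0.
      c < Re (\<Phi> (- inverse z)) \<and> Re (\<Phi> (- inverse z)) < \<beta> p"
    using minus_inverse_at_0 unfolding filterlim_iff by auto
  from argument_variation[OF cont lim _ this] C
  have "\<sigma> * pi \<le> \<beta> p - c" by simp
  then have "\<sigma> \<le> real m" using beta_ends by (simp add: mult.commute)
  then have "d \<le> m + K - 1" using m unfolding \<sigma>_def by linarith
  then show thesis using that[of P] PG G(2) by (simp add: d_def)
qed

section \<open>Equioscillation\<close>

definition \<omega> :: "real \<Rightarrow> complex" where
  "\<omega> u = (SOME w. (\<Phi> \<longlongrightarrow> w) (at_upper u))"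

text \<open>The continuation of \<open>f\<close> across the positive axis: off the poles, both
  \<open>T2\<close> and the root are holomorphic there.\<close>

definition H :: "complex \<Rightarrow> complex" where "H z = T2 z * csqrt z"

lemma H_upper:
  assumes "0 < Im z"
  shows "H z = f z"
proof -
  have "z \<noteq> 0" using assms by auto
  then have "inverse (csqrt z) * csqrt z = 1" by (intro left_inverse) (simp only: csqrt_eq_0 not_False_eq_True)
  moreover have "H z = f z * (inverse (csqrt z) * csqrt z)"
    by (simp only: H_def T2_upper[OF assms] T_def mult.assoc)
  ultimately show ?thesis by simp
qed

lemma H_real: "0 \<le> u \<Longrightarrow> H (of_real u) = of_real (\<tau> u * sqrt u)"
  by (simp add: H_def T2_real csqrt_of_real_nonneg)

lemma f_limit:
  assumes "0 < u" "u \<notin> special"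
  shows "(f \<longlongrightarrow> of_real (\<tau> u * sqrt u)) (at_upper u)"
proof -
  have "(csqrt \<longlongrightarrow> of_real (sqrt u)) (at_upper u)"
    using csqrt_at_real[of u] assms(1) by (simp add: filterlim_at)
  then have "((\<lambda>z. T z * csqrt z) \<longlongrightarrow> of_real (\<tau> u) * of_real (sqrt u))
      (at_upper u)"
    by (intro tendsto_mult T_tau assms(2))
  then have "((\<lambda>z. T z * csqrt z) \<longlongrightarrow> of_real (\<tau> u * sqrt u)) (at_upper u)"
    by simp
  then show ?thesis
  proof (rule Lim_transform_eventually)
    have "T z * csqrt z = f z" if "0 < Im z" for z
      using H_upper[OF that] by (simp add: H_def T2_upper that)
    then show "\<forall>\<^sub>F z in at_upper u. T z * csqrt z = f z"
      by (auto simp: eventually_at_filter intro!: always_eventually)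
  qed
qed

text \<open>Reflection gives limits of \<open>f\<close>, hence only of \<open>cos \<Phi>\<close>.
  Boundedness and \<open>limit_of_cos_limit\<close> upgrade them to limits of \<Phi>, so that the
  map itself can be followed along the axis.\<close>

lemma omega_limit:
  assumes u: "0 < u" "u \<notin> special"
  shows "(\<Phi> \<longlongrightarrow> \<omega> u) (at_upper u)"
    and "of_real (\<tau> u * sqrt u) = 1 - of_real (s * L) * cos (\<omega> u)"
proof -
  have sL: "of_real (s * L) \<noteq> (0 :: complex)" using limit_neq_0 by simp
  have "((\<lambda>z. (1 - f z) / of_real (s * L)) \<longlongrightarrow> (1 - of_real (\<tau> u * sqrt u)) / of_real (s * L))
      (at_upper u)"
    by (intro tendsto_intros f_limit u sL)
  moreover have "(1 - f z) / of_real (s * L) = cos (\<Phi> z)" for z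
    using sL by (simp add: f_def)
  ultimately have cos_lim: "((\<lambda>z. cos (\<Phi> z)) \<longlongrightarrow> (1 - of_real (\<tau> u * sqrt u)) / of_real (s * L))
      (at_upper u)" by simp
  obtain r K where r: "0 < r" "\<And>z. 0 < Im z \<Longrightarrow> dist z (of_real u) < r \<Longrightarrow> norm (\<Phi> z) \<le> K"
    using bounded_near[OF u(2)] by blast
  have "continuous_on (upper_half_plane \<inter> ball (of_real u) r) \<Phi>"
    using Phi_cont by (rule continuous_on_subset) auto
  moreover have "norm (\<Phi> z) \<le> K" if "z \<in> upper_half_plane \<inter> ball (of_real u) r" for z
    using r(2)[of z] that by (simp add: dist_commute)
  ultimately obtain w where "(\<Phi> \<longlongrightarrow> w) (at_upper u)"
    using limit_of_cos_limit[OF _ r(1) _ cos_lim] by metis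
  then show lim: "(\<Phi> \<longlongrightarrow> \<omega> u) (at_upper u)"
    unfolding \<omega>_def by (rule someI)
  have "((\<lambda>z. cos (\<Phi> z)) \<longlongrightarrow> cos (\<omega> u)) (at_upper u)"
    using lim by (rule tendsto_cos)
  then have "cos (\<omega> u) = (1 - of_real (\<tau> u * sqrt u)) / of_real (s * L)"
    using tendsto_unique[OF at_real_within_upper_half_plane_neq_bot _ cos_lim] by blast
  then show "of_real (\<tau> u * sqrt u) = 1 - of_real (s * L) * cos (\<omega> u)"
    using sL by (simp del: of_real_mult)
qed

lemma phi_limit:
  assumes "0 < t" "t\<^sup>2 \<notin> special"
  shows "(\<phi> \<longlongrightarrow> \<omega> (t\<^sup>2)) (at (of_real t) within first_quadrant)"
proof -
  have "filterlim (\<lambda>z. z\<^sup>2) (at_upper (t\<^sup>2)) (at (of_real t) within first_quadrant)"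
    unfolding filterlim_at
  proof
    show "((\<lambda>z. z\<^sup>2) \<longlongrightarrow> of_real (t\<^sup>2)) (at (of_real t) within first_quadrant)"
      unfolding of_real_power by (intro tendsto_intros)
    have "z\<^sup>2 \<in> upper_half_plane \<and> z\<^sup>2 \<noteq> of_real (t\<^sup>2)" if "z \<in> first_quadrant" for z
      using first_quadrant_square(1)[OF that] by (auto simp del: of_real_power)
    then show "\<forall>\<^sub>F z in at (of_real t) within first_quadrant. z\<^sup>2 \<in> upper_half_plane \<and> z\<^sup>2 \<noteq> of_real (t\<^sup>2)"
      unfolding eventually_at_filter by (intro always_eventually) blast
  qed
  from filterlim_compose[OF omega_limit(1) this] assms
  have "((\<lambda>z. \<Phi> (z\<^sup>2)) \<longlongrightarrow> \<omega> (t\<^sup>2)) (at (of_real t) within first_quadrant)" by simp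
  then show ?thesis
    by (rule Lim_transform_eventually)
       (auto simp: eventually_at_filter \<Phi>_def first_quadrant_square intro!: always_eventually)
qed

text \<open>Properness keeps the limit out of the domain, and \<open>positive_line_side\<close>
  keeps it off the cut.\<close>

lemma omega_boundary:
  assumes u: "0 < u" "u \<notin> special"
  shows "0 \<le> Im (\<omega> u)" "0 \<le> Re (\<omega> u)" "Re (\<omega> u) \<le> W"
    "Im (\<omega> u) = 0 \<or> Re (\<omega> u) = 0 \<or> Re (\<omega> u) = W \<or>
      (\<exists>j\<in>{1..p}. Re (\<omega> u) = ray_abscissa q m p k j \<and> B j \<le> Im (\<omega> u))"
proof -
  let ?F = "at_upper u"
  note lim = omega_limit(1)[OF u]
  have in_F: "\<forall>\<^sub>F z in ?F. \<Phi> z \<in> \<Omega>" by (auto simp: eventually_at_filter Phi_in intro!: always_eventually)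
  note nb = at_real_within_upper_half_plane_neq_bot[of u]
  have strip: "\<forall>\<^sub>F z in ?F. 0 \<le> Im (\<Phi> z)" "\<forall>\<^sub>F z in ?F. 0 \<le> Re (\<Phi> z)" "\<forall>\<^sub>F z in ?F. Re (\<Phi> z) \<le> W"
    by (rule eventually_mono[OF in_F]; simp add: in_comb_domain)+
  show "0 \<le> Im (\<omega> u)" by (rule tendsto_lowerbound[OF tendsto_Im[OF lim] strip(1) nb])
  show "0 \<le> Re (\<omega> u)" by (rule tendsto_lowerbound[OF tendsto_Re[OF lim] strip(2) nb])
  show "Re (\<omega> u) \<le> W" by (rule tendsto_upperbound[OF tendsto_Re[OF lim] strip(3) nb])
  have clos: "\<omega> u \<in> closure \<Omega>"
    by (rule Lim_in_closed_set[OF closed_closure _ nb lim])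
       (rule eventually_mono[OF in_F], use closure_subset in auto)
  have "\<omega> u \<notin> \<Omega>"
  proof
    assume "\<omega> u \<in> \<Omega>"
    then obtain e where e: "0 < e" "cball (\<omega> u) e \<subseteq> \<Omega>"
      using open_comb_domain open_contains_cball by blast
    have "\<forall>\<^sub>F z in ?F. \<Phi> z \<notin> cball (\<omega> u) e" by (rule Phi_proper) (use e in auto)
    moreover have "\<forall>\<^sub>F z in ?F. dist (\<Phi> z) (\<omega> u) < e" using lim e(1) by (rule tendstoD)
    ultimately have "\<forall>\<^sub>F z in ?F. False" by eventually_elim (auto simp: dist_commute)
    then show False using nb by simp
  qed
  moreover have "\<omega> u \<notin> cut_side"
  proof
    assume "\<omega> u \<in> cut_side"
    then have "\<forall>\<^sub>F z in ?F. \<Phi> z \<in> cut_side" using lim sides(1) topological_tendstoD by blast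
    then have "\<forall>\<^sub>F z in ?F. False"
      using positive_line_side[OF u(1)] by eventually_elim (use sides in auto)
    then show False using nb by simp
  qed
  ultimately show "Im (\<omega> u) = 0 \<or> Re (\<omega> u) = 0 \<or> Re (\<omega> u) = W \<or>
      (\<exists>j\<in>{1..p}. Re (\<omega> u) = ray_abscissa q m p k j \<and> B j \<le> Im (\<omega> u))"
    using boundary_types[OF clos] by blast
qed

definition J :: "real set" where "J = {a\<^sup>2..1}"

lemma J_regular:
  assumes "u \<in> J"
  shows "0 < u" "u \<notin> special"
proof -
  show "0 < u" using assms a0 by (auto simp: J_def intro: less_le_trans[of _ "a\<^sup>2"])
  show "u \<notin> special"
  proof
    assume "u \<in> special"
    then obtain j where j: "j \<le> p" "u = (X j)\<^sup>2" by (auto simp: special_def \<xi>_def)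
    have "0 \<le> X j" by (rule X_nonneg[OF j(1)])
    consider "X j < a" | "1 < X j"
      using x_left x_right j(1) a0 by (cases "j = 0"; cases "j \<le> q") (auto simp: X_def)
    then show False
    proof cases
      case 1
      then have "(X j)\<^sup>2 < a\<^sup>2" using \<open>0 \<le> X j\<close> by (intro power_strict_mono) auto
      then show False using assms j by (simp add: J_def)
    next
      case 2
      then have "1\<^sup>2 < (X j)\<^sup>2" by (intro power_strict_mono) auto
      then show False using assms j by (simp add: J_def)
    qed
  qed
qed

lemma omega_cont: "continuous_on J \<omega>"
proof -
  have "continuous_on (upper_half_plane \<union> of_real ` J)
      (\<lambda>z. if z \<in> upper_half_plane then \<Phi> z else \<omega> (Re z))"
  proof (rule continuous_on_boundary_extension[OF Phi_cont open_halfspace_Im_gt])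
    have "of_real u \<in> closure upper_half_plane" for u
      using at_real_within_upper_half_plane_neq_bot[of u]
        closure_mono[of "upper_half_plane - {of_real u}" upper_half_plane]
      by (auto simp: trivial_limit_within islimpt_in_closure)
    then show "of_real ` J \<subseteq> closure upper_half_plane" by blast
  qed (use omega_limit(1) J_regular in auto)
  then have "continuous_on J ((\<lambda>z. if z \<in> upper_half_plane then \<Phi> z else \<omega> (Re z)) \<circ> of_real)"
    by (intro continuous_on_compose continuous_intros) (auto elim: continuous_on_subset)
  then show ?thesis by (simp add: comp_def)
qed

lemma omega_ends: "\<omega> (a\<^sup>2) = 0" "\<omega> 1 = of_real W"
proof -
  have aJ: "a\<^sup>2 \<in> J" "1 \<in> J" using a0 a1 by (auto simp: J_def power_le_one)
  have "(\<Phi> \<longlongrightarrow> 0) (at_upper (a\<^sup>2))"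
    using Phi_limit[OF a0] normalized by (simp add: normalized_comb_map_def)
  then show "\<omega> (a\<^sup>2) = 0"
    using tendsto_unique[OF at_real_within_upper_half_plane_neq_bot omega_limit(1)] J_regular[OF aJ(1)] by blast
  have "(\<Phi> \<longlongrightarrow> of_real W) (at_upper (1\<^sup>2))"
    using normalized by (intro Phi_limit) (simp_all add: normalized_comb_map_def)
  then show "\<omega> 1 = of_real W"
    using tendsto_unique[OF at_real_within_upper_half_plane_neq_bot omega_limit(1)] J_regular[OF aJ(2)]
    by (metis one_power2)
qed

definition g :: "real \<Rightarrow> real" where "g u = \<tau> u * sqrt u"

lemma g_omega:
  assumes "u \<in> J"
  shows "g u = 1 - s * L * (cos (Re (\<omega> u)) * cosh (Im (\<omega> u)))"
proof -
  have "g u = Re (1 - of_real (s * L) * cos (\<omega> u))"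
    unfolding omega_limit(2)[OF J_regular[OF assms], symmetric] by (simp add: g_def)
  then show ?thesis by (simp add: Re_cos cosh_def field_simps)
qed

lemma H_derivative:
  assumes "u \<in> J"
  shows "(H has_field_derivative deriv H (of_real u)) (at (of_real u))"
    and "(g has_real_derivative Re (deriv H (of_real u))) (at u within J)"
proof -
  have "open (- poles - \<real>\<^sub>\<le>\<^sub>0)"
    by (intro open_Diff open_Compl finite_imp_closed finite_poles closed_nonpos_Reals_complex)
  moreover have "H holomorphic_on - poles - \<real>\<^sub>\<le>\<^sub>0"
    unfolding H_def by (intro holomorphic_intros holomorphic_on_subset[OF T2_hol]) auto
  moreover have "of_real u \<in> - poles - \<real>\<^sub>\<le>\<^sub>0"
    using J_regular[OF assms] by (auto simp: poles_def complex_nonpos_Reals_iff)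
  ultimately show der: "(H has_field_derivative deriv H (of_real u)) (at (of_real u))"
    by (intro holomorphic_derivI)
  have "((\<lambda>v. Re (H (of_real v))) has_real_derivative Re (deriv H (of_real u))) (at u within J)"
    unfolding has_real_derivative_iff_has_vector_derivative
    by (rule bounded_linear.has_vector_derivative[OF bounded_linear_Re has_vector_derivative_real_field[OF der]])
  then show "(g has_real_derivative Re (deriv H (of_real u))) (at u within J)"
    by (rule has_field_derivative_transform_within[OF _ zero_less_one assms])
      (auto simp: H_real g_def J_regular less_imp_le)
qed

text \<open>Above the boundary point the sign of the imaginary part of \<open>f\<close> is that of its normal
  derivative, which by the Cauchy-Riemann equations is the tangential derivative of \<open>g\<close>.\<close>

lemma deriv_sign:
  assumes u: "u \<in> J" and pos: "\<forall>\<^sub>F z in at_upper u. 0 < \<epsilon> * Im (f z)"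
  shows "0 \<le> \<epsilon> * Re (deriv H (of_real u))"
proof -
  define y where "y n = 1 / real (Suc n)" for n
  define z where "z n = of_real u + \<i> * of_real (y n)" for n
  have ypos: "0 < y n" "y n \<noteq> 0" for n by (simp_all add: y_def)
  have "y \<longlonglongrightarrow> 0" unfolding y_def by (rule LIMSEQ_Suc[OF lim_1_over_n])
  then have "z \<longlonglongrightarrow> of_real u + \<i> * of_real 0" unfolding z_def by (intro tendsto_intros)
  then have zlim: "filterlim z (at_upper u) sequentially"
    unfolding filterlim_at using ypos by (simp add: z_def)
  have "((\<lambda>w. (H w - H (of_real u)) / (w - of_real u)) \<longlongrightarrow> deriv H (of_real u)) (at (of_real u))"
    using H_derivative(1)[OF u] by (simp add: has_field_derivative_iff)
  then have "((\<lambda>w. (H w - H (of_real u)) / (w - of_real u)) \<longlongrightarrow> deriv H (of_real u))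
      (at_upper u)"
    by (rule tendsto_within_subset) simp
  from filterlim_compose[OF this zlim]
  have "(\<lambda>n. Re ((H (z n) - H (of_real u)) / (z n - of_real u))) \<longlonglongrightarrow> Re (deriv H (of_real u))"
    by (rule tendsto_Re)
  moreover have "Re ((H (z n) - H (of_real u)) / (z n - of_real u)) = Im (f (z n)) / y n" for n
  proof -
    have "H (z n) = f (z n)" using ypos by (intro H_upper) (simp add: z_def)
    moreover have "Im (H (of_real u)) = 0" using J_regular[OF u] by (simp add: H_real)
    moreover have "Re (w / (\<i> * of_real r)) = Im w / r" for w and r :: real
      by (simp add: Re_divide power2_eq_square)
    ultimately show ?thesis by (simp add: z_def)
  qed
  ultimately have "(\<lambda>n. \<epsilon> * (Im (f (z n)) / y n)) \<longlonglongrightarrow> \<epsilon> * Re (deriv H (of_real u))"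
    by (intro tendsto_mult_left) simp
  moreover have "\<forall>\<^sub>F n in sequentially. 0 < \<epsilon> * Im (f (z n))"
    using zlim pos unfolding filterlim_iff by blast
  then have "\<forall>\<^sub>F n in sequentially. 0 \<le> \<epsilon> * (Im (f (z n)) / y n)"
  proof eventually_elim
    case (elim n)
    then have "0 \<le> (\<epsilon> * Im (f (z n))) / y n" using ypos(1)[of n] by (intro divide_nonneg_pos) auto
    then show ?case by simp
  qed
  ultimately show ?thesis by (rule tendsto_lowerbound) simp
qed

lemma Im_f: "Im (f z) = s * L * (sin (Re (\<Phi> z)) * sinh (Im (\<Phi> z)))"
  by (simp add: f_def Im_cos sinh_def field_simps)

definition M :: nat where "M = m + K"

lemma W_eq: "W = pi * real M"
  by (simp add: strip_width_def M_def K_def algebra_simps)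

lemma cos_W: "cos W = (- 1) ^ M" by (simp add: W_eq)

text \<open>Next to this wall \<open>0 < Re \<Phi> < pi\<close>, so the sine is positive and
  \<open>Im f\<close> has the sign of \<open>s\<close>. Hence \<open>s * g\<close> cannot decrease
  while the boundary value is on the wall, whereas climbing would lower it.\<close>

lemma left_wall_sign:
  assumes u: "u \<in> J" and "Re (\<omega> u) = 0"
  shows "0 \<le> s * Re (deriv H (of_real u))"
proof (rule deriv_sign[OF u])
  let ?F = "at_upper u"
  have "\<forall>\<^sub>F z in ?F. Re (\<Phi> z) < pi"
    using tendsto_Re[OF omega_limit(1)[OF J_regular[OF u]]] assms(2) pi_gt_zero
    by (intro order_tendstoD(2)[of _ "Re (\<omega> u)"]) simp_all
  moreover have "\<forall>\<^sub>F z in ?F. 0 < Im z" by (simp add: eventually_at_filter)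
  ultimately show "\<forall>\<^sub>F z in ?F. 0 < s * Im (f z)"
  proof eventually_elim
    case (elim z)
    then have "0 < sin (Re (\<Phi> z))" "0 < sinh (Im (\<Phi> z))"
      using Phi_strip[of z] by (auto intro: sin_gt_zero)
    then have "0 < L * (sin (Re (\<Phi> z)) * sinh (Im (\<Phi> z)))" using L_pos by simp
    moreover have "s * Im (f z) = (s * s) * (L * (sin (Re (\<Phi> z)) * sinh (Im (\<Phi> z))))"
      by (simp only: Im_f mult.assoc)
    ultimately show ?case by (simp add: s_square)
  qed
qed

text \<open>The mirror image: since \<open>W = pi * M\<close>, replacing \<open>Re \<Phi>\<close> by
  the distance from the right wall changes the sine by the factor \<open>- (-1) ^ M\<close>.\<close>

lemma right_wall_sign:
  assumes u: "u \<in> J" and "Re (\<omega> u) = W"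
  shows "0 \<le> - ((- 1) ^ M * s) * Re (deriv H (of_real u))"
proof (rule deriv_sign[OF u])
  let ?F = "at_upper u"
  have "\<forall>\<^sub>F z in ?F. W - pi < Re (\<Phi> z)"
    using tendsto_Re[OF omega_limit(1)[OF J_regular[OF u]]] assms(2) pi_gt_zero
    by (intro order_tendstoD(1)[of _ "Re (\<omega> u)"]) simp_all
  moreover have "\<forall>\<^sub>F z in ?F. 0 < Im z" by (simp add: eventually_at_filter)
  ultimately show "\<forall>\<^sub>F z in ?F. 0 < - ((- 1) ^ M * s) * Im (f z)"
  proof eventually_elim
    case (elim z)
    have "sin (Re (\<Phi> z)) = - ((- 1) ^ M) * sin (W - Re (\<Phi> z))"
      by (simp add: sin_diff cos_W W_eq flip: mult.assoc power_mult_distrib)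
    then have "- ((- 1) ^ M * s) * Im (f z) =
        ((- 1) ^ M * (- 1) ^ M) * (s * s) * (L * (sin (W - Re (\<Phi> z)) * sinh (Im (\<Phi> z))))"
      unfolding Im_f by (simp only: mult_minus_left mult_minus_right minus_minus) (simp only: mult_ac)
    then have "- ((- 1) ^ M * s) * Im (f z) = L * (sin (W - Re (\<Phi> z)) * sinh (Im (\<Phi> z)))"
      by (simp add: s_square flip: power_mult_distrib)
    moreover have "0 < sin (W - Re (\<Phi> z))" "0 < sinh (Im (\<Phi> z))"
      using Phi_strip[of z] elim by (auto intro: sin_gt_zero)
    then have "0 < L * (sin (W - Re (\<Phi> z)) * sinh (Im (\<Phi> z)))" using L_pos by simp
    ultimately show ?case by simp
  qed
qed

text \<open>An excursion from the base would occupy an interval \<open>u1 < u < u2\<close> with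
  height 0 at both ends and stay on one vertical line. A ray begins at a positive height, so it
  cannot be entered from the base. On a wall, \<open>g\<close> is an explicit function of the
  height, and its monotonicity forbids leaving the left wall's foot or returning to the right
  one's.\<close>

lemma omega_real:
  assumes u0: "u0 \<in> J"
  shows "Im (\<omega> u0) = 0"
proof (rule ccontr)
  assume ne: "Im (\<omega> u0) \<noteq> 0"
  define Z where "Z = {u \<in> J. Im (\<omega> u) = 0}"
  have contIm: "continuous_on J (\<lambda>u. Im (\<omega> u))" by (intro continuous_intros omega_cont)
  have "closed Z"
    unfolding Z_def by (intro continuous_closed_preimage_constant contIm) (simp add: J_def)
  moreover have "bounded Z" by (rule bounded_subset[of "{a\<^sup>2..1}"]) (auto simp: Z_def J_def)
  ultimately have "compact Z" by (simp add: compact_eq_bounded_closed)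
  then have cZ: "compact (Z \<inter> {..u0})" "compact (Z \<inter> {u0..})"
    by (auto intro: compact_Int_closed)
  have aJ: "a\<^sup>2 \<in> J" "1 \<in> J" using a0 a1 by (auto simp: J_def power_le_one)
  have "a\<^sup>2 \<in> Z \<inter> {..u0}" using aJ omega_ends u0 by (simp add: Z_def J_def)
  then obtain u1 where u1: "u1 \<in> Z" "u1 \<le> u0" "\<And>u. u \<in> Z \<Longrightarrow> u \<le> u0 \<Longrightarrow> u \<le> u1"
    using compact_attains_sup[OF cZ(1)] by auto
  have "1 \<in> Z \<inter> {u0..}" using aJ omega_ends u0 by (simp add: Z_def J_def)
  then obtain u2 where u2: "u2 \<in> Z" "u0 \<le> u2" "\<And>u. u \<in> Z \<Longrightarrow> u0 \<le> u \<Longrightarrow> u2 \<le> u"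
    using compact_attains_inf[OF cZ(2)] by auto
  have lt: "u1 < u0" "u0 < u2"
    using u1 u2 ne by (auto simp: Z_def less_le)
  have sub: "{u1..u2} \<subseteq> J" using u1(1) u2(1) by (auto simp: Z_def J_def)
  define I where "I = {u1<..<u2}"
  have IJ: "I \<subseteq> J" using sub by (auto simp: I_def)
  have Ipos: "0 < Im (\<omega> u)" if "u \<in> I" for u
  proof -
    have "u \<notin> Z" using that u1(3)[of u] u2(3)[of u] by (cases "u \<le> u0") (auto simp: I_def)
    then show ?thesis
      using that IJ omega_boundary(1)[OF J_regular, of u] by (auto simp: Z_def less_le)
  qed
  \<comment> \<open>Off the base only these finitely many abscissas are possible, so continuity
    makes \<open>Re \<omega>\<close> constant on \<open>I\<close>.\<close>
  define V where "V = {0, W} \<union> ray_abscissa q m p k ` {1..p}"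
  have "(\<lambda>u. Re (\<omega> u)) ` I \<subseteq> V"
  proof (rule image_subsetI)
    fix u assume u: "u \<in> I"
    then have "u \<in> J" using IJ by blast
    from omega_boundary(4)[OF J_regular[OF this]] Ipos[OF u] show "Re (\<omega> u) \<in> V"
      unfolding V_def by auto
  qed
  then have "finite ((\<lambda>u. Re (\<omega> u)) ` I)" by (rule finite_subset) (simp add: V_def)
  moreover have "continuous_on I (\<lambda>u. Re (\<omega> u))"
    by (intro continuous_intros continuous_on_subset[OF omega_cont IJ])
  moreover have "connected I" by (simp add: I_def)
  ultimately have "(\<lambda>u. Re (\<omega> u)) constant_on I" using continuous_finite_range_constant by blast
  then obtain R0 where R0: "\<And>u. u \<in> I \<Longrightarrow> Re (\<omega> u) = R0" unfolding constant_on_def by blast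
  have clI: "closure I = {u1..u2}" using lt by (simp add: I_def closure_greaterThanLessThan)
  have cont12: "continuous_on {u1..u2} \<omega>" using omega_cont sub by (rule continuous_on_subset)
  have R0': "Re (\<omega> u) = R0" if "u \<in> {u1..u2}" for u
    by (rule continuous_constant_on_closure[of I "\<lambda>u. Re (\<omega> u)"])
       (use that clI R0 in \<open>auto intro!: continuous_intros cont12\<close>)
  have contg: "continuous_on {u1..u2} g"
    by (rule continuous_on_subset[OF DERIV_continuous_on[OF H_derivative(2)] sub])
  have derg: "(g has_real_derivative Re (deriv H (of_real u))) (at u)" if "u1 < u" "u < u2" for u
  proof -
    have "(g has_real_derivative Re (deriv H (of_real u))) (at u within I)"
      using IJ that by (intro DERIV_subset[OF H_derivative(2) IJ]) (auto simp: I_def)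
    moreover have "u \<in> I" "open I" using that by (auto simp: I_def)
    ultimately show ?thesis by (metis at_within_open)
  qed
  have J12: "u1 \<in> J" "u2 \<in> J" using u1(1) u2(1) by (auto simp: Z_def)
  have cosh_gt: "1 < cosh (Im (\<omega> u0))"
    using Ipos[of u0] lt cosh_real_strict_mono[of 0 "Im (\<omega> u0)"] by (simp add: I_def)
  have Im12: "Im (\<omega> u1) = 0" "Im (\<omega> u2) = 0" using u1(1) u2(1) by (auto simp: Z_def)
  consider "R0 = 0" | "R0 = W" | "R0 \<noteq> 0" "R0 \<noteq> W" by blast
  then show False
  proof cases
    case 1
    have "s * g u1 \<le> s * g u0"
    proof (rule DERIV_nonneg_imp_increasing_open[of u1 u0 "\<lambda>u. s * g u"])
      fix u assume u: "u1 < u" "u < u0"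
      then have "((\<lambda>u. s * g u) has_real_derivative s * Re (deriv H (of_real u))) (at u)"
        using lt by (intro DERIV_cmult derg) auto
      moreover have "0 \<le> s * Re (deriv H (of_real u))"
        using u lt sub R0' 1 by (intro left_wall_sign) auto
      ultimately show "\<exists>y. ((\<lambda>u. s * g u) has_real_derivative y) (at u) \<and> 0 \<le> y" by blast
    next
      show "continuous_on {u1..u0} (\<lambda>u. s * g u)"
        using lt by (intro continuous_intros continuous_on_subset[OF contg]) auto
    qed (use lt in auto)
    moreover have "s * g u0 = s - L * cosh (Im (\<omega> u0))" "s * g u1 = s - L"
      using R0'[of u0] R0'[of u1] lt 1 Im12 s_square(1)
      by (auto simp: g_omega u0 J12 right_diff_distrib simp flip: mult.assoc)
    ultimately show False using cosh_gt L_pos by simp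
  next
    case 2
    \<comment> \<open>On the right wall
      \<open>\<epsilon> * g = \<epsilon> + L * cosh (Im \<omega>)\<close> is nondecreasing, so the
      height cannot fall back to 0 at \<open>u2\<close>. On the left wall the contradiction was at
      \<open>u1\<close>.\<close>
    define \<epsilon> :: real where "\<epsilon> = - ((- 1) ^ M * s)"
    have "\<epsilon> * g u0 \<le> \<epsilon> * g u2"
    proof (rule DERIV_nonneg_imp_increasing_open[of u0 u2 "\<lambda>u. \<epsilon> * g u"])
      fix u assume u: "u0 < u" "u < u2"
      then have "((\<lambda>u. \<epsilon> * g u) has_real_derivative \<epsilon> * Re (deriv H (of_real u))) (at u)"
        using lt by (intro DERIV_cmult derg) auto
      moreover have "0 \<le> \<epsilon> * Re (deriv H (of_real u))"
        unfolding \<epsilon>_def using u lt sub R0' 2 by (intro right_wall_sign) auto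
      ultimately show "\<exists>y. ((\<lambda>u. \<epsilon> * g u) has_real_derivative y) (at u) \<and> 0 \<le> y" by blast
    next
      show "continuous_on {u0..u2} (\<lambda>u. \<epsilon> * g u)"
        using lt by (intro continuous_intros continuous_on_subset[OF contg]) auto
    qed (use lt in auto)
    moreover have eg: "\<epsilon> * (1 - s * L * ((- 1) ^ M * y)) = \<epsilon> + L * y" for y
    proof -
      have "\<epsilon> * (1 - s * L * ((- 1) ^ M * y)) = \<epsilon> + (((- 1) ^ M * (- 1) ^ M) * (s * s)) * (L * y)"
        by (simp add: \<epsilon>_def algebra_simps)
      then show ?thesis by (simp add: s_square flip: power_mult_distrib)
    qed
    have "\<epsilon> * g u0 = \<epsilon> + L * cosh (Im (\<omega> u0))" "\<epsilon> * g u2 = \<epsilon> + L * 1"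
      unfolding g_omega[OF u0] g_omega[OF J12(2)]
      using R0'[of u0] R0'[of u2] lt 2 Im12 eg eg[of 1] by (simp_all add: cos_W)
    ultimately show False using cosh_gt L_pos by simp
  next
    case 3
    define b where "b = Min (B ` {0..p})"
    have "0 < b" using B by (auto simp: b_def)
    have "b \<le> Im (\<omega> u)" if uI: "u \<in> I" for u
    proof -
      have "u \<in> J" using uI IJ by blast
      from omega_boundary(4)[OF J_regular[OF this]] Ipos[OF uI] R0[OF uI] 3
      obtain j where "j \<in> {1..p}" "B j \<le> Im (\<omega> u)" by auto
      moreover have "b \<le> B j" unfolding b_def using \<open>j \<in> {1..p}\<close> by (intro Min_le) auto
      ultimately show ?thesis by simp
    qed
    then have "b \<le> Im (\<omega> u1)"
      using continuous_ge_on_closure[of I "\<lambda>u. Im (\<omega> u)" u1 b] clI lt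
      by (auto intro!: continuous_intros cont12)
    then show False using \<open>0 < b\<close> Im12 by simp
  qed
qed

lemma g_error: "u \<in> J \<Longrightarrow> \<bar>1 - g u\<bar> \<le> L"
  using L_pos s_square(2) by (simp add: g_omega omega_real abs_mult mult_left_le)

text \<open>The points are first hitting times of \<open>Re \<omega> = pi * i\<close>, which are
  ordered by continuity without any monotonicity of \<open>Re \<omega>\<close>. There are
  \<open>M + 1\<close> of them because \<omega> runs from 0 to \<open>W = pi * M\<close> along the
  base, and \<open>cos\<close> alternates at multiples of pi.\<close>

lemma alternation_points:
  obtains u where "\<And>i. i \<le> M \<Longrightarrow> u i \<in> J" "\<And>i. i < M \<Longrightarrow> u i < u (Suc i)"
    "\<And>i. i \<le> M \<Longrightarrow> 1 - g (u i) = s * L * (- 1) ^ i"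
proof -
  have cont: "continuous_on J (\<lambda>u. Re (\<omega> u))" by (intro continuous_intros omega_cont)
  have aJ: "a\<^sup>2 \<in> J" "1 \<in> J" using a0 a1 by (auto simp: J_def power_le_one)
  have ex: "\<exists>v. v \<in> J \<and> Re (\<omega> v) = pi * real i \<and> (\<forall>w\<in>J. pi * real i \<le> Re (\<omega> w) \<longrightarrow> v \<le> w)" if i: "i \<le> M" for i
  proof -
    define Z where "Z = J \<inter> (\<lambda>u. Re (\<omega> u)) -` {pi * real i..}"
    have "closed Z" unfolding Z_def by (rule continuous_closed_preimage[OF cont]) (auto simp: J_def)
    then have "compact Z"
      using bounded_subset[of "{a\<^sup>2..1}" Z] by (auto simp: compact_eq_bounded_closed Z_def J_def)
    moreover have "1 \<in> Z" using i aJ by (simp add: Z_def omega_ends W_eq)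
    ultimately obtain v where v: "v \<in> Z" "\<And>w. w \<in> Z \<Longrightarrow> v \<le> w"
      using compact_attains_inf[of Z] by blast
    have vJ: "v \<in> J" "pi * real i \<le> Re (\<omega> v)" using v(1) by (auto simp: Z_def)
    have "Re (\<omega> v) = pi * real i"
    proof (rule ccontr)
      assume "Re (\<omega> v) \<noteq> pi * real i"
      then have gt: "pi * real i < Re (\<omega> v)" using vJ by simp
      have "continuous_on {a\<^sup>2..v} (\<lambda>u. Re (\<omega> u))"
        using cont by (rule continuous_on_subset) (use vJ in \<open>auto simp: J_def\<close>)
      then obtain w where w: "a\<^sup>2 \<le> w" "w \<le> v" "Re (\<omega> w) = pi * real i"
        using IVT'[of "\<lambda>u. Re (\<omega> u)" "a\<^sup>2" "pi * real i" v] gt vJ by (auto simp: omega_ends J_def)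
      then have "w \<in> Z" using vJ by (simp add: Z_def J_def)
      then show False using v(2)[of w] w gt by (cases "w = v") auto
    qed
    then show ?thesis using vJ v(2) by (auto simp: Z_def)
  qed
  then obtain u where u: "\<And>i. i \<le> M \<Longrightarrow> u i \<in> J" "\<And>i. i \<le> M \<Longrightarrow> Re (\<omega> (u i)) = pi * real i"
    "\<And>i w. i \<le> M \<Longrightarrow> w \<in> J \<Longrightarrow> pi * real i \<le> Re (\<omega> w) \<Longrightarrow> u i \<le> w"
    by metis
  show thesis
  proof (rule that[of u])
    fix i assume i: "i < M"
    have "u i \<le> u (Suc i)"
      using u(3)[of i "u (Suc i)"] u(1,2)[of "Suc i"] i by simp
    moreover have "u i \<noteq> u (Suc i)"
      using u(2)[of i] u(2)[of "Suc i"] i by force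
    ultimately show "u i < u (Suc i)" by simp
  next
    fix i assume i: "i \<le> M"
    show "1 - g (u i) = s * L * (- 1) ^ i"
      using u(2)[OF i] by (simp add: g_omega[OF u(1)[OF i]] omega_real[OF u(1)[OF i]])
  qed (use u in auto)
qed

section \<open>The extremal rational function and its uniqueness\<close>

abbreviation R where "R \<equiv> approximants m p k x"

definition den :: "real \<Rightarrow> real" where
  "den t = t ^ (2 * k 0 - 1) * (\<Prod>j=1..p. (t\<^sup>2 - (x j)\<^sup>2) ^ k j)"

lemma approximants_iff:
  "r \<in> R \<longleftrightarrow> (\<exists>c. r = (\<lambda>t. (\<Sum>i=0..2 * (M - 1). c i * t ^ i) / den t))"
proof -
  \<comment> \<open>Here \<open>0 < m\<close> ensures that the truncated subtraction is the true
    one.\<close>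
  have "2 * (m - 1 + (\<Sum>j=0..p. k j)) = 2 * (M - 1)" using m by (simp add: M_def K_def)
  then show ?thesis by (simp add: approximants_def den_def)
qed

lemma k0: "0 < k 0" using k by simp

lemma den_minus: "den (- t) = - den t"
  using k0 by (simp add: den_def power_minus_odd)

lemma nonspecial_iff:
  assumes "0 < t"
  shows "t\<^sup>2 \<notin> special \<longleftrightarrow> t \<notin> x ` {1..p}"
proof
  assume t: "t\<^sup>2 \<notin> special"
  show "t \<notin> x ` {1..p}"
  proof
    assume "t \<in> x ` {1..p}"
    then obtain j where "j \<in> {1..p}" "t = x j" by blast
    then have "t\<^sup>2 = \<xi> j" "j \<in> {0..p}" by (auto simp: \<xi>_def X_def)
    then show False using t by (auto simp: special_def)
  qed
next
  assume t: "t \<notin> x ` {1..p}"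
  show "t\<^sup>2 \<notin> special"
  proof
    assume "t\<^sup>2 \<in> special"
    then obtain j where j: "j \<le> p" "t\<^sup>2 = (X j)\<^sup>2" by (auto simp: special_def \<xi>_def)
    then have "t = X j" using assms X_nonneg[OF j(1)] by (simp add: power2_eq_iff_nonneg)
    then show False using t assms j(1) by (cases "j = 0") (auto simp: X_def)
  qed
qed

text \<open>Relates the odd denominator in \<open>t\<close> to \<open>Q\<close> in the variable
  \<open>t\<^sup>2\<close>; the extra factor \<open>t\<close> completes the exponent
  \<open>2 * k 0 - 1\<close>.\<close>

lemma den_square:
  "t * den t = (\<Prod>j=0..p. (t\<^sup>2 - \<xi> j) ^ k j)"
proof -
  have "t * t ^ (2 * k 0 - 1) = (t\<^sup>2) ^ k 0"
    using k0 by (simp flip: power_Suc power_mult)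
  moreover have "(\<Prod>j=1..p. (t\<^sup>2 - \<xi> j) ^ k j) = (\<Prod>j=1..p. (t\<^sup>2 - (x j)\<^sup>2) ^ k j)"
    by (intro prod.cong) (auto simp: \<xi>_def X_def)
  ultimately show ?thesis
    by (simp add: den_def prod.atLeast_Suc_atMost xi_0 flip: mult.assoc)
qed

text \<open>With \<open>T2 = P / Q\<close> and \<open>den_square\<close>, the quotient of
  \<open>P\<close> at \<open>t\<^sup>2\<close> by \<open>den t\<close> is \<open>t\<close> times
  \<open>T2\<close> at \<open>t\<^sup>2\<close>, which for positive \<open>t\<close> is
  \<open>g (t\<^sup>2)\<close>. An even numerator over an odd denominator makes it odd, so it serves
  \<open>sgn\<close> on both intervals.\<close>

lemma rational_form:
  obtains r where "r \<in> R" "\<And>t. r (- t) = - r t" "\<And>t. 0 < t \<Longrightarrow> t\<^sup>2 \<notin> special \<Longrightarrow> r t = g (t\<^sup>2)"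
proof -
  obtain P where P: "degree P \<le> M - 1" "\<And>z. z \<notin> poles \<Longrightarrow> poly P z = T2 z * Q z"
    using T2_polynomial unfolding M_def by blast
  \<comment> \<open>Taking real parts of the coefficients changes nothing at the points
    \<open>t\<^sup>2\<close> off the poles, because \<open>T2\<close> and \<open>Q\<close>, hence
    \<open>P\<close>, are real there.\<close>
  define c where "c i = Re (coeff P i)" for i
  define r where "r t = (\<Sum>i\<le>M - 1. c i * (t\<^sup>2) ^ i) / den t" for t
  show thesis
  proof (rule that[of r])
    show "r \<in> R"
      unfolding approximants_iff r_def
    proof (intro exI[of _ "\<lambda>i. if even i then c (i div 2) else 0"] ext)
      fix t
      have "(\<Sum>i=0..2 * (M - 1). (if even i then c (i div 2) else 0) * t ^ i) =
          (\<Sum>i\<le>2 * (M - 1). if even i then c (i div 2) * t ^ i else 0)"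
        unfolding atLeast0AtMost by (intro sum.cong) auto
      also have "\<dots> = (\<Sum>i\<le>M - 1. c i * (t\<^sup>2) ^ i)"
        unfolding sum_even_indices by (simp add: power_mult)
      finally show "(\<Sum>i\<le>M - 1. c i * (t\<^sup>2) ^ i) / den t =
          (\<Sum>i=0..2 * (M - 1). (if even i then c (i div 2) else 0) * t ^ i) / den t" by simp
    qed
    show "r (- t) = - r t" for t by (simp add: r_def den_minus)
    fix t :: real assume t: "0 < t" "t\<^sup>2 \<notin> special"
    have np: "of_real (t\<^sup>2) \<notin> poles" using t(2) by (auto simp: poles_def simp del: of_real_power)
    have Q: "Q (of_real (t\<^sup>2)) = of_real (t * den t)"
      by (simp add: Q_def den_square)
    then have den0: "den t \<noteq> 0" using Q_neq_0[OF np] by auto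
    have "poly P (of_real (t\<^sup>2)) = (\<Sum>i\<le>M - 1. coeff P i * of_real (t\<^sup>2) ^ i)"
      unfolding poly_altdef using P(1) by (intro sum.mono_neutral_left) (auto simp: coeff_eq_0)
    then have "Re (poly P (of_real (t\<^sup>2))) = (\<Sum>i\<le>M - 1. c i * (t\<^sup>2) ^ i)"
      by (simp add: c_def flip: of_real_power)
    moreover have "poly P (of_real (t\<^sup>2)) = of_real (\<tau> (t\<^sup>2) * (t * den t))"
      by (simp only: P(2)[OF np] T2_real Q of_real_mult)
    ultimately have "(\<Sum>i\<le>M - 1. c i * (t\<^sup>2) ^ i) = \<tau> (t\<^sup>2) * (t * den t)" by simp
    then show "r t = g (t\<^sup>2)" using t den0 by (simp add: r_def g_def)
  qed
qed

text \<open>On \<open>[a, 1]\<close> the factors with \<open>j > q\<close> have sign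
  \<open>(-1) ^ k j\<close> and the others are positive. The constant sign \<delta> lets
  inequalities between approximants pass to their numerators.\<close>

lemma den_sign:
  obtains \<delta> :: real where "\<bar>\<delta>\<bar> = 1" "\<And>t. a \<le> t \<Longrightarrow> t \<le> 1 \<Longrightarrow> 0 < \<delta> * den t"
proof -
  define \<delta> :: real where "\<delta> = (\<Prod>j=1..p. if j \<le> q then 1 else (- 1) ^ k j)"
  have "\<bar>\<delta>\<bar> = 1" unfolding \<delta>_def abs_prod by (intro prod.neutral) (auto simp: power_abs)
  moreover have "0 < \<delta> * den t" if t: "a \<le> t" "t \<le> 1" for t
  proof -
    have "0 < (if j \<le> q then 1 else (- 1) ^ k j) * (t\<^sup>2 - (x j)\<^sup>2) ^ k j" if "j \<in> {1..p}" for j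
    proof (cases "j \<le> q")
      case True
      then have "0 < x j \<and> x j < a" using x_left that by simp
      then have "0 < x j" "x j < t" using t by auto
      then have "(x j)\<^sup>2 < t\<^sup>2" by (intro power_strict_mono) auto
      then show ?thesis using True by simp
    next
      case False
      then have "1 < x j" using x_right that by simp
      then have "t < x j" using t by simp
      then have "t\<^sup>2 < (x j)\<^sup>2" using t a0 by (intro power_strict_mono) auto
      then have "0 < ((- 1) * (t\<^sup>2 - (x j)\<^sup>2)) ^ k j" by simp
      then show ?thesis using False by (simp only: power_mult_distrib) simp
    qed
    then have "0 < (\<Prod>j=1..p. (if j \<le> q then 1 else (- 1) ^ k j) * (t\<^sup>2 - (x j)\<^sup>2) ^ k j)"
      by (intro prod_pos) auto
    then have "0 < \<delta> * (\<Prod>j=1..p. (t\<^sup>2 - (x j)\<^sup>2) ^ k j)" by (simp add: \<delta>_def prod.distrib)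
    then have "0 < t ^ (2 * k 0 - 1) * (\<delta> * (\<Prod>j=1..p. (t\<^sup>2 - (x j)\<^sup>2) ^ k j))"
      using t a0 by (intro mult_pos_pos[OF zero_less_power]) auto
    then show ?thesis by (simp only: den_def mult_ac)
  qed
  ultimately show thesis by (rule that)
qed

definition domain :: "real set" where "domain = {t. a \<le> \<bar>t\<bar> \<and> \<bar>t\<bar> \<le> 1}"

text \<open>A real supremum dominates the single errors only over a bounded set; boundedness follows
  because the denominator has no zero on the compact domain.\<close>

lemma deviation_bdd:
  assumes "r \<in> R"
  shows "bdd_above ((\<lambda>t. \<bar>sgn t - r t\<bar>) ` domain)"
proof -
  obtain c where c: "r = (\<lambda>t. (\<Sum>i=0..2 * (M - 1). c i * t ^ i) / den t)"
    using assms approximants_iff by blast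
  obtain \<delta> where \<delta>: "\<And>t. a \<le> t \<Longrightarrow> t \<le> 1 \<Longrightarrow> 0 < \<delta> * den t"
    using den_sign by blast
  have den0: "den t \<noteq> 0" if "t \<in> domain" for t
  proof (cases "0 \<le> t")
    case True
    then show ?thesis using \<delta>[of t] that by (auto simp: domain_def)
  next
    case False
    then show ?thesis using \<delta>[of "- t"] that by (auto simp: domain_def den_minus)
  qed
  have "domain = {a..1} \<union> {-1..-a}" using a0 by (auto simp: domain_def)
  then have "compact domain" by (simp add: compact_Un)
  moreover have "continuous_on domain r"
    unfolding c using den0 unfolding den_def by (intro continuous_intros) auto
  ultimately have "compact (r ` domain)" by (intro compact_continuous_image)
  from compact_imp_bounded[OF this]
  obtain b where "\<forall>v\<in>r ` domain. norm v \<le> b" unfolding bounded_iff by blast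
  then have b: "\<And>t. t \<in> domain \<Longrightarrow> \<bar>r t\<bar> \<le> b" by simp
  show ?thesis
  proof (rule bdd_aboveI2)
    fix t assume "t \<in> domain"
    moreover have "\<bar>sgn t\<bar> \<le> 1" by (simp add: abs_sgn_eq)
    ultimately show "\<bar>sgn t - r t\<bar> \<le> 1 + b"
      using b[of t] abs_triangle_ineq4[of "sgn t" "r t"] by linarith
  qed
qed

lemma sgn_deviation_eq: "sgn_deviation a r = (SUP t\<in>domain. \<bar>sgn t - r t\<bar>)"
  by (simp add: sgn_deviation_def domain_def)

lemma deviation_ge: "r \<in> R \<Longrightarrow> t \<in> domain \<Longrightarrow> \<bar>sgn t - r t\<bar> \<le> sgn_deviation a r"
  unfolding sgn_deviation_eq by (intro cSUP_upper deviation_bdd)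

text \<open>A competitor that is no worse differs from \<open>r\<close> by \<open>D / den\<close>,
  and \<open>D\<close> alternates weakly at the points \<open>sqrt (u i)\<close>. At the mirror
  points both \<open>den\<close> and the error of \<open>r\<close> change sign, so the signs of
  \<open>D\<close> repeat, as \<open>symmetric_alternation_zero\<close> requires. Since uniqueness
  is claimed among all deviations at most \<open>L\<close>, optimality follows from it.\<close>

lemma extremal:
  obtains r where "r \<in> R" "sgn_deviation a r = L"
    "\<And>r'. r' \<in> R \<Longrightarrow> sgn_deviation a r' \<le> L \<Longrightarrow> r' = r"
    "\<And>t. 0 < t \<Longrightarrow> t\<^sup>2 \<notin> special \<Longrightarrow> r t = g (t\<^sup>2)"
proof -
  obtain r where r: "r \<in> R" "\<And>t. r (- t) = - r t" "\<And>t. 0 < t \<Longrightarrow> t\<^sup>2 \<notin> special \<Longrightarrow> r t = g (t\<^sup>2)"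
    using rational_form by blast
  obtain u where u: "\<And>i. i \<le> M \<Longrightarrow> u i \<in> J" "\<And>i. i < M \<Longrightarrow> u i < u (Suc i)"
    "\<And>i. i \<le> M \<Longrightarrow> 1 - g (u i) = s * L * (- 1) ^ i"
    using alternation_points by blast
  obtain \<delta> where \<delta>: "\<bar>\<delta>\<bar> = 1" "\<And>t. a \<le> t \<Longrightarrow> t \<le> 1 \<Longrightarrow> 0 < \<delta> * den t"
    using den_sign by blast
  have err: "\<bar>1 - r t\<bar> \<le> L" if "a \<le> t" "t \<le> 1" for t
  proof -
    have "t\<^sup>2 \<in> J" using that a0 by (auto simp: J_def power_mono power_le_one)
    then show ?thesis using g_error r(3)[of t] J_regular(2) that a0 by simp
  qed
  have err': "\<bar>sgn t - r t\<bar> \<le> L" if "t \<in> domain" for t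
  proof (cases "0 < t")
    case True
    then show ?thesis using err[of t] that by (simp add: domain_def)
  next
    case False
    then have "t < 0" using that a0 by (auto simp: domain_def)
    then show ?thesis using err[of "- t"] that r(2)[of t] by (simp add: domain_def abs_minus_commute)
  qed
  have sq: "a \<le> sqrt (u i)" "sqrt (u i) \<le> 1" "r (sqrt (u i)) = g (u i)" if "i \<le> M" for i
  proof -
    have "a\<^sup>2 \<le> u i" "u i \<le> 1" using u(1)[OF that] by (auto simp: J_def)
    then show "a \<le> sqrt (u i)" "sqrt (u i) \<le> 1" using a0 by (auto simp: real_le_rsqrt)
    show "r (sqrt (u i)) = g (u i)"
      using r(3)[of "sqrt (u i)"] J_regular[OF u(1)[OF that]] by simp
  qed
  have dom: "sqrt (u i) \<in> domain" "- sqrt (u i) \<in> domain" if "i \<le> M" for i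
    using sq[OF that] J_regular(1)[OF u(1)[OF that]] by (auto simp: domain_def)
  have Mpos: "0 < M" using m by (simp add: M_def)
  have dev: "sgn_deviation a r = L"
  proof (rule antisym)
    show "sgn_deviation a r \<le> L"
      unfolding sgn_deviation_eq using err' dom(1)[of 0] by (intro cSUP_least) auto
    have "\<bar>sgn (sqrt (u 0)) - r (sqrt (u 0))\<bar> = L"
      using sq[of 0] u(3)[of 0] J_regular(1)[OF u(1)[of 0]] L_pos s_square(2) by (simp add: abs_mult)
    then show "L \<le> sgn_deviation a r" using deviation_ge[OF r(1) dom(1)[of 0]] by simp
  qed
  have uniq: "r' = r" if r': "r' \<in> R" "sgn_deviation a r' \<le> L" for r'
  proof -
    obtain c where c: "r = (\<lambda>t. (\<Sum>i=0..2 * (M - 1). c i * t ^ i) / den t)"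
      using r(1) approximants_iff by blast
    obtain c' where c': "r' = (\<lambda>t. (\<Sum>i=0..2 * (M - 1). c' i * t ^ i) / den t)"
      using r'(1) approximants_iff by blast
    have le: "\<bar>sgn t - r' t\<bar> \<le> L" if "t \<in> domain" for t
      using deviation_ge[OF r'(1) that] r'(2) by simp
    define D where "D = (\<Sum>i=0..2 * (M - 1). monom (c' i - c i) i)"
    have D: "poly D t = (\<Sum>i=0..2 * (M - 1). c' i * t ^ i) - (\<Sum>i=0..2 * (M - 1). c i * t ^ i)" for t
      by (simp add: D_def poly_sum poly_monom left_diff_distrib sum_subtractf)
    have Dr: "poly D t = den t * (r' t - r t)" if "den t \<noteq> 0" for t
      using that by (simp add: D c c' field_simps)
    have ss: "s * (s * y) = y" for y using s_square(1) by (metis mult.assoc mult_1)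
    have ee: "(- 1) ^ i * ((- 1) ^ i * y) = (y :: real)" for i y
      by (simp flip: mult.assoc power_mult_distrib)
    \<comment> \<open>The factor \<open>\<delta> * s\<close> removes the sign of the denominator and
      that of the first extremal error, so the pattern starts with a nonnegative value.\<close>
    have "smult (\<delta> * s) D = 0"
    proof (rule symmetric_alternation_zero[where M = M and u = u])
      show "degree (smult (\<delta> * s) D) \<le> 2 * (M - 1)"
        unfolding D_def
        by (intro order_trans[OF degree_smult_le] degree_sum_le) (auto intro: order_trans[OF degree_monom_le])
      show "0 < M" by (rule Mpos)
      show "strict_mono_on {..M} u"
      proof (rule strict_mono_onI)
        fix i j assume "i \<in> {..M}" "j \<in> {..M}" "i < j"
        then show "u i < u j"
        proof (induction j)
          case (Suc j)
          then show ?case using u(2)[of j] by (cases "i = j") auto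
        qed simp
      qed
      show "0 < u i" if "i \<le> M" for i using J_regular(1)[OF u(1)[OF that]] .
      fix i assume i: "i \<le> M"
      define t where "t = sqrt (u i)"
      have t: "0 < t" "0 < \<delta> * den t" using sq[OF i] \<delta>(2)[of t] J_regular(1)[OF u(1)[OF i]] by (auto simp: t_def)
      then have den: "den t \<noteq> 0" "den (- t) \<noteq> 0" by (auto simp: den_minus)
      have e: "1 - r t = s * L * (- 1) ^ i" using sq(3)[OF i] u(3)[OF i] by (simp add: t_def)
      define \<epsilon> where "\<epsilon> = s * (- 1) ^ i"
      have \<epsilon>: "\<bar>\<epsilon>\<bar> = 1" "\<epsilon> * \<epsilon> = 1"
        using s_square by (auto simp: \<epsilon>_def abs_mult power_abs mult.assoc mult.left_commute ss ee)
      have e': "1 - r t = \<epsilon> * L" using e by (simp add: \<epsilon>_def)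
      have "\<bar>1 - r' t\<bar> \<le> L" using le[OF dom(1)[OF i]] t(1) by (simp add: t_def)
      then have "\<epsilon> * (1 - r' t) \<le> L"
        using \<epsilon>(1) abs_ge_self[of "\<epsilon> * (1 - r' t)"] by (simp add: abs_mult)
      then have "0 \<le> \<epsilon> * (\<epsilon> * L) - \<epsilon> * (1 - r' t)" using \<epsilon>(2) by (simp flip: mult.assoc)
      then have "0 \<le> \<epsilon> * (r' t - r t)" unfolding e'[symmetric] by (simp add: algebra_simps)
      then have "0 \<le> (\<delta> * den t) * (\<epsilon> * (r' t - r t))" using t(2) by simp
      then show "0 \<le> (- 1) ^ i * poly (smult (\<delta> * s) D) (sqrt (u i))"
        using Dr[OF den(1)] by (simp add: \<epsilon>_def t_def mult_ac)
      have "\<bar>- 1 - r' (- t)\<bar> \<le> L" using le[OF dom(2)[OF i]] t(1) by (simp add: t_def)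
      then have "- \<epsilon> * (- 1 - r' (- t)) \<le> L"
        using \<epsilon>(1) abs_ge_self[of "- \<epsilon> * (- 1 - r' (- t))"] by (simp add: abs_mult)
      then have "0 \<le> \<epsilon> * (\<epsilon> * L) + \<epsilon> * (- 1 - r' (- t))" using \<epsilon>(2) by (simp flip: mult.assoc)
      then have "0 \<le> - (\<epsilon> * (r' (- t) - r (- t)))"
        unfolding e'[symmetric] r(2) by (simp add: algebra_simps)
      then have "0 \<le> (\<delta> * den t) * (- (\<epsilon> * (r' (- t) - r (- t))))"
        by (rule mult_nonneg_nonneg[OF less_imp_le[OF t(2)]])
      then show "0 \<le> (- 1) ^ i * poly (smult (\<delta> * s) D) (- sqrt (u i))"
        using Dr[OF den(2)] by (simp add: \<epsilon>_def t_def den_minus mult_ac)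
    qed
    then have "D = 0" using \<delta>(1) s_square(2) by auto
    then have "(\<Sum>i=0..2 * (M - 1). c' i * t ^ i) = (\<Sum>i=0..2 * (M - 1). c i * t ^ i)" for t
      using D[of t] by simp
    then show "r' = r" by (simp add: c c')
  qed
  show thesis by (rule that[OF r(1) dev uniq r(3)])
qed

lemma best_approximation:
  "best_sgn_error a R = L \<and> (\<exists>!r. extremal_approximant a R r) \<and>
     (\<forall>r. extremal_approximant a R r \<longrightarrow>
        (\<forall>t>0. t \<notin> x ` {1..p} \<longrightarrow>
           (\<exists>w. (\<phi> \<longlongrightarrow> w) (at (of_real t) within first_quadrant) \<and>
                of_real (r t) = 1 - (- 1) ^ N * of_real L * cos w)))"
proof -
  obtain r where r: "r \<in> R" "sgn_deviation a r = L"
    "\<And>r'. r' \<in> R \<Longrightarrow> sgn_deviation a r' \<le> L \<Longrightarrow> r' = r"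
    "\<And>t. 0 < t \<Longrightarrow> t\<^sup>2 \<notin> special \<Longrightarrow> r t = g (t\<^sup>2)"
    using extremal by blast
  have best: "best_sgn_error a R = L"
    unfolding best_sgn_error_def
  proof (rule cInf_eq_minimum)
    show "L \<in> sgn_deviation a ` R" using imageI[OF r(1), of "sgn_deviation a"] r(2) by simp
    fix d assume "d \<in> sgn_deviation a ` R"
    then obtain r' where r': "r' \<in> R" "d = sgn_deviation a r'" by blast
    show "L \<le> d"
    proof (rule ccontr)
      assume "\<not> L \<le> d"
      then have "r' = r" using r' by (intro r(3)) auto
      then show False using r' r(2) \<open>\<not> L \<le> d\<close> by simp
    qed
  qed
  have ext: "extremal_approximant a R r' \<longleftrightarrow> r' = r" for r'
    unfolding extremal_approximant_def best using r(1-3) by (metis order_refl)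
  have "\<exists>w. (\<phi> \<longlongrightarrow> w) (at (of_real t) within first_quadrant) \<and>
      of_real (r t) = 1 - (- 1) ^ N * of_real L * cos w" if t: "0 < t" "t \<notin> x ` {1..p}" for t
  proof (intro exI conjI)
    have ns: "t\<^sup>2 \<notin> special" using nonspecial_iff t by blast
    show "(\<phi> \<longlongrightarrow> \<omega> (t\<^sup>2)) (at (of_real t) within first_quadrant)"
      by (rule phi_limit[OF t(1) ns])
    show "of_real (r t) = 1 - (- 1) ^ N * of_real L * cos (\<omega> (t\<^sup>2))"
      using omega_limit(2)[of "t\<^sup>2"] ns t(1) r(4)[OF t(1) ns] by (simp add: g_def s_def)
  qed
  then show ?thesis unfolding ext using best by blast
qed

end

theorem theorem2:
  fixes q p m :: nat and k :: "nat \<Rightarrow> nat" and x B :: "nat \<Rightarrow> real" and a :: real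
    and \<phi> :: "complex \<Rightarrow> complex"
  assumes "q \<le> p" and "0 < m" and "\<forall>j\<in>{0..p}. 0 < k j"
    and "0 < a" and "a < 1"
    and "strict_mono_on {1..p} x"
    and "\<forall>j\<in>{1..q}. 0 < x j \<and> x j < a"
    and "\<forall>j\<in>{q+1..p}. 1 < x j"
    and "\<forall>j\<in>{0..p}. 0 < B j"
    and "normalized_comb_map q m p k B a \<phi>"
    and "prescribed_ends q m p k B x \<phi>"
  shows "let L = 1 / cosh (B 0); R = approximants m p k x in
     best_sgn_error a R = L \<and>
     (\<exists>!r. extremal_approximant a R r) \<and>
     (\<forall>r. extremal_approximant a R r \<longrightarrow>
        (\<forall>t>0. t \<notin> x ` {1..p} \<longrightarrow>
           (\<exists>w. (\<phi> \<longlongrightarrow> w) (at (of_real t) within first_quadrant) \<and>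
                of_real (r t) = 1 - (- 1) ^ (\<Sum>j=0..q. k j) * of_real L * cos w)))"
proof -
  interpret comb q p m k x B a \<phi>
    using assms by (rule comb.intro)
  show ?thesis
    using best_approximation unfolding Let_def L_def N_def .
qed

end
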